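(* Let $f,g$ be Bernstein functions and $\lambda,\eta>0$. Let $Y_f^{g}(t)=\sum_{i=1}^{N_f(t)}X_i$, $t\ge0$, where the iid jumps $X_i$ satisfy $\mathbb{P}(X_i>t)=\mathbb{E}[e^{-\eta E_g(t)}]$, $t\ge0$, and let $Y_f^\eta(t)=\sum_{i=1}^{N_f(t)}X'_i$ with iid exponential jumps $X'_i$ of parameter $\eta$. Let $\{D_g(t)\}_{t\ge0}$ be the L\'evy subordinator with Bernstein function $g$, independent of $\{Y_f^\eta(t)\}_{t\ge0}$. Then $$Y_f^g(t)\stackrel{d}{=}D_g\big(Y_f^\eta(t)\big).$$ Moreover, the probability density function $P^g_f(x,t)$, $x>0$, of $Y_f^g(t)$ satisfies $$\eta\,\mathcal{D}^f_tP^g_f(x,t)=-\left[\lambda+\mathcal{D}^f_t\right]\mathcal{D}^g_xP^g_f(x,t),$$ with the conditions $$P^g_f(x,0)=0,\qquad \mathbb{P}(Y^g_f(t)>0)=1-\mathbb{E}[e^{-\lambda E_f(t)}].$$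
   Context: A Bernstein function here is $f(s)=bs+\int_0^\infty(1-e^{-sx})\,\nu(dx)$, $s>0$, with $b\ge 0$ and $\nu$ a non-negative L\'evy measure on $(0,\infty)$ with $\int_0^\infty (x\wedge 1)\,\nu(dx)<\infty$ and $\nu((0,\infty))=\infty$; $g$ is of the same form with its own drift and L\'evy measure. For such $f$, $\{D_f(t)\}_{t\ge0}$ is the L\'evy subordinator with $\mathbb{E}[e^{-sD_f(t)}]=e^{-tf(s)}$ and $E_f(t)=\inf\{r\ge0: D_f(r)>t\}$ its inverse; $D_g,E_g$ are defined likewise from $g$. Let $\{N(t)\}_{t\ge0}$ be a Poisson process with rate $\lambda>0$ independent of $\{E_f(t)\}$, and $N_f(t)=N(E_f(t))$. In each process the jumps are independent of $N$ and $E_f$, and an empty sum is $0$. Thus $Y_f^g(t)$ has an atom at $0$, and $P_f^g(x,t)$ denotes the density of its law on $(0,\infty)$. The symbol $\stackrel{d}{=}$ denotes equality in distribution for each $t$. The jumps $X_i$ have Laplace transform $\mathbb{E}[e^{-sX_1}]=\eta/(g(s)+\eta)$. The generalized Caputo–Djrbashian derivative with respect to $f$ is, for absolutely continuous $u$, $$\mathcal{D}^f_t u(t)=b\frac{d}{dt}u(t)+\int_0^t\frac{\partial}{\partial t}u(t-s)\,\bar\nu(s)\,ds,\qquad \bar\nu(s)=\nu((s,\infty)),$$ and $\mathcal{D}^g_x$ is the same operator in the variable $x$ with the drift and L\'evy measure of $g$.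
   Formalization: The equation is proved a.e. for any density regular enough for both operators (D_x^g P locally integrable); as P is not absolutely continuous at x=0, D_x^g u is read as b u' + d/dx∫u(x-s)ν̄(s)ds − u(0)ν̄(x) with P(0,t)=0. *)

theory Defs
  imports "HOL-Probability.Probability"
begin

section \<open>Bernstein functions and Levy processes\<close>

definition bernstein_function :: "real \<Rightarrow> real measure \<Rightarrow> (real \<Rightarrow> real) \<Rightarrow> bool" where
  "bernstein_function b \<nu> f \<longleftrightarrow>
     0 \<le> b \<and> sets \<nu> = sets borel \<and> emeasure \<nu> {..0} = 0 \<and>
     (\<integral>\<^sup>+x\<in>{0<..}. ennreal (min x 1) \<partial>\<nu>) < \<infinity> \<and> emeasure \<nu> {0<..} = \<infinity> \<and>
     (\<forall>s>0. f s = b * s + (LINT x:{0<..}|\<nu>. 1 - exp (- s * x)))"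

definition levy_tail :: "real measure \<Rightarrow> real \<Rightarrow> real" where
  "levy_tail \<nu> s = measure \<nu> {s<..}"

definition independent_increments :: "'a measure \<Rightarrow> (real \<Rightarrow> 'a \<Rightarrow> real) \<Rightarrow> bool" where
  "independent_increments M Z \<longleftrightarrow>
     (\<forall>\<tau>::nat \<Rightarrow> real. 0 \<le> \<tau> 0 \<and> incseq \<tau> \<longrightarrow>
        prob_space.indep_vars M (\<lambda>_. borel) (\<lambda>k \<omega>. Z (\<tau> (Suc k)) \<omega> - Z (\<tau> k) \<omega>) UNIV)"

text \<open>
  Time is \<open>real\<close>; processes start at 0 and are set to 0 at negative times. The latter is
  only a convention: it keeps a process evaluated at a random time measurable even on the null
  events where that time is negative or the infimum below is taken over the empty set.
\<close>

definition right_continuous_increasing :: "(real \<Rightarrow> real) \<Rightarrow> bool" where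
  "right_continuous_increasing z \<longleftrightarrow>
     (\<forall>t\<le>0. z t = 0) \<and> mono z \<and> (\<forall>t\<ge>0. continuous (at_right t) z)"

definition subordinator :: "'a measure \<Rightarrow> (real \<Rightarrow> real) \<Rightarrow> (real \<Rightarrow> 'a \<Rightarrow> real) \<Rightarrow> bool" where
  "subordinator M f D \<longleftrightarrow>
     (\<forall>t\<ge>0. D t \<in> borel_measurable M) \<and>
     (\<forall>\<omega>\<in>space M. right_continuous_increasing (\<lambda>t. D t \<omega>)) \<and>
     independent_increments M D \<and>
     (\<forall>s\<ge>0. \<forall>t\<ge>0. distr M borel (\<lambda>\<omega>. D (s + t) \<omega> - D s \<omega>) = distr M borel (D t)) \<and>
     (\<forall>s>0. \<forall>t\<ge>0. (LINT \<omega>|M. exp (- s * D t \<omega>)) = exp (- t * f s))"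

definition inverse_process :: "(real \<Rightarrow> 'a \<Rightarrow> real) \<Rightarrow> real \<Rightarrow> 'a \<Rightarrow> real" where
  "inverse_process D t \<omega> = Inf {r. 0 \<le> r \<and> t < D r \<omega>}"

definition poisson_process :: "'a measure \<Rightarrow> real \<Rightarrow> (real \<Rightarrow> 'a \<Rightarrow> nat) \<Rightarrow> bool" where
  "poisson_process M rate N \<longleftrightarrow>
     (\<forall>t\<ge>0. N t \<in> measurable M (count_space UNIV)) \<and>
     (\<forall>\<omega>\<in>space M. right_continuous_increasing (\<lambda>t. real (N t \<omega>))) \<and>
     independent_increments M (\<lambda>t \<omega>. real (N t \<omega>)) \<and>
     (\<forall>s\<ge>0. \<forall>t>0. distr M (count_space UNIV) (\<lambda>\<omega>. N (s + t) \<omega> - N s \<omega>)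
                     = measure_pmf (poisson_pmf (rate * t)))"

definition process_events :: "'a measure \<Rightarrow> 'i set \<Rightarrow> ('i \<Rightarrow> 'a \<Rightarrow> real) \<Rightarrow> 'a set set" where
  "process_events M I Z =
     sigma_sets (space M) {Z i -` A \<inter> space M | i A. i \<in> I \<and> A \<in> sets borel}"

text \<open>The jumps are indexed from 1, so only the values \<open>X i\<close> with \<open>i \<ge> 1\<close> matter.\<close>

definition iid_jumps :: "'a measure \<Rightarrow> (nat \<Rightarrow> 'a \<Rightarrow> real) \<Rightarrow> bool" where
  "iid_jumps M X \<longleftrightarrow>
     prob_space.indep_vars M (\<lambda>_. borel) X {1..} \<and>
     (\<forall>i\<ge>1. distr M borel (X i) = distr M borel (X 1))"

definition jumps_independent ::
  "'a measure \<Rightarrow> (real \<Rightarrow> 'a \<Rightarrow> nat) \<Rightarrow> (real \<Rightarrow> 'a \<Rightarrow> real) \<Rightarrow> (nat \<Rightarrow> 'a \<Rightarrow> real) \<Rightarrow> bool" where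
  "jumps_independent M N E X \<longleftrightarrow>
     prob_space.indep_sets M
       (\<lambda>k. [process_events M {0..} (\<lambda>t \<omega>. real (N t \<omega>)),
             process_events M {0..} E,
             process_events M {1..} X] ! k) {0, 1, 2}"

definition compound_process ::
  "(real \<Rightarrow> 'a \<Rightarrow> nat) \<Rightarrow> (real \<Rightarrow> 'a \<Rightarrow> real) \<Rightarrow> (nat \<Rightarrow> 'a \<Rightarrow> real) \<Rightarrow> real \<Rightarrow> 'a \<Rightarrow> real" where
  "compound_process N E X t \<omega> = (\<Sum>i = 1..N (E t \<omega>) \<omega>. X i \<omega>)"


section \<open>The generalized Caputo--Djrbashian derivative\<close>

text \<open>Absolute continuity on a compact interval, as being an indefinite Lebesgue integral.\<close>

definition abs_cont :: "real \<Rightarrow> real \<Rightarrow> (real \<Rightarrow> real) \<Rightarrow> bool" where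
  "abs_cont a b u \<longleftrightarrow>
     (\<exists>v. set_integrable lebesgue {a..b} v \<and>
          (\<forall>t\<in>{a..b}. u t = u a + (LINT s:{a..t}|lebesgue. v s)))"

text \<open>
  For absolutely continuous \<open>u\<close> the operator is
  \<open>b u'(t) + \<integral>\<^sub>0\<^sup>t \<partial>\<^sub>t u(t - s) \<nu>(s,\<infinity>) ds\<close>. For such \<open>u\<close>, almost everywhere,
  \<open>d/dt \<integral>\<^sub>0\<^sup>t u(t - s) \<nu>(s,\<infinity>) ds = u(0) \<nu>(t,\<infinity>) + \<integral>\<^sub>0\<^sup>t \<partial>\<^sub>t u(t - s) \<nu>(s,\<infinity>) ds\<close>,
  and this identity is used to extend the operator to functions that are not absolutely
  continuous up to 0. The extension is what the space variable needs: the densities below, set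
  to 0 at the origin, jump there if the drift is positive and are unbounded near it if the drift
  vanishes.
\<close>

definition caputo :: "real \<Rightarrow> real measure \<Rightarrow> (real \<Rightarrow> real) \<Rightarrow> real \<Rightarrow> real" where
  "caputo b \<nu> u t =
     b * deriv u t +
     (if \<forall>T>0. abs_cont 0 T u
      then LINT s:{0<..<t}|lebesgue. deriv (\<lambda>r. u (r - s)) t * levy_tail \<nu> s
      else deriv (\<lambda>r. LINT s:{0<..<r}|lebesgue. u (r - s) * levy_tail \<nu> s) t - u 0 * levy_tail \<nu> t)"

definition caputo_domain :: "real \<Rightarrow> real measure \<Rightarrow> (real \<Rightarrow> real) \<Rightarrow> bool" where
  "caputo_domain b \<nu> u \<longleftrightarrow>
     (\<forall>T>0. abs_cont 0 T u) \<or>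
     (\<forall>t>0. set_integrable lebesgue {0<..<t} (\<lambda>s. u (t - s) * levy_tail \<nu> s)) \<and>
     (\<forall>a>0. \<forall>c>a. (b \<noteq> 0 \<longrightarrow> abs_cont a c u) \<and>
        abs_cont a c (\<lambda>r. LINT s:{0<..<r}|lebesgue. u (r - s) * levy_tail \<nu> s))"


section \<open>Densities on the positive half-line\<close>

text \<open>
  \<open>P x t\<close> is the density at \<open>x\<close> of the law of \<open>Y t\<close> on the positive half-line (the atom at 0 is
  left out), extended by 0 to \<open>x \<le> 0\<close>.
\<close>

definition positive_density ::
  "'a measure \<Rightarrow> (real \<Rightarrow> 'a \<Rightarrow> real) \<Rightarrow> (real \<Rightarrow> real \<Rightarrow> real) \<Rightarrow> bool" where
  "positive_density M Y P \<longleftrightarrow>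
     (\<lambda>(x, t). P x t) \<in> borel_measurable borel \<and>
     (\<forall>x t. 0 \<le> P x t) \<and> (\<forall>x\<le>0. \<forall>t. P x t = 0) \<and>
     (\<forall>t\<ge>0. \<forall>A\<in>sets borel. A \<subseteq> {0<..} \<longrightarrow>
        emeasure M {\<omega> \<in> space M. Y t \<omega> \<in> A} = (\<integral>\<^sup>+x\<in>A. ennreal (P x t) \<partial>lborel))"

text \<open>
  The operators in the equation are applied to \<open>P\<close> in each variable and, in time, to the space
  derivative of \<open>P\<close>; the last is assumed locally integrable on \<open>(0,\<infinity>) \<times> [0,\<infinity>)\<close>.
\<close>

definition equation_regular ::
  "real \<Rightarrow> real measure \<Rightarrow> real \<Rightarrow> real measure \<Rightarrow> (real \<Rightarrow> real \<Rightarrow> real) \<Rightarrow> bool" where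
  "equation_regular bf \<nu>f bg \<nu>g P \<longleftrightarrow>
     (\<forall>t\<ge>0. caputo_domain bg \<nu>g (\<lambda>x. P x t)) \<and>
     (AE x in lborel. 0 < x \<longrightarrow>
        caputo_domain bf \<nu>f (\<lambda>t. P x t) \<and>
        caputo_domain bf \<nu>f (\<lambda>t. caputo bg \<nu>g (\<lambda>y. P y t) x)) \<and>
     (\<forall>a>0. \<forall>c>a. \<forall>T>0.
        set_integrable lborel ({a..c} \<times> {0..T}) (\<lambda>(x, t). caputo bg \<nu>g (\<lambda>y. P y t) x))"

end

(*
  Laplace transforms.  Up to a null set {r. t < D_g r} is the half-line above E_g t, so
  P(X > t) = E exp (- eta E_g t) says that X is distributed as D_g at an independent exponential
  time, and E exp (- s X) = eta / (eta + g s).  Conditioning on N and on E_f then gives both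
  Y_f^g (t) and D_g (Y_f^eta (t)) the transform E exp (- mu E_f t), mu = lam g s / (eta + g s).

  The equation.  Let k_f be the measure b delta_0 + nu (s, infinity) ds, whose transform is f s / s;
  then D^f u is the derivative of k_f * u whenever u 0 = 0.  The transform of P in both variables is
  explicit and yields, with * in the variable shown and 1 the constant function,
    eta k_f *_t (1 *_x P) + k_f *_t (k_g *_x P) + lam 1 *_t (k_g *_x P)
      = lam eta (integral over [0,t] of E exp (- lam E_f r) dr),
  where all terms are non-negative.  The right-hand side does not depend on x, so differences in x
  eliminate it; since k_g *_x P is an indefinite integral of D^g_x P, Fubini and Lebesgue's
  differentiation theorem remove the integration in x.  What remains is, for almost every x, an
  identity between indefinite integrals in t, and the same argument in t gives the equation.
*)
theory Submission
  imports Defs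
begin

text \<open>The space derivative of \<open>P\<close> is only known to be locally integrable: neither
  its sign nor its growth in time is controlled, so it cannot be Laplace transformed. The equation
  is therefore integrated in both variables until only convolutions of \<open>P\<close> itself
  remain. These take values in \<open>ennreal\<close>, where Tonelli's theorem and uniqueness of
  transforms ask for no integrability. Finiteness is gained afterwards, because the right-hand side
  is finite for every \<open>t\<close>; only then can values at two points be subtracted. Identities
  obtained from transforms hold almost everywhere. Undoing an integration must thus make do with
  endpoints from a set of full measure, and the null set of times must not depend on the space
  interval. Hence transforms are compared at integers only, and countably many compact boxes exhaust
  the quadrant. The constant right-hand side stems from the atom: the space transform of
  \<open>P\<close> is the difference of E exp (- mu E_f t) and P(Y = 0) = E exp (- lam E_f
  t).\<close>

section \<open>Lebesgue differentiation and absolute continuity\<close>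

text \<open>The exceptional points are covered, up to a null set, by disjoint intervals with average
  above \<open>s\<close> inside an open set \<open>U\<close> for which \<open>\<bar>h - r\<bar>\<close> has small integral over
  \<open>U - {x. h x < r}\<close>; this makes the total length of the intervals small.\<close>

lemma negligible_upper_density:
  fixes h :: "real \<Rightarrow> real"
  assumes h: "integrable lborel h" and rs: "r < s"
  shows "negligible {x. h x < r \<and> (\<forall>d>0. \<exists>y z. y < x \<and> x < z \<and> z - y < d \<and> s * (z - y) < (LINT t:{y<..<z}|lborel. h t))}"
    (is "negligible ?E")
proof -
  have hm [measurable]: "h \<in> borel_measurable borel" using h by auto
  have "negligible (?E \<inter> {-real n<..<real n})" for n
  proof (rule negligible_outer_le[THEN iffD2], intro allI impI)
    fix e0 :: real assume e0: "0 < e0"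
    \<comment> \<open>The union \<open>W\<close> of the selected intervals will satisfy (s - r) *
      |W| \<le> e, which with this choice reads |W| \<le> e0.\<close>
    define e where "e = e0 * (s - r)"
    have e: "0 < e" using e0 rs by (simp add: e_def)
    define A where "A = {x. h x < r} \<inter> {-real n<..<real n}"
    have A [measurable]: "A \<in> sets borel" unfolding A_def by measurable
    define k where "k x = indicator {-real n<..<real n} x * \<bar>h x - r\<bar>" for x
    have k [measurable]: "k \<in> borel_measurable borel" unfolding k_def by measurable
    have kint: "integrable lborel k"
    proof -
      have "integrable lborel (\<lambda>x. indicator {-real n<..<real n} x *\<^sub>R (h x - r))"
        unfolding scaleR_diff_right
        by (intro Bochner_Integration.integrable_diff integrable_mult_indicator[OF _ h] integrable_indicator) auto
      from integrable_abs[OF this] show ?thesis unfolding k_def by (simp add: abs_mult)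
    qed
    \<comment> \<open>Weighting Lebesgue measure by |h - r| lets outer regularity bound the integral
      of |h - r| over \<open>U - A\<close> directly. The cut-off to (-n, n) makes the weighted
      measure finite.\<close>
    define \<mu> where "\<mu> = density lborel k"
    have fin: "emeasure \<mu> (space \<mu>) \<noteq> \<infinity>"
      using integrableD(2)[OF kint] by (simp add: \<mu>_def emeasure_density k_def)
    have s\<mu>: "sets \<mu> = sets borel" by (simp add: \<mu>_def)
    have finA: "emeasure \<mu> A \<noteq> \<infinity>" using fin emeasure_space[of \<mu> A] by (auto simp: top_unique)
    have "emeasure \<mu> A < emeasure \<mu> A + ennreal e" using finA e
      by (metis ennreal_add_left_cancel_less add.right_neutral ennreal_eq_0_iff infinity_ennreal_def linorder_not_le zero_less_iff_neq_zero)
    then have "(INF U\<in>{U. A \<subseteq> U \<and> open U}. emeasure \<mu> U) < emeasure \<mu> A + ennreal e"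
      using outer_regular[OF s\<mu> fin A] by simp
    then obtain U0 where U0: "A \<subseteq> U0" "open U0" "emeasure \<mu> U0 < emeasure \<mu> A + ennreal e"
      by (auto simp: INF_less_iff)
    define U where "U = U0 \<inter> {-real n<..<real n}"
    have U: "A \<subseteq> U" "open U" "U \<subseteq> {-real n<..<real n}" using U0 by (auto simp: U_def A_def)
    have Ub[measurable]: "U \<in> sets borel" using U(2) by auto
    have Ufin: "emeasure \<mu> U \<noteq> \<infinity>" using fin emeasure_space[of \<mu> U] by (auto simp: top_unique)
    have "emeasure \<mu> (U - A) \<le> ennreal e"
    proof -
      have "emeasure \<mu> U \<le> emeasure \<mu> U0" using U0(2) by (intro emeasure_mono) (auto simp: U_def s\<mu>)
      then have "emeasure \<mu> U \<le> emeasure \<mu> A + ennreal e" using U0(3) by (meson le_less_trans less_imp_le)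
      moreover have "emeasure \<mu> (U - A) = emeasure \<mu> U - emeasure \<mu> A"
        using finA U(1) by (intro emeasure_Diff) (auto simp: s\<mu>)
      ultimately show ?thesis using finA by (auto simp add: ennreal_minus_le_iff add.commute)
    qed
    then have UA: "(LINT x:U-A|lborel. \<bar>h x - r\<bar>) \<le> e"
    proof -
      have eq: "indicator (U-A) x * \<bar>h x - r\<bar> = indicator (U - A) x * k x" for x
        using U(3) by (auto simp: k_def indicator_def)
      have "(\<integral>\<^sup>+x. ennreal (indicator (U-A) x * k x) \<partial>lborel) = emeasure \<mu> (U - A)"
        unfolding \<mu>_def by (subst emeasure_density) (auto intro!: nn_integral_cong simp: indicator_def)
      then have le: "(\<integral>\<^sup>+x. ennreal (indicator (U-A) x * k x) \<partial>lborel) \<le> ennreal e"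
        using \<open>emeasure \<mu> (U - A) \<le> ennreal e\<close> by simp
      have "(LINT x|lborel. indicator (U-A) x * k x) = enn2real (\<integral>\<^sup>+x. ennreal (indicator (U-A) x * k x) \<partial>lborel)"
        by (subst integral_eq_nn_integral) (auto simp: k_def)
      also have "\<dots> \<le> e" using le e by (simp add: enn2real_leI)
      finally show ?thesis unfolding set_lebesgue_integral_def by (simp add: eq)
    qed
    define K where "K = {(y,z). y < z \<and> {y<..<z} \<subseteq> U \<and> s * (z - y) < (LINT t:{y<..<z}|lborel. h t)}"
    define I where "I p = {fst p<..<snd p}" for p :: "real \<times> real"
    have ballI: "ball ((fst p + snd p)/2) ((snd p - fst p)/2) = I p" for p :: "real \<times> real"
    proof -
      have "(fst p + snd p)/2 - (snd p - fst p)/2 = fst p" "(fst p + snd p)/2 + (snd p - fst p)/2 = snd p"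
        by (simp_all add: field_simps)
      then show ?thesis by (simp only: I_def ball_eq_greaterThanLessThan)
    qed
    \<comment> \<open>The covering theorem speaks of balls that contain the point, not of balls
      centred there, so every interval (y, z) around \<open>x\<close> qualifies, as the ball with
      its midpoint and half its length.\<close>
    obtain C where C: "countable C" "C \<subseteq> K"
      "pairwise (\<lambda>i j. disjnt (I i) (I j)) C" "negligible ((?E \<inter> {-real n<..<real n}) - (\<Union>i\<in>C. I i))"
    proof (rule Vitali_covering_theorem_balls[of "?E \<inter> {-real n<..<real n}" K "\<lambda>p. (fst p + snd p)/2" "\<lambda>p. (snd p - fst p)/2", unfolded ballI])
      fix x d :: real assume x: "x \<in> ?E \<inter> {-real n<..<real n}" and d: "0 < d"
      then have "x \<in> U" using U(1) by (auto simp: A_def)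
      then obtain d' where d': "0 < d'" "ball x d' \<subseteq> U" using U(2) by (meson open_contains_ball)
      from x have "\<forall>d>0. \<exists>y z. y < x \<and> x < z \<and> z - y < d \<and> s * (z - y) < (LINT t:{y<..<z}|lborel. h t)"
        by blast
      moreover have "0 < min d d'" using d d' by simp
      ultimately obtain y z where yz: "y < x" "x < z" "z - y < min d d'" "s * (z - y) < (LINT t:{y<..<z}|lborel. h t)"
        by blast
      have "{y<..<z} \<subseteq> ball x d'" using yz by (auto simp: dist_real_def abs_if)
      then have "(y,z) \<in> K" using yz d' by (auto simp: K_def)
      moreover have "x \<in> I (y,z)" using yz by (auto simp: I_def)
      ultimately show "\<exists>i. i \<in> K \<and> x \<in> I i \<and> (snd i - fst i) / 2 < d"
        using yz by (intro exI[of _ "(y,z)"]) auto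
    qed auto
    define W where "W = (\<Union>i\<in>C. I i)"
    \<comment> \<open>An enumeration by all naturals, padded with empty sets when \<open>C\<close>
      is finite, so that the integral over \<open>W\<close> becomes a limit along the partial unions
      \<open>V\<close>.\<close>
    define J where "J i = (if i \<in> to_nat_on C ` C then I (from_nat_into C i) else {})" for i
    have WJ: "W = (\<Union>i. J i)"
    proof -
      have "J (to_nat_on C a) = I a" if "a \<in> C" for a using C(1) that by (simp add: J_def)
      moreover have "J i \<subseteq> (\<Union>i\<in>C. I i)" for i
        using C(1) by (auto simp: J_def)
      ultimately show ?thesis unfolding W_def by blast
    qed
    have Jm [measurable]: "J i \<in> sets borel" for i by (auto simp: J_def I_def)
    have Jdisj: "J i \<inter> J j = {}" if "i \<noteq> j" for i j
    proof -
      { assume "i \<in> to_nat_on C ` C" "j \<in> to_nat_on C ` C"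
        then obtain a b where ab: "a \<in> C" "b \<in> C" "i = to_nat_on C a" "j = to_nat_on C b" by auto
        then have "a \<noteq> b" using that by auto
        then have "disjnt (I a) (I b)" using C(3) ab by (auto simp: pairwise_def)
        then have "J i \<inter> J j = {}" using ab C(1) by (auto simp: J_def disjnt_def) }
      then show ?thesis by (auto simp: J_def)
    qed
    have Wm [measurable]: "W \<in> sets borel" unfolding WJ by measurable
    have WU: "W \<subseteq> U" using C(2) unfolding W_def K_def I_def by fastforce
    have Wbd: "W \<subseteq> {-real n<..<real n}" using WU U(3) by auto
    have Wfin: "emeasure lborel W < \<infinity>"
      using emeasure_mono[OF Wbd, of lborel] by (simp add: le_less_trans)
    have int1: "set_integrable lborel B h" if "B \<in> sets borel" for B
      unfolding set_integrable_def using that by (intro integrable_mult_indicator h) auto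
    have int2: "set_integrable lborel B (\<lambda>x. c)" if "B \<in> sets borel" "B \<subseteq> {-real n<..<real n}" for B and c :: real
    proof -
      have "emeasure lborel B < \<infinity>" using emeasure_mono[OF that(2), of lborel] by (simp add: le_less_trans)
      then show ?thesis unfolding set_integrable_def using that by (auto simp: mult.commute intro!: integrable_mult_indicator)
    qed
    have JW: "J i \<subseteq> {-real n<..<real n}" for i using WJ Wbd by auto
    have pos: "0 \<le> (LINT x:J i|lborel. h x - s)" for i
    proof (cases "i \<in> to_nat_on C ` C")
      case True
      then obtain a where a: "a \<in> C" "i = to_nat_on C a" by auto
      then have Ji: "J i = I a" using C(1) by (auto simp: J_def)
      have "(LINT x:I a|lborel. h x - s) = (LINT x:I a|lborel. h x) - (LINT x:I a|lborel. s)"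
        using JW[of i] Ji by (intro set_integral_diff int1 int2) (auto simp: I_def)
      moreover have "(LINT x:I a|lborel. s) = s * (snd a - fst a)"
        using a C(2) by (auto simp: K_def I_def set_lebesgue_integral_def)
      ultimately show ?thesis using a C(2) Ji by (auto simp: K_def I_def)
    qed (simp add: J_def set_lebesgue_integral_def)
    define V where "V n = (\<Union>i<n. J i)" for n
    have VW: "(\<Union>n. V n) = W" by (auto simp: V_def WJ)
    have Vm [measurable]: "V n \<in> sets borel" for n by (auto simp: V_def)
    have Vb: "V n \<subseteq> {-real m<..<real m} \<longleftrightarrow> (\<forall>i<n. J i \<subseteq> {-real m<..<real m})" for n m
      by (auto simp: V_def)
    have "0 \<le> (LINT x:V m|lborel. h x - s)" for m
    proof (induction m)
      case (Suc m)
      have "V (Suc m) = V m \<union> J m" by (auto simp: V_def lessThan_Suc)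
      moreover have "J i \<inter> J m = {}" if "i < m" for i using Jdisj[of i m] that by simp
      then have "V m \<inter> J m = {}" unfolding V_def by blast
      moreover have "V m \<subseteq> {- real n<..<real n}" using JW by (auto simp: Vb)
      ultimately have "(LINT x:V (Suc m)|lborel. h x - s) = (LINT x:V m|lborel. h x - s) + (LINT x:J m|lborel. h x - s)"
        using JW by (simp add: set_integral_Un set_integral_diff int1 int2)
      then show ?case using Suc pos[of m] by simp
    qed (simp add: V_def set_lebesgue_integral_def)
    moreover have "(\<lambda>m. LINT x:V m|lborel. h x - s) \<longlonglongrightarrow> (LINT x:(\<Union>m. V m)|lborel. h x - s)"
    proof (rule set_integral_cont_up)
      show "incseq V" by (auto simp: incseq_def V_def) (meson lessThan_iff less_le_trans)
      show "set_integrable lborel (\<Union>m. V m) (\<lambda>x. h x - s)"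
        unfolding VW using Wbd by (intro set_integral_diff int1 int2) auto
    qed auto
    ultimately have "0 \<le> (LINT x:W|lborel. h x - s)"
      unfolding VW by (intro LIMSEQ_le_const) auto
    also have "(LINT x:W|lborel. h x - s) = (LINT x:W|lborel. h x - r) - (s - r) * measure lborel W"
    proof -
      have "(LINT x:W|lborel. (h x - r) - (s - r)) = (LINT x:W|lborel. h x - r) - (LINT x:W|lborel. s - r)"
        using Wbd by (intro set_integral_diff int1 int2) auto
      then show ?thesis using Wfin by (simp add: set_lebesgue_integral_def measure_def)
    qed
    finally have "(s - r) * measure lborel W \<le> (LINT x:W|lborel. h x - r)" by simp
    also have "\<dots> \<le> (LINT x:U-A|lborel. \<bar>h x - r\<bar>)"
    proof -
      have i1: "set_integrable lborel W (\<lambda>x. h x - r)"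
        using Wbd by (intro set_integral_diff int1 int2) auto
      have i2: "set_integrable lborel (U-A) (\<lambda>x. h x - r)"
        using U(3) by (intro set_integral_diff int1 int2) auto
      \<comment> \<open>On \<open>A\<close> the left side is negative because h < r there; the rest
        of \<open>W\<close> lies in \<open>U - A\<close>.\<close>
      have pw: "indicator W x *\<^sub>R (h x - r) \<le> indicator (U-A) x *\<^sub>R \<bar>h x - r\<bar>" for x
      proof (cases "x \<in> W")
        case True
        then have "h x < r \<or> x \<notin> A" by (auto simp: A_def)
        then show ?thesis using True WU by (cases "x \<in> A") (auto simp: A_def)
      qed simp
      show ?thesis
        using i1 set_integrable_abs[OF i2]
        unfolding set_integrable_def set_lebesgue_integral_def
        by (intro integral_mono pw)
    qed
    also have "\<dots> \<le> e" by (rule UA)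
    finally have "measure lborel W \<le> e0" using rs by (simp add: e_def mult.commute[of e0])
    moreover have "W \<in> lmeasurable" using Wfin by (auto simp: fmeasurable_def)
    ultimately show "\<exists>T. ?E \<inter> {- real n<..<real n} \<subseteq> T \<and> T \<in> lmeasurable \<and> measure lebesgue T \<le> e0"
    proof (intro exI conjI)
      let ?N = "(?E \<inter> {-real n<..<real n}) - W"
      have N: "negligible ?N" using C(4) by (simp only: W_def)
      show "?E \<inter> {- real n<..<real n} \<subseteq> W \<union> ?N" by blast
      show "W \<union> ?N \<in> lmeasurable" using fmeasurable.Un[OF \<open>W \<in> lmeasurable\<close> negligible_imp_measurable[OF N]] .
      have "measure lebesgue (W \<union> ?N) = measure lebesgue W"
        using measure_Un_null_set[OF fmeasurableD[OF \<open>W \<in> lmeasurable\<close>] N[unfolded negligible_iff_null_sets]] .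
      also have "\<dots> = measure lborel W" by (intro measure_completion) (simp add: Wm)
      finally show "measure lebesgue (W \<union> ?N) \<le> e0" using \<open>measure lborel W \<le> e0\<close> by (simp only:)
    qed
  qed
  then have "negligible (\<Union>n. ?E \<inter> {-real n<..<real n})" by (intro negligible_countable_Union) auto
  moreover have "?E \<subseteq> (\<Union>n. ?E \<inter> {-real n<..<real n})"
  proof
    fix x assume x: "x \<in> ?E"
    obtain n where "\<bar>x\<bar> < real n" using reals_Archimedean2 by blast
    then have "x \<in> {- real n<..<real n}" by (simp add: abs_less_iff)
    with x show "x \<in> (\<Union>n. ?E \<inter> {-real n<..<real n})" by (intro UN_I[OF UNIV_I] IntI)
  qed
  ultimately show ?thesis by (rule negligible_subset)
qed

lemma negligible_lower_density:
  fixes h :: "real \<Rightarrow> real"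
  assumes h: "integrable lborel h" and rs: "s < r"
  shows "negligible {x. r < h x \<and> (\<forall>d>0. \<exists>y z. y < x \<and> x < z \<and> z - y < d \<and> (LINT t:{y<..<z}|lborel. h t) < s * (z - y))}"
  using negligible_upper_density[of "\<lambda>x. - h x" "-r" "-s"] h rs
  by (simp add: set_lebesgue_integral_def)

text \<open>Rational thresholds make the exceptional sets countable in number. At a point outside
  all of them, two rationals within \<open>e\<close> on each side of \<open>h x\<close> trap the
  averages: the nearer one separates \<open>h x\<close> from the farther one, which is the
  bound.\<close>

lemma AE_interval_average:
  fixes h :: "real \<Rightarrow> real"
  assumes h: "integrable lborel h"
  shows "AE x in lebesgue. \<forall>e>0. \<exists>d>0. \<forall>y z. y < x \<and> x < z \<and> z - y < d \<longrightarrow>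
           \<bar>(LINT t:{y<..<z}|lborel. h t) - h x * (z - y)\<bar> \<le> e * (z - y)"
proof -
  define up where "up r s = {x. h x < r \<and> (\<forall>d>0. \<exists>y z. y < x \<and> x < z \<and> z - y < d \<and> s * (z - y) < (LINT t:{y<..<z}|lborel. h t))}" for r s
  define lo where "lo r s = {x. r < h x \<and> (\<forall>d>0. \<exists>y z. y < x \<and> x < z \<and> z - y < d \<and> (LINT t:{y<..<z}|lborel. h t) < s * (z - y))}" for r s
  have "AE x in lebesgue. x \<notin> up (real_of_rat r) (real_of_rat s)" if "r < s" for r s
    using negligible_upper_density[OF h, of "real_of_rat r" "real_of_rat s"] that
    by (intro AE_not_in) (simp add: up_def negligible_iff_null_sets of_rat_less)
  then have 1: "AE x in lebesgue. \<forall>r s. r < s \<longrightarrow> x \<notin> up (real_of_rat r) (real_of_rat s)"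
    by (auto simp: AE_all_countable)
  have "AE x in lebesgue. x \<notin> lo (real_of_rat r) (real_of_rat s)" if "s < r" for r s
    using negligible_lower_density[OF h, of "real_of_rat s" "real_of_rat r"] that
    by (intro AE_not_in) (simp add: lo_def negligible_iff_null_sets of_rat_less)
  then have 2: "AE x in lebesgue. \<forall>r s. s < r \<longrightarrow> x \<notin> lo (real_of_rat r) (real_of_rat s)"
    by (auto simp: AE_all_countable)
  show ?thesis
    using 1 2
  proof eventually_elim
    fix x assume up: "\<forall>r s. r < s \<longrightarrow> x \<notin> up (real_of_rat r) (real_of_rat s)"
      and lo: "\<forall>r s. s < r \<longrightarrow> x \<notin> lo (real_of_rat r) (real_of_rat s)"
    show "\<forall>e>0. \<exists>d>0. \<forall>y z. y < x \<and> x < z \<and> z - y < d \<longrightarrow>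
           \<bar>(LINT t:{y<..<z}|lborel. h t) - h x * (z - y)\<bar> \<le> e * (z - y)"
    proof (intro allI impI)
      fix e :: real assume e: "0 < e"
      obtain r where r: "h x < real_of_rat r" "real_of_rat r < h x + e" using of_rat_dense[of "h x" "h x + e"] e by auto
      obtain s where s: "real_of_rat r < real_of_rat s" "real_of_rat s < h x + e" using of_rat_dense[OF r(2)] by auto
      have "x \<notin> up (real_of_rat r) (real_of_rat s)" using up s by (simp add: of_rat_less)
      then obtain d1 where d1: "d1 > 0" "\<And>y z. y < x \<Longrightarrow> x < z \<Longrightarrow> z - y < d1 \<Longrightarrow> (LINT t:{y<..<z}|lborel. h t) \<le> real_of_rat s * (z - y)"
        using r by (force simp: up_def not_less)
      obtain r' where r': "h x - e < real_of_rat r'" "real_of_rat r' < h x" using of_rat_dense[of "h x - e" "h x"] e by auto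
      obtain s' where s': "h x - e < real_of_rat s'" "real_of_rat s' < real_of_rat r'" using of_rat_dense[OF r'(1)] by auto
      have "x \<notin> lo (real_of_rat r') (real_of_rat s')" using lo s' by (simp add: of_rat_less)
      then obtain d2 where d2: "d2 > 0" "\<And>y z. y < x \<Longrightarrow> x < z \<Longrightarrow> z - y < d2 \<Longrightarrow> real_of_rat s' * (z - y) \<le> (LINT t:{y<..<z}|lborel. h t)"
        using r' by (force simp: lo_def not_less)
      show "\<exists>d>0. \<forall>y z. y < x \<and> x < z \<and> z - y < d \<longrightarrow>
           \<bar>(LINT t:{y<..<z}|lborel. h t) - h x * (z - y)\<bar> \<le> e * (z - y)"
      proof (intro exI[of _ "min d1 d2"] conjI allI impI)
        fix y z assume yz: "y < x \<and> x < z \<and> z - y < min d1 d2"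
        have "real_of_rat s * (z - y) \<le> (h x + e) * (z - y)" "(h x - e) * (z - y) \<le> real_of_rat s' * (z - y)"
          using yz s s' by (intro mult_right_mono; simp)+
        then show "\<bar>(LINT t:{y<..<z}|lborel. h t) - h x * (z - y)\<bar> \<le> e * (z - y)"
          using d1(2)[of y z] d2(2)[of y z] yz by (simp add: abs_le_iff algebra_simps)
      qed (use d1 d2 in auto)
    qed
  qed
qed

lemma set_integrable_lborel_all:
  "integrable lborel h \<Longrightarrow> A \<in> sets borel \<Longrightarrow> set_integrable lborel A (h :: real \<Rightarrow> real)"
  unfolding set_integrable_def by (rule integrable_mult_indicator) auto

lemma set_integral_lborel_eq_integral:
  fixes h :: "real \<Rightarrow> real"
  assumes "integrable lborel h" "A \<in> sets borel"
  shows "(LINT t:A|lborel. h t) = integral A h" "h integrable_on A"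
  using set_borel_integral_eq_integral[OF set_integrable_lborel_all[OF assms]] by auto

lemma indefinite_integral_has_derivative_AE:
  fixes h :: "real \<Rightarrow> real"
  assumes h: "integrable lborel h"
  shows "AE x in lebesgue. a < x \<longrightarrow> ((\<lambda>t. LINT s:{a..t}|lborel. h s) has_real_derivative h x) (at x)"
  using AE_interval_average[OF h]
proof eventually_elim
  fix x assume *: "\<forall>e>0. \<exists>d>0. \<forall>y z. y < x \<and> x < z \<and> z - y < d \<longrightarrow>
           \<bar>(LINT t:{y<..<z}|lborel. h t) - h x * (z - y)\<bar> \<le> e * (z - y)"
  define F where "F t = integral {a..t} h" for t
  have FI: "(LINT t:{y<..<z}|lborel. h t) = F z - F y" if "a \<le> y" "y \<le> z" for y z
    using that Henstock_Kurzweil_Integration.integral_combine[OF that set_integral_lborel_eq_integral(2)[OF h]]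
    by (simp add: set_integral_lborel_eq_integral[OF h] F_def integral_open_interval_real)
  have Fc: "isCont F t" if "a < t" for t
  proof -
    have "continuous_on {a..t+1} F" unfolding F_def
      by (intro indefinite_integral_continuous_1 set_integral_lborel_eq_integral(2)[OF h]) auto
    then show ?thesis
      by (rule continuous_on_interior) (use that in \<open>simp add: interior_atLeastAtMost_real\<close>)
  qed
  show "a < x \<longrightarrow> ((\<lambda>t. LINT s:{a..t}|lborel. h s) has_real_derivative h x) (at x)"
  proof
    assume ax: "a < x"
    \<comment> \<open>The averages are known only for intervals with \<open>x\<close> in the
      interior. Widening by \<delta> n on both sides and letting n tend to infinity, with continuity
      of \<open>F\<close>, admits \<open>x\<close> as an endpoint, as difference quotients
      require.\<close>
    have lim: "\<bar>F z - F y - h x * (z - y)\<bar> \<le> e * (z - y)"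
      if d: "\<forall>y z. y < x \<and> x < z \<and> z - y < d \<longrightarrow> \<bar>(LINT t:{y<..<z}|lborel. h t) - h x * (z - y)\<bar> \<le> e * (z - y)"
        and yz: "a < y" "y \<le> x" "x \<le> z" "z - y < d" for d e y z
    proof -
      define \<delta> where "\<delta> n = inverse (real (Suc n))" for n
      have \<delta>: "\<delta> \<longlonglongrightarrow> 0" unfolding \<delta>_def by (rule LIMSEQ_inverse_real_of_nat)
      have \<delta>p: "0 < \<delta> n" for n by (simp add: \<delta>_def)
      have "(\<lambda>n. y - \<delta> n) \<longlonglongrightarrow> y" "(\<lambda>n. z + \<delta> n) \<longlonglongrightarrow> z"
        using tendsto_diff[OF tendsto_const \<delta>, of y] tendsto_add[OF tendsto_const \<delta>, of z] by auto
      note L = this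
      have LF: "(\<lambda>n. F (y - \<delta> n)) \<longlonglongrightarrow> F y" "(\<lambda>n. F (z + \<delta> n)) \<longlonglongrightarrow> F z"
        using yz by (intro isCont_tendsto_compose[OF Fc] L; simp)+
      have "\<forall>\<^sub>F n in sequentially. y - \<delta> n > a"
        using order_tendstoD(1)[OF L(1) yz(1)] .
      moreover have "\<forall>\<^sub>F n in sequentially. (z + \<delta> n) - (y - \<delta> n) < d"
        using order_tendstoD(2)[OF tendsto_diff[OF L(2,1)] yz(4)] .
      ultimately have ev: "\<forall>\<^sub>F n in sequentially. \<bar>F (z + \<delta> n) - F (y - \<delta> n) - h x * ((z + \<delta> n) - (y - \<delta> n))\<bar> \<le> e * ((z + \<delta> n) - (y - \<delta> n))"
      proof eventually_elim
        case (elim n)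
        have "y - \<delta> n < x" "x < z + \<delta> n" using yz \<delta>p[of n] by linarith+
        then show ?case using d[rule_format, of "y - \<delta> n" "z + \<delta> n"] elim FI[of "y - \<delta> n" "z + \<delta> n"] by simp
      qed
      have t1: "(\<lambda>n. \<bar>F (z + \<delta> n) - F (y - \<delta> n) - h x * ((z + \<delta> n) - (y - \<delta> n))\<bar>) \<longlonglongrightarrow> \<bar>F z - F y - h x * (z - y)\<bar>"
        by (intro tendsto_intros LF L)
      have t2: "(\<lambda>n. e * ((z + \<delta> n) - (y - \<delta> n))) \<longlonglongrightarrow> e * (z - y)"
        by (intro tendsto_intros L)
      show ?thesis by (rule tendsto_le[OF sequentially_bot t2 t1 ev])
    qed
    have "((\<lambda>z. (F z - F x) / (z - x)) \<longlongrightarrow> h x) (at x)"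
      unfolding LIM_def
    proof (intro allI impI)
      fix e :: real assume e: "0 < e"
      then obtain d where d: "d > 0" "\<forall>y z. y < x \<and> x < z \<and> z - y < d \<longrightarrow> \<bar>(LINT t:{y<..<z}|lborel. h t) - h x * (z - y)\<bar> \<le> e/2 * (z - y)"
        using *[rule_format, of "e/2"] by auto
      show "\<exists>s>0. \<forall>z. z \<noteq> x \<and> dist z x < s \<longrightarrow> dist ((F z - F x) / (z - x)) (h x) < e"
      proof (intro exI[of _ "min d (x - a)"] conjI allI impI)
        fix z assume z: "z \<noteq> x \<and> dist z x < min d (x - a)"
        have "\<bar>F z - F x - h x * (z - x)\<bar> \<le> e/2 * \<bar>z - x\<bar>"
        proof (cases "z > x")
          case True
          then show ?thesis using lim[OF d(2), of x z] z ax by (auto simp: dist_real_def)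
        next
          case False
          then have "\<bar>F x - F z - h x * (x - z)\<bar> \<le> e/2 * (x - z)" using lim[OF d(2), of z x] z by (auto simp: dist_real_def)
          moreover have "\<bar>F x - F z - h x * (x - z)\<bar> = \<bar>F z - F x - h x * (z - x)\<bar>" by (subst abs_minus_commute) (simp add: algebra_simps)
          ultimately show ?thesis using False by (simp add: abs_if)
        qed
        moreover have "(F z - F x) / (z - x) - h x = (F z - F x - h x * (z - x)) / (z - x)" using z by (simp add: field_simps)
        ultimately have "\<bar>(F z - F x) / (z - x) - h x\<bar> \<le> e/2" using z by (simp add: abs_divide divide_le_eq)
        then show "dist ((F z - F x) / (z - x)) (h x) < e" using e by (simp add: dist_real_def)
      qed (use d ax in auto)
    qed
    then show "((\<lambda>t. LINT s:{a..t}|lborel. h s) has_real_derivative h x) (at x)"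
      by (simp add: has_field_derivative_iff set_integral_lborel_eq_integral[OF h] F_def)
  qed
qed

text \<open>Completeness of \<open>lebesgue\<close> makes \<open>w\<close> measurable, as it differs
  from a Borel function on a null set. This is how \<open>deriv\<close> and \<open>caputo\<close>,
  defined pointwise without regard to measurability, come to be integrated.\<close>

lemma lebesgue_integral_eq_lborel_AE:
  fixes k w :: "real \<Rightarrow> real"
  assumes k: "integrable lborel k" and ae: "AE x in lborel. k x = w x"
  shows "integrable lebesgue w" "integral\<^sup>L lebesgue w = integral\<^sup>L lborel k"
proof -
  have km: "k \<in> borel_measurable lborel" using k by simp
  have ael: "AE x in lebesgue. k x = w x" using ae by (rule AE_completion)
  have wm: "w \<in> borel_measurable lebesgue"
  proof (rule measurableI)
    fix A :: "real set" assume A: "A \<in> sets borel"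
    show "w -` A \<inter> space lebesgue \<in> sets lebesgue"
    proof (rule completion.in_sets_AE)
      show "AE x in lebesgue. (x \<in> k -` A \<inter> space lebesgue) = (x \<in> w -` A \<inter> space lebesgue)"
        using ael by eventually_elim auto
      show "k -` A \<inter> space lebesgue \<in> sets lebesgue"
        using measurable_sets[OF measurable_completion[OF km] A] .
    qed auto
  qed simp
  have "integrable lebesgue k" using k km by (simp add: integrable_completion)
  then show "integrable lebesgue w" using wm ael by (rule integrable_cong_AE_imp)
  show "integral\<^sup>L lebesgue w = integral\<^sup>L lborel k"
    using integral_cong_AE[OF measurable_completion[OF km] wm ael] integral_completion[OF km] by simp
qed

lemma set_integrable_lebesgue_borel_version:
  fixes v :: "real \<Rightarrow> real"
  assumes v: "set_integrable lebesgue A v"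
  obtains h where "integrable lborel h" "AE x in lborel. x \<in> A \<longrightarrow> h x = v x"
    "\<And>B. B \<in> sets borel \<Longrightarrow> B \<subseteq> A \<Longrightarrow> (LINT s:B|lebesgue. v s) = (LINT s:B|lborel. h s)"
proof -
  let ?w = "\<lambda>x. indicator A x *\<^sub>R v x"
  have w: "integrable lebesgue ?w" using v by (simp add: set_integrable_def)
  then have "?w \<in> borel_measurable lebesgue" by auto
  from completion_ex_borel_measurable_real[OF this]
  obtain h where h: "h \<in> borel_measurable lborel" "AE x in lborel. ?w x = h x" by auto
  have AEl: "AE x in lebesgue. ?w x = h x" using h(2) by (simp add: AE_completion)
  have "integrable lebesgue h"
    using w AEl h(1) by (subst integrable_cong_AE[symmetric]) (auto intro: measurable_completion)
  then have hi: "integrable lborel h" using h(1) by (simp add: integrable_completion)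
  show thesis
  proof
    show "integrable lborel h" by fact
    show "AE x in lborel. x \<in> A \<longrightarrow> h x = v x" using h(2) by eventually_elim auto
    fix B :: "real set" assume B: "B \<in> sets borel" "B \<subseteq> A"
    have "AE x in lborel. indicator B x *\<^sub>R h x = indicator B x *\<^sub>R v x"
      using h(2) by eventually_elim (use B(2) in \<open>auto simp: indicator_def split: if_splits\<close>)
    from lebesgue_integral_eq_lborel_AE(2)[OF _ this] set_integrable_lborel_all[OF hi B(1)]
    show "(LINT s:B|lebesgue. v s) = (LINT s:B|lborel. h s)"
      by (simp add: set_integrable_def set_lebesgue_integral_def)
  qed
qed

text \<open>Exchanges the unnamed density in \<open>abs_cont\<close> for \<open>deriv F\<close>, the
  function that \<open>caputo\<close> contains. Lebesgue differentiation of a Borel version of that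
  density identifies the two almost everywhere.\<close>

lemma abs_cont_has_derivative_AE:
  assumes "abs_cont a b F"
  shows "AE x in lborel. a < x \<and> x < b \<longrightarrow> (F has_real_derivative deriv F x) (at x)"
    and "set_integrable lebesgue {a..b} (deriv F)"
    and "t \<in> {a..b} \<Longrightarrow> F t = F a + (LINT s:{a..t}|lebesgue. deriv F s)"
proof -
  obtain v where v: "set_integrable lebesgue {a..b} v" "\<And>t. t\<in>{a..b} \<Longrightarrow> F t = F a + (LINT s:{a..t}|lebesgue. v s)"
    using assms unfolding abs_cont_def by blast
  obtain h where h: "integrable lborel h" "AE x in lborel. x \<in> {a..b} \<longrightarrow> h x = v x"
    "\<And>B. B \<in> sets borel \<Longrightarrow> B \<subseteq> {a..b} \<Longrightarrow> (LINT s:B|lebesgue. v s) = (LINT s:B|lborel. h s)"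
    using set_integrable_lebesgue_borel_version[OF v(1)] by blast
  have Fh: "F t = F a + (LINT s:{a..t}|lborel. h s)" if "t \<in> {a..b}" for t
    using v(2)[OF that] h(3)[of "{a..t}"] that by auto
  have D: "AE x in lborel. a < x \<and> x < b \<longrightarrow> (F has_real_derivative h x) (at x)"
  proof -
    have "AE x in lborel. a < x \<longrightarrow> ((\<lambda>t. LINT s:{a..t}|lborel. h s) has_real_derivative h x) (at x)"
      using indefinite_integral_has_derivative_AE[OF h(1), of a] by (simp add: AE_completion_iff)
    then show ?thesis
    proof eventually_elim
      case (elim x)
      show ?case
      proof
        assume x: "a < x \<and> x < b"
        then have "((\<lambda>t. F a + (LINT s:{a..t}|lborel. h s)) has_real_derivative h x) (at x)"
          using elim by (auto intro!: derivative_eq_intros)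
        moreover have "open {a<..<b}" "x \<in> {a<..<b}" using x by auto
        ultimately show "(F has_real_derivative h x) (at x)"
          by (rule has_field_derivative_transform_within_open) (rule Fh[symmetric], simp)
      qed
    qed
  qed
  then show 1: "AE x in lborel. a < x \<and> x < b \<longrightarrow> (F has_real_derivative deriv F x) (at x)"
    by eventually_elim (metis DERIV_imp_deriv)
  have "AE x in lborel. x \<noteq> a" "AE x in lborel. x \<noteq> b" by (auto intro: AE_lborel_singleton)
  with D have dh: "AE x in lborel. x \<in> {a..b} \<longrightarrow> deriv F x = h x"
    by eventually_elim (auto dest: DERIV_imp_deriv)
  have cong: "integrable lebesgue (\<lambda>x. indicator B x *\<^sub>R deriv F x) \<and>
      (\<integral>x. indicator B x *\<^sub>R deriv F x \<partial>lebesgue) = (\<integral>x. indicator B x *\<^sub>R h x \<partial>lborel)"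
    if B: "B \<subseteq> {a..b}" "B \<in> sets borel" for B
  proof -
    have "AE x in lborel. indicator B x *\<^sub>R h x = indicator B x *\<^sub>R deriv F x"
      using dh by eventually_elim (use B in \<open>auto simp: indicator_def\<close>)
    from lebesgue_integral_eq_lborel_AE[OF _ this] set_integrable_lborel_all[OF h(1) B(2)]
    show ?thesis by (simp add: set_integrable_def)
  qed
  from cong[of "{a..b}"] show "set_integrable lebesgue {a..b} (deriv F)" by (simp add: set_integrable_def)
  assume t: "t \<in> {a..b}"
  with cong[of "{a..t}"] Fh[OF t] show "F t = F a + (LINT s:{a..t}|lebesgue. deriv F s)"
    by (simp add: set_lebesgue_integral_def)
qed

lemma AE_lborel_dense:
  assumes "AE x in lborel. P x" "l < (u::real)"
  shows "\<exists>x. l < x \<and> x < u \<and> P x"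
proof (rule ccontr)
  assume "\<not> ?thesis"
  then have "AE x in lborel. x \<notin> {l<..<u}" using assms(1) by (auto elim!: eventually_mono)
  then have "{l<..<u} \<in> null_sets lborel" by (subst AE_iff_null_sets) auto
  then show False using assms(2) by (simp add: null_sets_def)
qed

text \<open>Endpoints in \<open>S\<close> are all that identities valid almost everywhere can
  provide. A set of full measure is dense, so the continuous primitive of \<open>h\<close> vanishes
  identically between such endpoints, and differentiating it finishes.\<close>

lemma AE_zero_of_interval_integrals:
  fixes h :: "real \<Rightarrow> real"
  assumes S: "AE x in lborel. 0 < x \<longrightarrow> x \<in> S"
    and int: "\<And>a c. a \<in> S \<Longrightarrow> c \<in> S \<Longrightarrow> 0 < a \<Longrightarrow> a < c \<Longrightarrow> set_integrable lebesgue {a..c} h \<and> (LINT s:{a..c}|lebesgue. h s) = 0"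
  shows "AE x in lborel. 0 < x \<longrightarrow> h x = 0"
proof -
  have loc: "AE x in lborel. a < x \<and> x < c \<longrightarrow> h x = 0" if ac: "a \<in> S" "c \<in> S" "0 < a" "a < c" for a c
  proof -
    have hi: "set_integrable lebesgue {a..c} h" using int ac by blast
    obtain k where k: "integrable lborel k" "AE x in lborel. x \<in> {a..c} \<longrightarrow> k x = h x"
      "\<And>B. B \<in> sets borel \<Longrightarrow> B \<subseteq> {a..c} \<Longrightarrow> (LINT s:B|lebesgue. h s) = (LINT s:B|lborel. k s)"
      using set_integrable_lebesgue_borel_version[OF hi] by blast
    define F where "F t = integral {a..t} k" for t
    have Fc: "continuous_on {a..c} F" unfolding F_def
      by (intro indefinite_integral_continuous_1 set_integral_lborel_eq_integral(2)[OF k(1)]) auto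
    have F0: "F t = 0" if "t \<in> S \<inter> {a<..<c}" for t
      using int[of a t] that ac k(3)[of "{a..t}"] set_integral_lborel_eq_integral(1)[OF k(1), of "{a..t}"]
      by (auto simp: F_def)
    have F1: "F t = 0" if t: "t \<in> {a<..<c}" for t
    proof (rule ccontr)
      assume "F t \<noteq> 0"
      have "isCont F t" using Fc by (rule continuous_on_interior) (use t in auto)
      from this[unfolded continuous_at_eps_delta, rule_format, of "\<bar>F t\<bar>"] \<open>F t \<noteq> 0\<close>
      obtain d where d: "d > 0" "\<And>y. dist y t < d \<Longrightarrow> dist (F y) (F t) < \<bar>F t\<bar>" by auto
      from AE_lborel_dense[OF S, of t "min (t + d) c"] t d(1)
      obtain y where "t < y" "y < t + d" "y < c" "y \<in> S" using ac by force
      then have "dist y t < d" "F y = 0" using F0[of y] t by (auto simp: dist_real_def)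
      with d(2)[of y] show False by (simp add: dist_real_def)
    qed
    have "AE x in lborel. a < x \<longrightarrow> ((\<lambda>t. LINT s:{a..t}|lborel. k s) has_real_derivative k x) (at x)"
      using indefinite_integral_has_derivative_AE[OF k(1), of a] by (simp add: AE_completion_iff)
    with k(2) show ?thesis
    proof eventually_elim
      case (elim x)
      show ?case
      proof
        assume x: "a < x \<and> x < c"
        have "(F has_real_derivative k x) (at x)"
          using elim x by (simp add: set_integral_lborel_eq_integral[OF k(1)] F_def[abs_def])
        moreover have "(F has_real_derivative 0) (at x)"
          by (rule has_field_derivative_transform_within_open[of "\<lambda>_. 0" _ _ "{a<..<c}"]) (use x F1 in auto)
        ultimately have "k x = 0" by (rule DERIV_unique)
        then show "h x = 0" using elim x by simp
      qed
    qed
  qed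
  \<comment> \<open>Intervals with endpoints in \<open>S\<close> exhaust the half-line:
    \<open>A n\<close> lies below 1 / (n + 1), \<open>C n\<close> above n + 1.\<close>
  have "\<exists>a. 0 < a \<and> a < 1 / real (Suc n) \<and> a \<in> S" for n
    using AE_lborel_dense[OF S, of 0 "1 / real (Suc n)"] by auto
  then obtain A where A: "\<And>n. 0 < A n \<and> A n < 1 / real (Suc n) \<and> A n \<in> S" by metis
  have "\<exists>c. real (Suc n) < c \<and> c \<in> S" for n
    using AE_lborel_dense[OF S, of "real (Suc n)" "real (Suc n) + 1"] by auto
  then obtain C where C: "\<And>n. real (Suc n) < C n \<and> C n \<in> S" by metis
  have "A n < C n" for n
    using A[of n] C[of n] by (smt (verit) divide_le_eq_1 of_nat_0_less_iff of_nat_Suc zero_less_Suc of_nat_0_le_iff)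
  then have "\<And>n. AE x in lborel. A n < x \<and> x < C n \<longrightarrow> h x = 0"
    using A C by (intro loc) auto
  then have "AE x in lborel. \<forall>n. A n < x \<and> x < C n \<longrightarrow> h x = 0"
    unfolding AE_all_countable by blast
  then show ?thesis
  proof eventually_elim
    case (elim x)
    show ?case
    proof
      assume x: "0 < x"
      obtain n where n: "max x (1/x) < real n" using reals_Archimedean2 by blast
      then have "1 / real (Suc n) < x" using x by (auto simp: field_simps)
      moreover have "x < real (Suc n)" using n by auto
      ultimately show "h x = 0" using elim A[of n] C[of n] by (meson order.strict_trans)
    qed
  qed
qed

section \<open>Laplace transforms and convolutions\<close>

lemma power_div_fact_tendsto_0: "(\<lambda>n. x ^ n / fact n) \<longlonglongrightarrow> (0::real)"
  using summable_LIMSEQ_zero[OF summable_exp[of x]] by (simp add: field_simps)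

text \<open>On [-1, 1] the absolute moments are at most 1, so the Taylor remainder of order n of the
  characteristic function is at most 2 |t|^n / n!. Equal moments leave a gap of at most twice that,
  which tends to 0; Levy's uniqueness theorem concludes.\<close>

lemma real_distribution_eq_of_moments:
  assumes "real_distribution P1" "real_distribution P2"
    and b1: "AE x in P1. \<bar>x\<bar> \<le> 1" and b2: "AE x in P2. \<bar>x\<bar> \<le> 1"
    and mom: "\<And>n. (LINT x|P1. x ^ n) = (LINT x|P2. x ^ n)"
  shows "P1 = P2"
proof (rule Levy_uniqueness[OF assms(1,2)], rule ext)
  interpret P1: real_distribution P1 by fact
  interpret P2: real_distribution P2 by fact
  have bound: "cmod (char P t - (\<Sum>k\<le>n. ((\<i> * t)^k / fact k) * (LINT x|P. x ^ k))) \<le> 2 * (\<bar>t\<bar>^n / fact n)"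
    if P: "real_distribution P" and b: "AE x in P. \<bar>x\<bar> \<le> 1" for P t n
  proof -
    interpret P: real_distribution P by fact
    have i: "integrable P (\<lambda>x. x ^ k)" for k
      by (rule P.integrable_const_bound[of _ 1])
         (use b in \<open>auto simp: power_abs intro: power_le_one elim!: eventually_mono\<close>)
    have "(LINT x|P. \<bar>x\<bar>^n) \<le> (LINT x|P. 1)"
      using integrable_abs[OF i[of n]] b
      by (intro integral_mono_AE) (auto simp: power_abs intro: power_le_one elim!: eventually_mono)
    then have "(LINT x|P. \<bar>x\<bar>^n) \<le> 1" using P.prob_space by simp
    then have "(2 * \<bar>t\<bar>^n / fact n) * (LINT x|P. \<bar>x\<bar>^n) \<le> (2 * \<bar>t\<bar>^n / fact n) * 1"
      by (intro mult_left_mono) auto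
    with P.char_approx1[OF i, where n = n and t = t] show ?thesis by simp
  qed
  fix t
  have "cmod (char P1 t - char P2 t) \<le> 4 * (\<bar>t\<bar>^n / fact n)" for n
    using bound[OF assms(1) b1, of t n] bound[OF assms(2) b2, of t n] unfolding mom
    using norm_triangle_ineq4[of "char P1 t - (\<Sum>k\<le>n. ((\<i> * t)^k / fact k) * (LINT x|P2. x ^ k))"
        "char P2 t - (\<Sum>k\<le>n. ((\<i> * t)^k / fact k) * (LINT x|P2. x ^ k))"] by simp
  moreover have "(\<lambda>n. 4 * (\<bar>t\<bar>^n / fact n)) \<longlonglongrightarrow> 4 * 0"
    by (intro tendsto_intros power_div_fact_tendsto_0)
  ultimately have "cmod (char P1 t - char P2 t) \<le> 4 * 0"
    by (intro LIMSEQ_le_const) auto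
  then show "char P1 t = char P2 t" by simp
qed

text \<open>The Laplace transforms at the integers are the moments of the image under \<open>x \<mapsto> exp (- x)\<close>,
  which lives on \<open>[0,1]\<close>.\<close>

lemma measure_eq_of_laplace:
  fixes M1 M2 :: "real measure"
  assumes "finite_measure M1" "finite_measure M2"
    and s1 [measurable_cong]: "sets M1 = sets borel" and s2 [measurable_cong]: "sets M2 = sets borel"
    and b1: "AE x in M1. 0 \<le> x" and b2: "AE x in M2. 0 \<le> x"
    and lap: "\<And>n::nat. (LINT x|M1. exp (- real n * x)) = (LINT x|M2. exp (- real n * x))"
  shows "M1 = M2"
proof -
  interpret M1: finite_measure M1 by fact
  interpret M2: finite_measure M2 by fact
  define m where "m = measure M1 (space M1)"
  \<comment> \<open>The transform at 0 is the total mass.\<close>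
  have m: "measure M2 (space M2) = m" using lap[of 0] by (simp add: m_def)
  show ?thesis
  proof (cases "m = 0")
    case True
    then have "emeasure M1 (space M1) = 0" "emeasure M2 (space M2) = 0"
      using m by (auto simp: M1.emeasure_eq_measure M2.emeasure_eq_measure m_def)
    then have "emeasure M1 A = 0" "emeasure M2 A = 0" for A
      using emeasure_space[of M1 A] emeasure_space[of M2 A] by auto
    then show ?thesis by (intro measure_eqI) (simp_all add: s1 s2)
  next
    case False
    then have mp: "m > 0" unfolding m_def by (simp add: zero_less_measure_iff)
    \<comment> \<open>Normalisation to mass one makes the moment lemma applicable, which is why mass
      zero is treated apart. The map - ln undoes the image under exp (- x).\<close>
    define Q where "Q M = density M (\<lambda>_. ennreal (1/m))" for M :: "real measure"
    define P where "P M = distr (Q M) borel (\<lambda>x. exp (- x))" for M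
    have key: "real_distribution (P M) \<and> (AE x in P M. \<bar>x\<bar> \<le> 1) \<and>
        (\<forall>n. (LINT x|P M. x ^ n) = (LINT x|M. exp (- real n * x)) / m) \<and> distr (P M) borel (\<lambda>y. - ln y) = Q M"
      if M: "finite_measure M" "sets M = sets borel" "AE x in M. 0 \<le> x" "measure M (space M) = m" for M
    proof -
      interpret finite_measure M by fact
      note M(2)[measurable_cong]
      have sQ [measurable_cong]: "sets (Q M) = sets borel" by (simp add: Q_def M(2))
      have "emeasure (Q M) (space (Q M)) = ennreal (1/m) * ennreal m"
        using M(4) by (simp add: Q_def emeasure_density_const emeasure_eq_measure)
      also have "\<dots> = 1" using mp by (simp add: ennreal_mult[symmetric])
      finally have pQ: "prob_space (Q M)" by (rule prob_spaceI)
      then have pP: "prob_space (P M)" unfolding P_def by (rule prob_space.prob_space_distr) measurable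
      have "real_distribution (P M)" 
        by (intro real_distribution.intro pP real_distribution_axioms.intro) (simp add: P_def)
      moreover have "AE x in Q M. 0 \<le> x"
        unfolding Q_def using M(3) by (subst AE_density) (auto elim!: eventually_mono)
      then have "AE x in P M. \<bar>x\<bar> \<le> 1"
        unfolding P_def by (subst AE_distr_iff) (auto elim!: eventually_mono)
      moreover have "(LINT x|P M. x ^ n) = (LINT x|M. exp (- real n * x)) / m" for n
      proof -
        have "(LINT x|P M. x ^ n) = (LINT x|Q M. exp (- x) ^ n)"
          unfolding P_def by (subst integral_distr) auto
        also have "\<dots> = (LINT x|M. (1/m) * exp (- x) ^ n)"
          unfolding Q_def using mp by (subst integral_density) auto
        finally show ?thesis by (simp add: exp_of_nat_mult[symmetric])
      qed
      moreover have "distr (P M) borel (\<lambda>y. - ln y) = Q M"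
        unfolding P_def by (subst distr_distr) (auto simp: comp_def intro!: distr_id2 sQ[symmetric])
      ultimately show ?thesis by blast
    qed
    note k1 = key[OF assms(1) s1 b1 m_def[symmetric]] and k2 = key[OF assms(2) s2 b2 m]
    have "P M1 = P M2"
      by (rule real_distribution_eq_of_moments) (use k1 k2 lap in auto)
    then have Q: "Q M1 = Q M2" using k1 k2 by metis
    show ?thesis
    proof (rule measure_eqI)
      fix A assume A: "A \<in> sets M1"
      have "ennreal (1/m) * emeasure M1 A = ennreal (1/m) * emeasure M2 A"
        using arg_cong[OF Q, of "\<lambda>N. emeasure N A"] A by (simp add: Q_def emeasure_density_const s1 s2)
      then show "emeasure M1 A = emeasure M2 A" using mp
        by (simp add: ennreal_mult_cancel_left)
    qed (simp add: s1 s2)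
  qed
qed

section \<open>Transforms and convolutions of non-negative functions\<close>

text \<open>Values in \<open>ennreal\<close> keep Tonelli's theorem free of integrability
  conditions; finiteness is read off from explicit transforms. At \<theta> = 0 this is the plain
  integral over the half-line and serves for L1 bounds.\<close>

definition laplace :: "(real \<Rightarrow> ennreal) \<Rightarrow> real \<Rightarrow> ennreal" where
  "laplace u \<theta> = (\<integral>\<^sup>+x. (if 0 < x then ennreal (exp (- \<theta> * x)) * u x else 0) \<partial>lborel)"

text \<open>The weight exp (- x) turns both functions into densities of finite measures, to which
  uniqueness at the integers applies. The weighted transform at n is the original one at n + 1, so
  only indices from 1 on occur.\<close>

lemma AE_eq_of_laplace:
  fixes u v :: "real \<Rightarrow> ennreal"
  assumes [measurable]: "u \<in> borel_measurable borel" "v \<in> borel_measurable borel"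
    and eq: "\<And>n. 1 \<le> n \<Longrightarrow> laplace u (real n) = laplace v (real n)"
    and fin: "laplace u 1 < \<infinity>"
  shows "AE x in lborel. 0 < x \<longrightarrow> u x = v x"
proof -
  define d where "d w x = (if 0 < x then ennreal (exp (- x)) * w x else 0)" for w :: "real \<Rightarrow> ennreal" and x
  define D where "D w = density lborel (d w)" for w
  have dm [measurable]: "d w \<in> borel_measurable borel" if [measurable]: "w \<in> borel_measurable borel" for w
    unfolding d_def by measurable
  have key: "finite_measure (D w) \<and> sets (D w) = sets borel \<and> (AE x in D w. 0 \<le> x) \<and>
      (\<forall>n::nat. (LINT x|D w. exp (- real n * x)) = enn2real (laplace w (real (Suc n))))"
    if w [measurable]: "w \<in> borel_measurable borel" and f: "laplace w 1 < \<infinity>" for w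
  proof (intro conjI allI)
    have "emeasure (D w) (space (D w)) = laplace w 1"
      unfolding D_def by (subst emeasure_density) (auto simp: laplace_def d_def intro!: nn_integral_cong)
    then show "finite_measure (D w)" using f by (intro finite_measureI) auto
    show "sets (D w) = sets borel" by (simp add: D_def)
    show "AE x in D w. 0 \<le> x" unfolding D_def by (subst AE_density) (auto simp: d_def)
    fix n :: nat
    have "(LINT x|D w. exp (- real n * x)) = enn2real (\<integral>\<^sup>+x. ennreal (exp (- real n * x)) \<partial>D w)"
      by (subst integral_eq_nn_integral) (auto simp: D_def)
    also have "(\<integral>\<^sup>+x. ennreal (exp (- real n * x)) \<partial>D w) = (\<integral>\<^sup>+x. d w x * ennreal (exp (- real n * x)) \<partial>lborel)"
      unfolding D_def by (subst nn_integral_density) auto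
    also have "\<dots> = laplace w (real (Suc n))"
      unfolding laplace_def d_def
      by (intro nn_integral_cong)
         (auto simp: mult.assoc mult.left_commute ennreal_mult[symmetric] exp_add[symmetric] algebra_simps
           simp del: ennreal_mult)
    finally show "(LINT x|D w. exp (- real n * x)) = enn2real (laplace w (real (Suc n)))" .
  qed
  have fv: "laplace v 1 < \<infinity>" using fin eq[of 1] by simp
  note ku = key[OF assms(1) fin] and kv = key[OF assms(2) fv]
  have "laplace u (1 + real n) = laplace v (1 + real n)" for n using eq[of "Suc n"] by simp
  then have "D u = D v"
    by (intro measure_eq_of_laplace) (use ku kv in auto)
  then have "AE x in lborel. d u x = d v x"
    unfolding D_def by (intro sigma_finite_measure.density_unique[OF lborel.sigma_finite_measure_axioms]) auto
  then show ?thesis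
  proof eventually_elim
    case (elim x)
    then show ?case by (auto simp: d_def ennreal_mult_cancel_left)
  qed
qed

text \<open>Convolution of \<open>u\<close> with the measure b delta_0 + k(s) ds. For
  \<open>b\<close> the drift and \<open>k\<close> the Levy tail it is convolution with k_f or k_g;
  for b = 0 and k = 1 it is integration from 0.\<close>

definition nconv :: "real \<Rightarrow> (real \<Rightarrow> ennreal) \<Rightarrow> (real \<Rightarrow> ennreal) \<Rightarrow> real \<Rightarrow> ennreal" where
  "nconv b k u r = ennreal b * u r + (\<integral>\<^sup>+s. (if 0 < s \<and> s < r then u (r - s) * k s else 0) \<partial>lborel)"

lemma measurable_nconv [measurable]:
  assumes [measurable]: "k \<in> borel_measurable borel" "(\<lambda>(x, r). U x r) \<in> borel_measurable (M \<Otimes>\<^sub>M borel)"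
    "t \<in> borel_measurable M"
  shows "(\<lambda>x. nconv b k (U x) (t x)) \<in> borel_measurable M"
  unfolding nconv_def by measurable

lemma measurable_laplace [measurable]:
  assumes [measurable]: "(\<lambda>(x, r). U x r) \<in> borel_measurable (M \<Otimes>\<^sub>M borel)" "t \<in> borel_measurable M"
  shows "(\<lambda>x. laplace (U x) (t x)) \<in> borel_measurable M"
  unfolding laplace_def by measurable

lemma laplace_add:
  assumes [measurable]: "u \<in> borel_measurable borel" "v \<in> borel_measurable borel"
  shows "laplace (\<lambda>x. u x + v x) \<theta> = laplace u \<theta> + laplace v \<theta>"
  unfolding laplace_def by (subst nn_integral_add[symmetric]) (auto intro!: nn_integral_cong simp: distrib_left)

lemma laplace_cmult:
  assumes [measurable]: "u \<in> borel_measurable borel"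
  shows "laplace (\<lambda>x. c * u x) \<theta> = c * laplace u \<theta>"
  unfolding laplace_def by (subst nn_integral_cmult[symmetric]) (auto intro!: nn_integral_cong simp: mult_ac)

lemma laplace_cong: "(\<And>x. 0 < x \<Longrightarrow> u x = v x) \<Longrightarrow> laplace u \<theta> = laplace v \<theta>"
  unfolding laplace_def by (intro nn_integral_cong) auto

text \<open>Tonelli and a shift of \<open>r\<close> by \<open>s\<close> give the usual product; the
  atom of the kernel at 0 contributes the constant \<open>b\<close>.\<close>

lemma laplace_nconv:
  assumes [measurable]: "k \<in> borel_measurable borel" "u \<in> borel_measurable borel"
  shows "laplace (nconv b k u) \<theta> = (ennreal b + laplace k \<theta>) * laplace u \<theta>"
proof -
  define J where "J r = (\<integral>\<^sup>+s. (if 0 < s \<and> s < r then u (r - s) * k s else 0) \<partial>lborel)" for r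
  have Jm [measurable]: "J \<in> borel_measurable borel" unfolding J_def by measurable
  have "laplace J \<theta> = (\<integral>\<^sup>+r. \<integral>\<^sup>+s. (if 0 < s \<and> s < r then ennreal (exp (- \<theta> * r)) * (u (r - s) * k s) else 0) \<partial>lborel \<partial>lborel)"
    unfolding laplace_def J_def
  proof (rule nn_integral_cong)
    fix r
    show "(if 0 < r then ennreal (exp (- \<theta> * r)) * (\<integral>\<^sup>+s. (if 0 < s \<and> s < r then u (r - s) * k s else 0) \<partial>lborel) else 0) =
      (\<integral>\<^sup>+s. (if 0 < s \<and> s < r then ennreal (exp (- \<theta> * r)) * (u (r - s) * k s) else 0) \<partial>lborel)"
    proof (cases "0 < r")
      case True
      then show ?thesis by (subst nn_integral_cmult[symmetric]) (auto intro!: nn_integral_cong)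
    next
      case False
      then have "\<not> (0 < s \<and> s < r)" for s by auto
      then show ?thesis using False by (simp only: if_False) simp
    qed
  qed
  also have "\<dots> = (\<integral>\<^sup>+s. \<integral>\<^sup>+r. (if 0 < s \<and> s < r then ennreal (exp (- \<theta> * r)) * (u (r - s) * k s) else 0) \<partial>lborel \<partial>lborel)"
    by (rule lborel_pair.Fubini') measurable
  also have "\<dots> = (\<integral>\<^sup>+s. (if 0 < s then ennreal (exp (- \<theta> * s)) * k s else 0) * laplace u \<theta> \<partial>lborel)"
  proof (rule nn_integral_cong)
    fix s :: real
    have "(\<integral>\<^sup>+r. (if 0 < s \<and> s < r then ennreal (exp (- \<theta> * r)) * (u (r - s) * k s) else 0) \<partial>lborel)
        = (\<integral>\<^sup>+r. (if 0 < s \<and> 0 < r then ennreal (exp (- \<theta> * (s + r))) * (u r * k s) else 0) \<partial>lborel)"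
      by (subst nn_integral_real_affine[of _ 1 s]) (auto intro!: nn_integral_cong)
    also have "\<dots> = (if 0 < s then ennreal (exp (- \<theta> * s)) * k s else 0) * laplace u \<theta>"
      unfolding laplace_def
      by (subst nn_integral_cmult[symmetric])
         (auto intro!: nn_integral_cong simp: algebra_simps exp_add exp_diff exp_minus ennreal_mult divide_inverse mult_ac)
    finally show "(\<integral>\<^sup>+r. (if 0 < s \<and> s < r then ennreal (exp (- \<theta> * r)) * (u (r - s) * k s) else 0) \<partial>lborel)
      = (if 0 < s then ennreal (exp (- \<theta> * s)) * k s else 0) * laplace u \<theta>" .
  qed
  also have "\<dots> = laplace k \<theta> * laplace u \<theta>"
    by (subst nn_integral_multc) (auto simp: laplace_def)
  finally have J: "laplace J \<theta> = laplace k \<theta> * laplace u \<theta>" .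
  have "laplace (nconv b k u) \<theta> = laplace (\<lambda>r. ennreal b * u r + J r) \<theta>"
    by (simp add: nconv_def[abs_def] J_def)
  also have "\<dots> = ennreal b * laplace u \<theta> + laplace J \<theta>"
    by (simp add: laplace_add laplace_cmult)
  finally show ?thesis by (simp add: J distrib_right)
qed

text \<open>Convolution acts on the second variable and the transform on the first, so Tonelli lets
  them commute. This allows transforming convolutions in time with respect to space.\<close>

lemma laplace_nconv_swap:
  assumes [measurable]: "k \<in> borel_measurable borel" "(\<lambda>(x, r). U x r) \<in> borel_measurable (borel \<Otimes>\<^sub>M borel)"
  shows "laplace (\<lambda>x. nconv b k (U x) t) \<theta> = nconv b k (\<lambda>r. laplace (\<lambda>x. U x r) \<theta>) t"
proof -
  have "laplace (\<lambda>x. \<integral>\<^sup>+s. (if 0 < s \<and> s < t then U x (t - s) * k s else 0) \<partial>lborel) \<theta>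
      = (\<integral>\<^sup>+x. \<integral>\<^sup>+s. (if 0 < x \<and> 0 < s \<and> s < t then ennreal (exp (- \<theta> * x)) * (U x (t - s) * k s) else 0) \<partial>lborel \<partial>lborel)"
    unfolding laplace_def
    by (intro nn_integral_cong) (auto simp: nn_integral_cmult[symmetric] if_distrib intro!: nn_integral_cong cong: if_cong)
  also have "\<dots> = (\<integral>\<^sup>+s. \<integral>\<^sup>+x. (if 0 < x \<and> 0 < s \<and> s < t then ennreal (exp (- \<theta> * x)) * (U x (t - s) * k s) else 0) \<partial>lborel \<partial>lborel)"
    by (rule lborel_pair.Fubini') measurable
  also have "\<dots> = (\<integral>\<^sup>+s. (if 0 < s \<and> s < t then laplace (\<lambda>x. U x (t - s)) \<theta> * k s else 0) \<partial>lborel)"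
    unfolding laplace_def
  proof (rule nn_integral_cong)
    fix s
    have "(\<integral>\<^sup>+x. (if 0 < x \<and> 0 < s \<and> s < t then ennreal (exp (- \<theta> * x)) * (U x (t - s) * k s) else 0) \<partial>lborel)
      = (\<integral>\<^sup>+x. (if 0 < x then ennreal (exp (- \<theta> * x)) * U x (t - s) else 0) * (if 0 < s \<and> s < t then k s else 0) \<partial>lborel)"
      by (intro nn_integral_cong) (auto simp: mult.assoc)
    also have "\<dots> = (\<integral>\<^sup>+x. (if 0 < x then ennreal (exp (- \<theta> * x)) * U x (t - s) else 0) \<partial>lborel) * (if 0 < s \<and> s < t then k s else 0)"
      by (rule nn_integral_multc) measurable
    finally show "(\<integral>\<^sup>+x. (if 0 < x \<and> 0 < s \<and> s < t then ennreal (exp (- \<theta> * x)) * (U x (t - s) * k s) else 0) \<partial>lborel)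
      = (if 0 < s \<and> s < t then (\<integral>\<^sup>+x. (if 0 < x then ennreal (exp (- \<theta> * x)) * U x (t - s) else 0) \<partial>lborel) * k s else 0)"
      by simp
  qed
  finally show ?thesis
    unfolding nconv_def by (subst laplace_add) (simp_all add: laplace_cmult)
qed

lemma laplace_one: "0 < \<theta> \<Longrightarrow> laplace (\<lambda>_. 1) \<theta> = ennreal (1 / \<theta>)"
proof -
  assume t: "0 < \<theta>"
  interpret prob_space "density lborel (exponential_density \<theta>)" by (rule prob_space_exponential_density[OF t])
  have "1 = (\<integral>\<^sup>+x. ennreal (exponential_density \<theta> x) \<partial>lborel)"
    using emeasure_space_1 by (simp add: emeasure_density)
  also have "\<dots> = (\<integral>\<^sup>+x. ennreal \<theta> * (if 0 < x then ennreal (exp (- \<theta> * x)) * 1 else 0) \<partial>lborel)"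
    using t AE_lborel_singleton[of "0::real"]
    by (intro nn_integral_cong_AE) (auto simp: exponential_density_def ennreal_mult[symmetric] mult_ac elim!: eventually_mono)
  also have "\<dots> = ennreal \<theta> * laplace (\<lambda>_. 1) \<theta>"
    unfolding laplace_def by (rule nn_integral_cmult) measurable
  finally have "ennreal (1/\<theta>) = (ennreal (1/\<theta>) * ennreal \<theta>) * laplace (\<lambda>_. 1) \<theta>" by (simp add: mult.assoc)
  also have "ennreal (1/\<theta>) * ennreal \<theta> = 1" using t by (simp add: ennreal_mult[symmetric])
  finally show ?thesis by simp
qed

section \<open>The Caputo--Djrbashian derivative in integrated form\<close>

lemma nn_integral_exp_interval:
  assumes s: "0 < s"
  shows "(\<integral>\<^sup>+t. (if 0 < t \<and> t < x then ennreal (exp (- s * t)) else 0) \<partial>lborel) = (if 0 < x then ennreal ((1 - exp (- s * x)) / s) else 0)"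
proof (cases "0 < x")
  case True
  have "(\<integral>\<^sup>+t. (if 0 < t \<and> t < x then ennreal (exp (- s * t)) else 0) \<partial>lborel) = (\<integral>\<^sup>+t. ennreal (exp (- s * t)) * indicator {0..x} t \<partial>lborel)"
    using AE_lborel_singleton[of "0::real"] AE_lborel_singleton[of x]
    by (intro nn_integral_cong_AE) (auto simp: indicator_def elim!: eventually_elim2)
  also have "\<dots> = ennreal ((- exp (- s * x) / s) - (- exp (- s * 0) / s))"
    using s True by (intro nn_integral_FTC_Icc) (auto intro!: derivative_eq_intros)
  finally show ?thesis using True by (simp add: diff_divide_distrib)
next
  case False
  then have "\<not> (0 < t \<and> t < x)" for t by auto
  then show ?thesis using False by (simp only: if_False) simp
qed

lemma levy_tail_nonneg: "0 \<le> levy_tail \<nu> s"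
  by (simp add: levy_tail_def)

lemma bernstein_functionD:
  assumes "bernstein_function b \<nu> f"
  shows "0 \<le> b" "sets \<nu> = sets borel" "emeasure \<nu> {..0} = 0"
    "(\<integral>\<^sup>+x. ennreal (min x 1) * indicator {0<..} x \<partial>\<nu>) < \<infinity>" "emeasure \<nu> {0<..} = \<infinity>"
    "0 < s \<Longrightarrow> f s = b * s + (LINT x:{0<..}|\<nu>. 1 - exp (- s * x))"
  using assms unfolding bernstein_function_def by auto

context
  fixes b :: real and \<nu> :: "real measure" and f :: "real \<Rightarrow> real"
  assumes bern: "bernstein_function b \<nu> f"
begin

lemma levy_sets: "sets \<nu> = sets borel" by (rule bernstein_functionD(2)[OF bern])

lemma levy_space: "space \<nu> = UNIV" using sets_eq_imp_space_eq[OF levy_sets] by simp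

lemma levy_finite_away_from_0:
  assumes e: "0 < e"
  shows "emeasure \<nu> {e<..} < \<infinity>"
proof -
  note levy_sets [measurable_cong]
  have "ennreal (min e 1) * emeasure \<nu> {e<..} = (\<integral>\<^sup>+x. ennreal (min e 1) * indicator {e<..} x \<partial>\<nu>)"
    by (subst nn_integral_cmult_indicator) (auto simp: levy_sets)
  also have "\<dots> \<le> (\<integral>\<^sup>+x. ennreal (min x 1) * indicator {0<..} x \<partial>\<nu>)"
    using e by (intro nn_integral_mono) (auto simp: indicator_def intro!: ennreal_leI)
  also have "\<dots> < \<infinity>" by (rule bernstein_functionD(4)[OF bern])
  finally show ?thesis using e by (auto simp: ennreal_mult_eq_top_iff less_top ennreal_mult_less_top)
qed

text \<open>Fubini against \<nu> requires it, the total mass being infinite. The mass beyond any e >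
  0 is finite because \<open>min x 1\<close> is bounded below there.\<close>

lemma levy_sigma_finite: "sigma_finite_measure \<nu>"
proof
  let ?A = "insert {..0} (range (\<lambda>n. {1 / real (Suc n)<..}))"
  have U: "\<Union> ?A = space \<nu>"
  proof -
    have "x \<in> \<Union> ?A" for x :: real
    proof (cases "x \<le> 0")
      case False
      then obtain n where "inverse (real (Suc n)) < x" using reals_Archimedean[of x] by auto
      then have "x \<in> {1 / real (Suc n)<..}" by (simp add: divide_inverse)
      then show ?thesis by blast
    qed simp
    then show ?thesis unfolding levy_space by blast
  qed
  have fin: "emeasure \<nu> a \<noteq> \<infinity>" if "a \<in> ?A" for a
  proof -
    from that consider "a = {..0}" | n where "a = {1 / real (Suc n)<..}" by blast
    then show ?thesis
    proof cases
      case 1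
      then show ?thesis using bernstein_functionD(3)[OF bern] by simp
    next
      case (2 n)
      then show ?thesis using levy_finite_away_from_0[of "1 / real (Suc n)"] by (simp add: less_top)
    qed
  qed
  have c: "countable ?A" by simp
  have s: "?A \<subseteq> sets \<nu>" by (auto simp: levy_sets)
  show "\<exists>A. countable A \<and> A \<subseteq> sets \<nu> \<and> \<Union> A = space \<nu> \<and> (\<forall>a\<in>A. emeasure \<nu> a \<noteq> \<infinity>)"
    by (intro exI[of _ ?A] conjI ballI c s U fin)
qed

text \<open>For s \<le> 0 the mass is infinite and \<open>measure\<close> returns the default 0;
  positivity of \<open>s\<close> excludes that value.\<close>

lemma emeasure_levy_tail: "0 < s \<Longrightarrow> emeasure \<nu> {s<..} = ennreal (levy_tail \<nu> s)"
  using levy_finite_away_from_0[of s] unfolding levy_tail_def by (simp add: emeasure_eq_ennreal_measure)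

lemma levy_tail_measurable: "levy_tail \<nu> \<in> borel_measurable borel"
proof -
  interpret sigma_finite_measure \<nu> by (rule levy_sigma_finite)
  note levy_sets [measurable_cong]
  have "(\<lambda>s. \<integral>\<^sup>+x. (if s < x then 1 else 0) \<partial>\<nu>) \<in> borel_measurable (borel :: real measure)"
    by measurable
  also have "(\<lambda>s. \<integral>\<^sup>+x. (if s < x then 1 else 0) \<partial>\<nu>) = (\<lambda>s. emeasure \<nu> {s<..})"
  proof
    fix s
    have "(\<integral>\<^sup>+x. (if s < x then 1 else 0) \<partial>\<nu>) = (\<integral>\<^sup>+x. indicator {s<..} x \<partial>\<nu>)"
      by (intro nn_integral_cong) (auto simp: indicator_def)
    then show "(\<integral>\<^sup>+x. (if s < x then 1 else 0) \<partial>\<nu>) = emeasure \<nu> {s<..}" by (simp add: levy_sets)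
  qed
  finally have [measurable]: "(\<lambda>s. emeasure \<nu> {s<..}) \<in> borel_measurable borel" .
  show ?thesis unfolding levy_tail_def[abs_def] measure_def by measurable
qed

text \<open>Guards against the default value 0 of a divergent Bochner integral in the formula for
  \<open>f\<close>.\<close>

lemma bernstein_integrable:
  assumes s: "0 < s"
  shows "set_integrable \<nu> {0<..} (\<lambda>x. 1 - exp (- s * x))"
proof -
  note levy_sets [measurable_cong]
  \<comment> \<open>Up to 1 this is 1 - exp (- u) \<le> u with u = s * x; beyond 1 the left side is
    below 1.\<close>
  have le: "1 - exp (- s * x) \<le> max 1 s * min x 1" if "0 < x" for x
  proof (cases "x \<le> 1")
    case True
    have "1 - exp (- s * x) \<le> s * x" using exp_ge_add_one_self[of "- s * x"] by simp
    also have "\<dots> \<le> max 1 s * x" using that by (intro mult_right_mono) auto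
    finally show ?thesis using True by (simp add: min_def)
  next
    case False
    have "1 - exp (- s * x) \<le> 1" by simp
    then show ?thesis using False by (simp add: min_def) (smt (verit) exp_ge_zero)
  qed
  have "(\<integral>\<^sup>+x. ennreal (norm (indicator {0<..} x *\<^sub>R (1 - exp (- s * x)))) \<partial>\<nu>)
      \<le> (\<integral>\<^sup>+x. ennreal (max 1 s) * (ennreal (min x 1) * indicator {0<..} x) \<partial>\<nu>)"
    using le s by (intro nn_integral_mono) (auto simp: indicator_def ennreal_mult[symmetric] mult_less_0_iff zero_le_mult_iff intro!: ennreal_leI)
  also have "\<dots> = ennreal (max 1 s) * (\<integral>\<^sup>+x. ennreal (min x 1) * indicator {0<..} x \<partial>\<nu>)"
    by (rule nn_integral_cmult) measurable
  also have "\<dots> < \<infinity>" using bernstein_functionD(4)[OF bern] by (simp add: ennreal_mult_less_top)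
  finally show ?thesis unfolding set_integrable_def
    by (intro integrableI_bounded) auto
qed

lemma bernstein_nn_integral:
  assumes s: "0 < s"
  shows "ennreal (f s) = ennreal (b * s) + (\<integral>\<^sup>+x. (if 0 < x then ennreal (1 - exp (- s * x)) else 0) \<partial>\<nu>)"
    and "b * s \<le> f s"
proof -
  note levy_sets [measurable_cong]
  have nn: "0 \<le> indicator {0<..} x *\<^sub>R (1 - exp (- s * x))" for x using s by (auto simp: indicator_def)
  have "(\<integral>\<^sup>+x. (if 0 < x then ennreal (1 - exp (- s * x)) else 0) \<partial>\<nu>) = (\<integral>\<^sup>+x. ennreal (indicator {0<..} x *\<^sub>R (1 - exp (- s * x))) \<partial>\<nu>)"
    by (intro nn_integral_cong) (auto simp: indicator_def)
  also have "\<dots> = ennreal (LINT x:{0<..}|\<nu>. 1 - exp (- s * x))"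
    using bernstein_integrable[OF s] nn unfolding set_integrable_def set_lebesgue_integral_def
    by (intro nn_integral_eq_integral) auto
  finally have 1: "(\<integral>\<^sup>+x. (if 0 < x then ennreal (1 - exp (- s * x)) else 0) \<partial>\<nu>) = ennreal (LINT x:{0<..}|\<nu>. 1 - exp (- s * x))" .
  have 2: "0 \<le> (LINT x:{0<..}|\<nu>. 1 - exp (- s * x))"
    unfolding set_lebesgue_integral_def using nn by (intro integral_nonneg_AE) auto
  then show "b * s \<le> f s" by (simp add: bernstein_functionD(6)[OF bern s])
  show "ennreal (f s) = ennreal (b * s) + (\<integral>\<^sup>+x. (if 0 < x then ennreal (1 - exp (- s * x)) else 0) \<partial>\<nu>)"
    unfolding 1 using 2 s bernstein_functionD(1)[OF bern] by (simp add: bernstein_functionD(6)[OF bern s])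
qed

text \<open>A vanishing integral of a positive function would make the half-line a \<nu>-null set,
  against its infinite mass.\<close>

lemma bernstein_pos:
  assumes s: "0 < s"
  shows "0 < f s"
proof -
  interpret sigma_finite_measure \<nu> by (rule levy_sigma_finite)
  note levy_sets [measurable_cong]
  have "f s \<noteq> 0"
  proof
    assume "f s = 0"
    then have "(\<integral>\<^sup>+x. (if 0 < x then ennreal (1 - exp (- s * x)) else 0) \<partial>\<nu>) = 0"
      using bernstein_nn_integral(1)[OF s] by simp
    then have "AE x in \<nu>. (if 0 < x then ennreal (1 - exp (- s * x)) else 0) = 0"
      by (subst (asm) nn_integral_0_iff_AE) auto
    then have "AE x in \<nu>. x \<notin> {0<..}" using s by (auto elim!: eventually_mono split: if_splits)
    then have "emeasure \<nu> {0<..} = 0" by (subst (asm) AE_iff_null_sets[symmetric]) (auto simp: levy_sets)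
    then show False using bernstein_functionD(5)[OF bern] by simp
  qed
  moreover have "0 \<le> f s" using bernstein_nn_integral(2)[OF s] bernstein_functionD(1)[OF bern] s
    by (meson mult_nonneg_nonneg order_trans less_imp_le)
  ultimately show ?thesis by simp
qed

text \<open>With the tail written as the \<nu>-integral of the indicator of t < x, Tonelli does the
  work of an integration by parts; the inner integral is (1 - exp (- s x)) / s.\<close>

lemma laplace_levy_tail:
  assumes s: "0 < s"
  shows "ennreal b + laplace (\<lambda>x. ennreal (levy_tail \<nu> x)) s = ennreal (f s / s)"
proof -
  interpret sigma_finite_measure \<nu> by (rule levy_sigma_finite)
  note levy_sets [measurable_cong]
  interpret P: pair_sigma_finite lborel \<nu> by unfold_locales
  note levy_tail_measurable [measurable]
  note E = nn_integral_exp_interval[OF s]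
  have "laplace (\<lambda>x. ennreal (levy_tail \<nu> x)) s = (\<integral>\<^sup>+t. (if 0 < t then ennreal (exp (- s * t)) * emeasure \<nu> {t<..} else 0) \<partial>lborel)"
    unfolding laplace_def by (intro nn_integral_cong) (auto simp: emeasure_levy_tail)
  also have "\<dots> = (\<integral>\<^sup>+t. \<integral>\<^sup>+x. (if 0 < t \<and> t < x then ennreal (exp (- s * t)) else 0) \<partial>\<nu> \<partial>lborel)"
  proof (rule nn_integral_cong)
    fix t :: real
    have "(\<integral>\<^sup>+x. (if 0 < t \<and> t < x then ennreal (exp (- s * t)) else 0) \<partial>\<nu>)
      = (\<integral>\<^sup>+x. (if 0 < t then ennreal (exp (- s * t)) else 0) * indicator {t<..} x \<partial>\<nu>)"
      by (intro nn_integral_cong) (auto simp: indicator_def)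
    also have "\<dots> = (if 0 < t then ennreal (exp (- s * t)) else 0) * emeasure \<nu> {t<..}"
      by (rule nn_integral_cmult_indicator) (simp add: levy_sets)
    finally show "(if 0 < t then ennreal (exp (- s * t)) * emeasure \<nu> {t<..} else 0)
      = (\<integral>\<^sup>+x. (if 0 < t \<and> t < x then ennreal (exp (- s * t)) else 0) \<partial>\<nu>)" by simp
  qed
  also have "\<dots> = (\<integral>\<^sup>+x. \<integral>\<^sup>+t. (if 0 < t \<and> t < x then ennreal (exp (- s * t)) else 0) \<partial>lborel \<partial>\<nu>)"
    by (rule P.Fubini'[symmetric]) measurable
  also have "\<dots> = (\<integral>\<^sup>+x. ennreal (1 / s) * (if 0 < x then ennreal (1 - exp (- s * x)) else 0) \<partial>\<nu>)"
    unfolding E using s by (intro nn_integral_cong) (auto simp: ennreal_mult[symmetric])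
  also have "\<dots> = ennreal (1/s) * (\<integral>\<^sup>+x. (if 0 < x then ennreal (1 - exp (- s * x)) else 0) \<partial>\<nu>)"
    by (rule nn_integral_cmult) measurable
  finally have "ennreal (1/s) * ennreal (b * s) + laplace (\<lambda>x. ennreal (levy_tail \<nu> x)) s = ennreal (1/s) * ennreal (f s)"
    unfolding bernstein_nn_integral(1)[OF s] by (simp add: distrib_left)
  then show ?thesis using s bernstein_functionD(1)[OF bern] bernstein_pos[OF s] by (simp add: ennreal_mult[symmetric])
qed

text \<open>The tail can blow up at 0. Below \<open>T\<close> the factor exp T * exp (- x) is at
  least 1, so the transform at 1, itself at most \<open>f 1\<close>, controls the integral.\<close>

lemma levy_tail_integrable: "set_integrable lborel {0<..<T} (levy_tail \<nu>)"
proof -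
  note levy_tail_measurable [measurable]
  have "(\<integral>\<^sup>+x. ennreal (norm (indicator {0<..<T} x *\<^sub>R levy_tail \<nu> x)) \<partial>lborel)
      \<le> (\<integral>\<^sup>+x. ennreal (exp T) * (if 0 < x then ennreal (exp (- 1 * x)) * ennreal (levy_tail \<nu> x) else 0) \<partial>lborel)"
  proof (rule nn_integral_mono)
    fix x
    have "levy_tail \<nu> x \<le> exp T * (exp (- x) * levy_tail \<nu> x)" if "x < T"
      using that levy_tail_nonneg[of \<nu> x] by (simp add: mult.assoc[symmetric] exp_add[symmetric] mult_le_cancel_right1)
    then show "ennreal (norm (indicator {0<..<T} x *\<^sub>R levy_tail \<nu> x))
        \<le> ennreal (exp T) * (if 0 < x then ennreal (exp (- 1 * x)) * ennreal (levy_tail \<nu> x) else 0)"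
      using levy_tail_nonneg[of \<nu> x] by (auto simp: indicator_def ennreal_mult[symmetric] intro!: ennreal_leI)
  qed
  also have "\<dots> = ennreal (exp T) * laplace (\<lambda>x. ennreal (levy_tail \<nu> x)) 1"
    unfolding laplace_def by (rule nn_integral_cmult) measurable
  also have "\<dots> < \<infinity>"
  proof -
    have "laplace (\<lambda>x. ennreal (levy_tail \<nu> x)) 1 \<le> ennreal (f 1 / 1)"
      unfolding laplace_levy_tail[OF zero_less_one, symmetric] by simp
    then show ?thesis by (auto simp: ennreal_mult_less_top intro: le_less_trans)
  qed
  finally show ?thesis unfolding set_integrable_def by (intro integrableI_bounded) auto
qed

end

section \<open>Integration of the Caputo derivative\<close>

text \<open>Fubini's form of 1 * (k * w) = (1 * k) * w. With \<open>k\<close> the derivative of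
  \<open>u\<close>, \<open>w\<close> the Levy tail and u 0 = 0, the right side is u * w, so this
  convolution is a primitive of the integral part of the Caputo derivative.\<close>

lemma convolution_primitive:
  fixes k w :: "real \<Rightarrow> real"
  assumes k: "integrable lborel k" and w: "\<And>T. set_integrable lborel {0<..<T} w"
    and wm [measurable]: "w \<in> borel_measurable borel"
  shows "integrable lborel (\<lambda>s. if 0 < s \<and> s < T then (LINT r:{0..T-s}|lborel. k r) * w s else 0)"
    and "AE t in lborel. integrable lborel (\<lambda>s. if 0 < s \<and> s < t then k (t - s) * w s else 0)"
    and "set_integrable lborel {0..T} (\<lambda>t. LINT s|lborel. (if 0 < s \<and> s < t then k (t - s) * w s else 0))"
    and "(LINT t:{0..T}|lborel. LINT s|lborel. (if 0 < s \<and> s < t then k (t - s) * w s else 0))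
       = (LINT s|lborel. (if 0 < s \<and> s < T then (LINT r:{0..T-s}|lborel. k r) * w s else 0))"
proof -
  have km [measurable]: "k \<in> borel_measurable borel" using k by auto
  \<comment> \<open>The bound t \<le> T makes the integrand integrable over the plane, since
    \<open>w\<close> is integrable on bounded intervals only.\<close>
  define \<Phi> where "\<Phi> T p = (case p of (t, s) \<Rightarrow> if 0 < s \<and> s < t \<and> t \<le> T then k (t - s) * w s else 0)" for T p
  have \<Phi>m [measurable]: "\<Phi> T \<in> borel_measurable (borel \<Otimes>\<^sub>M borel)" for T
    unfolding \<Phi>_def case_prod_beta by measurable
  have \<Phi>i: "integrable (lborel \<Otimes>\<^sub>M lborel) (\<Phi> T)" for T
  proof (rule integrableI_bounded)
    let ?k = "\<lambda>x. ennreal \<bar>k x\<bar>" and ?w = "\<lambda>x. ennreal (norm (indicator {0<..<T} x *\<^sub>R w x))"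
    have "(\<integral>\<^sup>+p. ennreal (norm (\<Phi> T p)) \<partial>(lborel \<Otimes>\<^sub>M lborel)) = (\<integral>\<^sup>+t. \<integral>\<^sup>+s. ennreal (norm (\<Phi> T (t, s))) \<partial>lborel \<partial>lborel)"
      by (rule lborel.nn_integral_fst[symmetric]) measurable
    also have "\<dots> \<le> laplace (nconv 0 ?w ?k) 0"
      unfolding laplace_def
    proof (rule nn_integral_mono)
      fix t
      show "(\<integral>\<^sup>+s. ennreal (norm (\<Phi> T (t, s))) \<partial>lborel) \<le> (if 0 < t then ennreal (exp (- 0 * t)) * nconv 0 ?w ?k t else 0)"
      proof (cases "0 < t")
        case True
        then show ?thesis
          by (auto simp: nconv_def \<Phi>_def indicator_def abs_mult ennreal_mult intro!: nn_integral_mono)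
      next
        case False
        then have "\<Phi> T (t, s) = 0" for s by (auto simp: \<Phi>_def)
        then show ?thesis by simp
      qed
    qed
    also have "\<dots> = laplace ?w 0 * laplace ?k 0" by (subst laplace_nconv) auto
    also have "\<dots> < \<infinity>"
    proof -
      have "laplace ?w 0 \<le> (\<integral>\<^sup>+x. ?w x \<partial>lborel)" "laplace ?k 0 \<le> (\<integral>\<^sup>+x. ?k x \<partial>lborel)"
        unfolding laplace_def by (auto intro!: nn_integral_mono)
      moreover have "(\<integral>\<^sup>+x. ?w x \<partial>lborel) < \<infinity>" "(\<integral>\<^sup>+x. ?k x \<partial>lborel) < \<infinity>"
        using w[of T] k unfolding set_integrable_def integrable_iff_bounded by simp_all
      ultimately show ?thesis by (auto simp: ennreal_mult_less_top intro: le_less_trans)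
    qed
    finally show "(\<integral>\<^sup>+p. ennreal (norm (\<Phi> T p)) \<partial>(lborel \<Otimes>\<^sub>M lborel)) < \<infinity>" .
  qed measurable
  have in1: "(\<integral>t. \<Phi> T (t, s) \<partial>lborel) = (if 0 < s \<and> s < T then (LINT r:{0..T-s}|lborel. k r) * w s else 0)" for s
  proof (cases "0 < s \<and> s < T")
    case True
    have "(\<integral>t. \<Phi> T (t, s) \<partial>lborel) = (\<integral>r. \<Phi> T (s + 1 * r, s) \<partial>lborel)"
      by (subst lborel_integral_real_affine[of 1 _ s]) auto
    also have "\<dots> = (\<integral>r. (indicator {0..T-s} r *\<^sub>R k r) * w s \<partial>lborel)"
      using AE_lborel_singleton[of "0::real"] True
      by (intro integral_cong_AE) (auto simp: \<Phi>_def indicator_def elim!: eventually_mono)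
    finally show ?thesis using True by (simp add: set_lebesgue_integral_def)
  next
    case False
    then have "\<Phi> T (t, s) = 0" for t by (auto simp: \<Phi>_def)
    then show ?thesis unfolding if_not_P[OF False] by simp
  qed
  have in2: "(\<integral>s. \<Phi> T (t, s) \<partial>lborel) = indicator {0..T} t *\<^sub>R (LINT s|lborel. (if 0 < s \<and> s < t then k (t - s) * w s else 0))" for t
  proof (cases "0 \<le> t \<and> t \<le> T")
    case False
    then have "\<Phi> T (t, s) = 0" for s by (auto simp: \<Phi>_def)
    then show ?thesis using False by (simp add: indicator_def)
  qed (auto simp: \<Phi>_def intro!: Bochner_Integration.integral_cong)
  show "integrable lborel (\<lambda>s. if 0 < s \<and> s < T then (LINT r:{0..T-s}|lborel. k r) * w s else 0)"
    using lborel_pair.integrable_snd[of "\<lambda>t s. \<Phi> T (t, s)"] \<Phi>i[of T] by (simp add: in1)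
  show "set_integrable lborel {0..T} (\<lambda>t. LINT s|lborel. (if 0 < s \<and> s < t then k (t - s) * w s else 0))"
    using lborel_pair.integrable_fst[of "\<lambda>t s. \<Phi> T (t, s)"] \<Phi>i[of T] by (simp add: in2 set_integrable_def)
  show "(LINT t:{0..T}|lborel. LINT s|lborel. (if 0 < s \<and> s < t then k (t - s) * w s else 0))
       = (LINT s|lborel. (if 0 < s \<and> s < T then (LINT r:{0..T-s}|lborel. k r) * w s else 0))"
    using lborel_pair.Fubini_integral[of "\<lambda>t s. \<Phi> T (t, s)"] \<Phi>i[of T] by (simp add: in1 in2 set_lebesgue_integral_def)
  \<comment> \<open>Integer horizons suffice and leave a single null set of times.\<close>
  have "AE t in lborel. integrable lborel (\<lambda>s. \<Phi> (real n) (t, s))" for n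
    using lborel_pair.AE_integrable_fst[of "\<lambda>t s. \<Phi> (real n) (t, s)"] \<Phi>i[of "real n"] by simp
  then have "AE t in lborel. \<forall>n. integrable lborel (\<lambda>s. \<Phi> (real n) (t, s))" unfolding AE_all_countable by blast
  then show "AE t in lborel. integrable lborel (\<lambda>s. if 0 < s \<and> s < t then k (t - s) * w s else 0)"
  proof eventually_elim
    case (elim t)
    obtain n where "t \<le> real n" using real_arch_simple by blast
    then show ?case using elim[rule_format, of n] by (simp add: \<Phi>_def)
  qed
qed

text \<open>Convolution with k_f for functions of either sign, over \<open>lebesgue\<close> as in
  \<open>caputo\<close>. On \<open>caputo_domain\<close>, and when u 0 = 0, it is a primitive of
  \<open>caputo\<close> away from the origin.\<close>

definition caputo_conv :: "real \<Rightarrow> real measure \<Rightarrow> (real \<Rightarrow> real) \<Rightarrow> real \<Rightarrow> real" where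
  "caputo_conv b \<nu> u r = b * u r + (LINT s:{0<..<r}|lebesgue. u (r - s) * levy_tail \<nu> s)"

lemma deriv_shift: "deriv (\<lambda>r. u (r - s)) (t::real) = deriv u (t - s)"
  unfolding deriv_def using DERIV_shift[of u _ t "-s"] by simp

text \<open>The branch of \<open>caputo\<close> that differentiates under the integral. A Borel
  version \<open>h\<close> of \<open>deriv u\<close> goes through
  \<open>convolution_primitive\<close>; it remains to exchange \<open>h\<close> for
  \<open>deriv u\<close> inside the integral over \<open>s\<close>.\<close>

lemma caputo_integral_abs_cont:
  assumes bern: "bernstein_function b \<nu> f" and ac: "\<And>T. 0 < T \<Longrightarrow> abs_cont 0 T u" and u0: "u 0 = 0"
    and c: "0 < c"
  shows "set_integrable lebesgue {0<..<c} (\<lambda>s. u (c - s) * levy_tail \<nu> s)"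
    and "set_integrable lebesgue {0..c} (caputo b \<nu> u)"
    and "(LINT s:{0..c}|lebesgue. caputo b \<nu> u s) = caputo_conv b \<nu> u c"
proof -
  note levy_tail_measurable[OF bern, measurable]
  obtain h where h: "integrable lborel h" "AE x in lborel. x \<in> {0..c} \<longrightarrow> h x = deriv u x"
    "\<And>B. B \<in> sets borel \<Longrightarrow> B \<subseteq> {0..c} \<Longrightarrow> (LINT s:B|lebesgue. deriv u s) = (LINT s:B|lborel. h s)"
    using set_integrable_lebesgue_borel_version[OF abs_cont_has_derivative_AE(2)[OF ac[OF c]]] by blast
  have uh: "u t = (LINT s:{0..t}|lborel. h s)" if "t \<in> {0..c}" for t
    using abs_cont_has_derivative_AE(3)[OF ac[OF c] that] h(3)[of "{0..t}"] that u0 by auto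
  note C = convolution_primitive[OF h(1) levy_tail_integrable[OF bern] levy_tail_measurable[OF bern]]
  let ?\<kappa> = "\<lambda>t. LINT s|lborel. (if 0 < s \<and> s < t then h (t - s) * levy_tail \<nu> s else 0)"
  have eq1: "(if 0 < s \<and> s < c then (LINT r:{0..c-s}|lborel. h r) * levy_tail \<nu> s else 0) = indicator {0<..<c} s *\<^sub>R (u (c - s) * levy_tail \<nu> s)" for s
    using uh[of "c - s"] by (auto simp: indicator_def)
  have "AE s in lborel. (if 0 < s \<and> s < c then (LINT r:{0..c-s}|lborel. h r) * levy_tail \<nu> s else 0) = indicator {0<..<c} s *\<^sub>R (u (c - s) * levy_tail \<nu> s)"
    using eq1 by simp
  note K0 = lebesgue_integral_eq_lborel_AE[OF C(1) this]
  from K0(1) show "set_integrable lebesgue {0<..<c} (\<lambda>s. u (c - s) * levy_tail \<nu> s)" by (simp add: set_integrable_def)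
  \<comment> \<open>The exceptional set is named because it has to be reflected:
    \<open>t - s\<close> must stay outside \<open>N\<close>, which excludes only a null set of
    \<open>s\<close> by invariance of Lebesgue measure under reflection and translation.\<close>
  from AE_E[OF h(2)] obtain N
    where N': "{x \<in> space lborel. \<not> (x \<in> {0..c} \<longrightarrow> h x = deriv u x)} \<subseteq> N" "emeasure lborel N = 0" "N \<in> sets lborel" .
  have N: "N \<in> null_sets lborel" "\<And>x. x \<in> {0..c} \<Longrightarrow> x \<notin> N \<Longrightarrow> h x = deriv u x"
    using N' by auto
  have cap: "AE t in lborel. t \<in> {0..c} \<longrightarrow> b * h t + ?\<kappa> t = caputo b \<nu> u t"
    using C(2) h(2)
  proof eventually_elim
    case (elim t)
    show ?case
    proof
      assume t: "t \<in> {0..c}"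
      have "distr lborel borel (\<lambda>s. t + (-1) * s) = density (distr lborel borel (\<lambda>s. t + (-1) * s)) (\<lambda>_. ennreal \<bar>-1\<bar>)"
        by (simp add: density_1)
      also have "\<dots> = (lborel :: real measure)" by (rule lborel_real_affine[symmetric]) simp
      finally have refl: "distr lborel borel (\<lambda>s. t + (-1) * s) = (lborel :: real measure)" .
      have "AE s in lborel. t - s \<notin> N"
      proof -
        have "AE x in distr lborel borel (\<lambda>s. t + (-1) * s). x \<notin> N"
          unfolding refl by (rule AE_not_in[OF N(1)])
        then show ?thesis using N(1) by (subst (asm) AE_distr_iff) auto
      qed
      then have "AE s in lborel. (if 0 < s \<and> s < t then h (t - s) * levy_tail \<nu> s else 0)
          = indicator {0<..<t} s *\<^sub>R (deriv (\<lambda>r. u (r - s)) t * levy_tail \<nu> s)"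
        by eventually_elim (use N(2) t in \<open>auto simp: deriv_shift indicator_def\<close>)
      from lebesgue_integral_eq_lborel_AE(2)[OF elim(1) this]
      have "(LINT s:{0<..<t}|lebesgue. deriv (\<lambda>r. u (r - s)) t * levy_tail \<nu> s) = ?\<kappa> t"
        by (simp add: set_lebesgue_integral_def)
      then show "b * h t + ?\<kappa> t = caputo b \<nu> u t"
        using ac elim(2) t unfolding caputo_def by simp
    qed
  qed
  have hi: "set_integrable lborel {0..c} (\<lambda>t. b * h t)"
    using set_integrable_lborel_all[OF h(1), of "{0..c}"] by simp
  have wi: "set_integrable lborel {0..c} (\<lambda>t. b * h t + ?\<kappa> t)" by (rule set_integral_add(1)[OF hi C(3)])
  have "AE t in lborel. indicator {0..c} t *\<^sub>R (b * h t + ?\<kappa> t) = indicator {0..c} t *\<^sub>R caputo b \<nu> u t"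
    using cap by eventually_elim (auto simp: indicator_def)
  note L = lebesgue_integral_eq_lborel_AE[OF wi[unfolded set_integrable_def] this]
  show "set_integrable lebesgue {0..c} (caputo b \<nu> u)" using L(1) by (simp add: set_integrable_def)
  have "(LINT s:{0..c}|lebesgue. caputo b \<nu> u s) = (LINT t:{0..c}|lborel. b * h t + ?\<kappa> t)"
    using L(2) by (simp add: set_lebesgue_integral_def)
  also have "\<dots> = b * u c + (LINT t:{0..c}|lborel. ?\<kappa> t)"
    using set_integral_add(2)[OF hi C(3)] uh[of c] c by simp
  also have "\<dots> = caputo_conv b \<nu> u c"
    unfolding C(4) caputo_conv_def using K0(2) by (simp add: set_lebesgue_integral_def)
  finally show "(LINT s:{0..c}|lebesgue. caputo b \<nu> u s) = caputo_conv b \<nu> u c" .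
qed

text \<open>Both branches of \<open>caputo\<close> have \<open>caputo_conv\<close> as primitive; u 0
  = 0 removes the boundary term of the second one. There absolute continuity is granted only away
  from 0, hence a > 0 and a difference of two values.\<close>

lemma caputo_integral:
  assumes bern: "bernstein_function b \<nu> f" and dom: "caputo_domain b \<nu> u" and u0: "u 0 = 0"
  shows "0 < t \<Longrightarrow> set_integrable lebesgue {0<..<t} (\<lambda>s. u (t - s) * levy_tail \<nu> s)"
    and "0 < a \<Longrightarrow> a < c \<Longrightarrow> set_integrable lebesgue {a..c} (caputo b \<nu> u)"
    and "0 < a \<Longrightarrow> a < c \<Longrightarrow> (LINT s:{a..c}|lebesgue. caputo b \<nu> u s) = caputo_conv b \<nu> u c - caputo_conv b \<nu> u a"
proof -
  have *: "(0 < t \<longrightarrow> set_integrable lebesgue {0<..<t} (\<lambda>s. u (t - s) * levy_tail \<nu> s)) \<and>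
    (0 < a \<longrightarrow> a < c \<longrightarrow> set_integrable lebesgue {a..c} (caputo b \<nu> u) \<and>
      (LINT s:{a..c}|lebesgue. caputo b \<nu> u s) = caputo_conv b \<nu> u c - caputo_conv b \<nu> u a)" for t a c
  proof (cases "\<forall>T>0. abs_cont 0 T u")
    case True
    have ac: "\<And>T. 0 < T \<Longrightarrow> abs_cont 0 T u" using True by blast
    note L = caputo_integral_abs_cont[OF bern ac u0]
    have "set_integrable lebesgue {a..c} (caputo b \<nu> u) \<and>
      (LINT s:{a..c}|lebesgue. caputo b \<nu> u s) = caputo_conv b \<nu> u c - caputo_conv b \<nu> u a" if ac: "0 < a" "a < c"
    proof
      have i: "set_integrable lebesgue {0..c} (caputo b \<nu> u)" using L(2)[of c] ac by auto
      then show i2: "set_integrable lebesgue {a..c} (caputo b \<nu> u)"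
        by (rule set_integrable_subset) (use ac in auto)
      have i1: "set_integrable lebesgue {0..a} (caputo b \<nu> u)"
        using i by (rule set_integrable_subset) (use ac in auto)
      have "(LINT s:{0..c}|lebesgue. caputo b \<nu> u s) = (LINT s:{0..a} \<union> {a..c}|lebesgue. caputo b \<nu> u s)"
        using ac by (simp add: ivl_disj_un_two_touch)
      also have "\<dots> = (LINT s:{0..a}|lebesgue. caputo b \<nu> u s) + (LINT s:{a..c}|lebesgue. caputo b \<nu> u s)"
      proof (rule set_integral_Un_AE[OF _ _ _ i1 i2])
        have "AE x in lborel. x \<noteq> a" by (rule AE_lborel_singleton)
        then have "AE x in lebesgue. x \<noteq> a" by (rule AE_completion)
        then show "AE x in lebesgue. \<not> (x \<in> {0..a} \<and> x \<in> {a..c})" by eventually_elim auto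
      qed auto
      finally show "(LINT s:{a..c}|lebesgue. caputo b \<nu> u s) = caputo_conv b \<nu> u c - caputo_conv b \<nu> u a"
        using L(3)[of c] L(3)[of a] ac by simp
    qed
    then show ?thesis using L(1)[of t] by blast
  next
    case False
    define K where "K r = (LINT s:{0<..<r}|lebesgue. u (r - s) * levy_tail \<nu> s)" for r
    have D: "\<And>t. 0 < t \<Longrightarrow> set_integrable lebesgue {0<..<t} (\<lambda>s. u (t - s) * levy_tail \<nu> s)"
      "\<And>a c. 0 < a \<Longrightarrow> a < c \<Longrightarrow> b \<noteq> 0 \<Longrightarrow> abs_cont a c u"
      "\<And>a c. 0 < a \<Longrightarrow> a < c \<Longrightarrow> abs_cont a c K"
      using dom False unfolding caputo_domain_def K_def[abs_def] by blast+
    have cap: "caputo b \<nu> u = (\<lambda>t. b * deriv u t + deriv K t)"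
      by (rule ext) (simp only: caputo_def if_not_P[OF False] u0 mult_zero_left diff_zero K_def[abs_def])
    have "set_integrable lebesgue {a..c} (caputo b \<nu> u) \<and>
      (LINT s:{a..c}|lebesgue. caputo b \<nu> u s) = caputo_conv b \<nu> u c - caputo_conv b \<nu> u a" if ac: "0 < a" "a < c"
    proof -
      have K: "set_integrable lebesgue {a..c} (deriv K)" "(LINT s:{a..c}|lebesgue. deriv K s) = K c - K a"
        using abs_cont_has_derivative_AE(2)[OF D(3)[OF ac]] abs_cont_has_derivative_AE(3)[OF D(3)[OF ac], of c] ac
        by simp_all
      have U: "set_integrable lebesgue {a..c} (\<lambda>t. b * deriv u t) \<and> (LINT s:{a..c}|lebesgue. b * deriv u s) = b * u c - b * u a"
      \<comment> \<open>The domain controls \<open>deriv u\<close> only for non-zero drift;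
        otherwise the factor \<open>b\<close> removes the term.\<close>
      proof (cases "b = 0")
        case False
        then show ?thesis using abs_cont_has_derivative_AE(2)[OF D(2)[OF ac False]] abs_cont_has_derivative_AE(3)[OF D(2)[OF ac False], of c] ac
          by (simp add: algebra_simps)
      qed (simp add: set_integrable_def set_lebesgue_integral_def)
      show ?thesis unfolding cap caputo_conv_def K_def[symmetric]
        using set_integral_add[OF conjunct1[OF U] K(1)] conjunct2[OF U] K(2) by (simp only: algebra_simps)
    qed
    then show ?thesis using D(1) by blast
  qed
  show "0 < t \<Longrightarrow> set_integrable lebesgue {0<..<t} (\<lambda>s. u (t - s) * levy_tail \<nu> s)" using * by blast
  show "0 < a \<Longrightarrow> a < c \<Longrightarrow> set_integrable lebesgue {a..c} (caputo b \<nu> u)" using * by blast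
  show "0 < a \<Longrightarrow> a < c \<Longrightarrow> (LINT s:{a..c}|lebesgue. caputo b \<nu> u s) = caputo_conv b \<nu> u c - caputo_conv b \<nu> u a" using * by blast
qed

section \<open>Subordinators and their inverses\<close>

text \<open>At s = n + 1 the integrand is at least 1 - exp (- 1) for x > 1 / s, and the mass of
  these half-lines grows to infinity with n. Here the infinite Levy measure enters the path
  properties.\<close>

lemma bernstein_unbounded:
  assumes bern: "bernstein_function b \<nu> f"
  shows "\<exists>s>0. C < f s"
proof -
  note [measurable_cong] = levy_sets[OF bern]
  have U: "(\<Union>n. {1 / real (Suc n)<..}) = {0<..}"
  proof -
    have "\<exists>n. 1 / real (Suc n) < x" if "0 < x" for x :: real
      using reals_Archimedean[OF that] by (auto simp: divide_inverse)
    moreover have "0 < x" if "1 / real (Suc n) < x" for x n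
      using that by (meson less_trans of_nat_0_less_iff zero_less_Suc zero_less_divide_1_iff)
    ultimately show ?thesis by (auto simp del: of_nat_Suc)
  qed
  have "(SUP n. emeasure \<nu> {1 / real (Suc n)<..}) = emeasure \<nu> (\<Union>n. {1 / real (Suc n)<..})"
  proof (rule SUP_emeasure_incseq)
    show "incseq (\<lambda>n. {1 / real (Suc n)<..})"
    proof (rule incseq_SucI)
      fix n
      have "1 / real (Suc (Suc n)) \<le> 1 / real (Suc n)" by (intro divide_left_mono) auto
      then show "{1 / real (Suc n)<..} \<le> {1 / real (Suc (Suc n))<..}" by auto
    qed
  qed (auto simp: levy_sets[OF bern])
  then have S: "(SUP n. emeasure \<nu> {1 / real (Suc n)<..}) = \<infinity>"
    unfolding U using bernstein_functionD(5)[OF bern] by simp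
  define c where "c = 1 - exp (-1::real)"
  have c: "0 < c" by (simp add: c_def)
  have "ennreal (max 0 C / c) < (SUP n. emeasure \<nu> {1 / real (Suc n)<..})" unfolding S by simp
  then obtain n where n: "ennreal (max 0 C / c) < emeasure \<nu> {1 / real (Suc n)<..}" by (auto simp: less_SUP_iff)
  define s where "s = real (Suc n)"
  have s: "0 < s" by (simp add: s_def)
  have "ennreal (max 0 C) = ennreal c * ennreal (max 0 C / c)" using c by (simp add: ennreal_mult[symmetric])
  also have "\<dots> < ennreal c * emeasure \<nu> {1 / s<..}"
    using n c unfolding s_def by (intro ennreal_mult_strict_left_mono) auto
  also have "\<dots> = (\<integral>\<^sup>+x. ennreal c * indicator {1 / s<..} x \<partial>\<nu>)"
    by (rule nn_integral_cmult_indicator[symmetric]) (simp add: levy_sets[OF bern])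
  also have "\<dots> \<le> (\<integral>\<^sup>+x. (if 0 < x then ennreal (1 - exp (- s * x)) else 0) \<partial>\<nu>)"
  proof (rule nn_integral_mono)
    fix x
    show "ennreal c * indicator {1 / s<..} x \<le> (if 0 < x then ennreal (1 - exp (- s * x)) else 0)"
    proof (cases "1 / s < x")
      case True
      then have "0 < x" "1 < s * x" using s by (auto simp: field_simps intro: less_trans[of 0 "1/s"])
      then show ?thesis using True by (auto simp: c_def intro!: ennreal_leI)
    qed auto
  qed
  also have "\<dots> \<le> ennreal (f s)" unfolding bernstein_nn_integral(1)[OF bern s] by simp
  finally have "max 0 C < f s" by (subst (asm) ennreal_less_iff) auto
  then show ?thesis using s by auto
qed

lemma right_continuous_increasingD:
  assumes "right_continuous_increasing z"
  shows "t \<le> 0 \<Longrightarrow> z t = 0" "mono z" "continuous (at_right t) z" "0 \<le> z t"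
proof -
  show z0: "z t = 0" if "t \<le> 0" for t using assms that by (auto simp: right_continuous_increasing_def)
  show m: "mono z" using assms by (auto simp: right_continuous_increasing_def)
  show "continuous (at_right t) z"
  proof (cases "0 \<le> t")
    case False
    have "(z \<longlongrightarrow> z t) (at_right t)"
    proof (rule tendsto_eventually)
      have "\<forall>\<^sub>F x in at_right t. x \<in> {t<..<0}" using False by (intro eventually_at_right_real) auto
      then show "\<forall>\<^sub>F x in at_right t. z x = z t" by eventually_elim (use False in \<open>auto simp: z0\<close>)
    qed
    then show ?thesis by (simp add: continuous_within)
  qed (use assms in \<open>auto simp: right_continuous_increasing_def\<close>)
  show "0 \<le> z t" using z0[of t] monoD[OF m, of 0 t] z0[of 0] by (cases "t \<le> 0") auto
qed

text \<open>Floor plus one stays strictly above \<open>r\<close> even at dyadic points, so that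
  limits are taken from the right; each level has countably many values.\<close>

definition dyadic_above :: "nat \<Rightarrow> real \<Rightarrow> real" where
  "dyadic_above n r = (real_of_int \<lfloor>2 ^ n * r\<rfloor> + 1) / 2 ^ n"

lemma dyadic_above_bounds: "r < dyadic_above n r" "dyadic_above n r \<le> r + 1 / 2 ^ n"
proof -
  show "r < dyadic_above n r" unfolding dyadic_above_def
    using real_of_int_floor_add_one_gt[of "2 ^ n * r"] by (simp add: field_simps)
  have "real_of_int \<lfloor>2 ^ n * r\<rfloor> \<le> 2 ^ n * r" by simp
  then show "dyadic_above n r \<le> r + 1 / 2 ^ n" unfolding dyadic_above_def by (simp add: field_simps)
qed

lemma dyadic_above_tendsto: "filterlim (\<lambda>n. dyadic_above n r) (at_right r) sequentially"
proof -
  have l: "(\<lambda>n. r + 1 / 2 ^ n) \<longlonglongrightarrow> r + 0"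
    by (intro tendsto_intros) (auto intro!: LIMSEQ_divide_realpow_zero)
  have "(\<lambda>n. dyadic_above n r) \<longlonglongrightarrow> r"
    by (rule tendsto_sandwich[OF _ _ tendsto_const l[simplified]]) (auto simp: dyadic_above_bounds less_imp_le)
  moreover have "dyadic_above n r \<noteq> r" for n using dyadic_above_bounds(1)[of r n] by simp
  ultimately show ?thesis
    unfolding filterlim_at by (auto simp: dyadic_above_bounds)
qed

text \<open>At each dyadic level only countably many measurable sections occur, and right-continuity
  passes to the limit. Joint measurability is what makes a process at a random time
  measurable.\<close>

lemma right_continuous_joint_measurable:
  fixes Z :: "real \<Rightarrow> 'a \<Rightarrow> real"
  assumes Z [measurable]: "\<And>r. Z r \<in> borel_measurable M"
    and rc: "\<And>\<omega> r. \<omega> \<in> space M \<Longrightarrow> continuous (at_right r) (\<lambda>t. Z t \<omega>)"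
  shows "(\<lambda>p. Z (fst p) (snd p)) \<in> borel_measurable (borel \<Otimes>\<^sub>M M)"
proof (rule borel_measurable_LIMSEQ_real)
  fix n
  have "(\<lambda>p. Z ((real_of_int k + 1) / 2 ^ n) (snd p)) \<in> borel_measurable (borel \<Otimes>\<^sub>M M)" for k :: int
    by measurable
  moreover have "(\<lambda>p::real \<times> 'a. \<lfloor>2 ^ n * fst p\<rfloor>) \<in> measurable (borel \<Otimes>\<^sub>M M) (count_space UNIV)"
    by (rule measurable_compose[OF _ measurable_real_floor]) measurable
  ultimately show "(\<lambda>p. Z (dyadic_above n (fst p)) (snd p)) \<in> borel_measurable (borel \<Otimes>\<^sub>M M)"
    unfolding dyadic_above_def by (rule measurable_compose_countable)
next
  fix p :: "real \<times> 'a" assume "p \<in> space (borel \<Otimes>\<^sub>M M)"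
  then have "snd p \<in> space M" by (auto simp: space_pair_measure)
  from rc[OF this, of "fst p"] show "(\<lambda>n. Z (dyadic_above n (fst p)) (snd p)) \<longlonglongrightarrow> Z (fst p) (snd p)"
    unfolding continuous_within by (rule filterlim_compose[OF _ dyadic_above_tendsto])
qed

lemma nn_integral_exponential_tail:
  assumes "0 < \<mu>"
  shows "(\<integral>\<^sup>+r. (if a < r then ennreal (\<mu> * exp (- \<mu> * r)) else 0) \<partial>lborel) = ennreal (exp (- \<mu> * a))"
proof -
  have "(\<integral>\<^sup>+r. (if a < r then ennreal (\<mu> * exp (- \<mu> * r)) else 0) \<partial>lborel)
      = (\<integral>\<^sup>+r. ennreal (\<mu> * exp (- \<mu> * r)) * indicator {a..} r \<partial>lborel)"
    using AE_lborel_singleton[of a]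
    by (intro nn_integral_cong_AE) (auto simp: indicator_def elim!: eventually_mono)
  also have "\<dots> = ennreal (0 - (- exp (- \<mu> * a)))"
  proof (rule nn_integral_FTC_atLeast)
    have "((\<lambda>r. exp (- \<mu> * r)) \<longlongrightarrow> 0) at_top"
      using assms by (intro filterlim_compose[OF exp_at_bot] filterlim_tendsto_neg_mult_at_bot[OF tendsto_const] filterlim_ident) auto
    then show "((\<lambda>r. - exp (- \<mu> * r)) \<longlongrightarrow> 0) at_top" using tendsto_minus by fastforce
  qed (use assms in \<open>auto intro!: derivative_eq_intros\<close>)
  finally show ?thesis by simp
qed

locale levy_subordinator = prob_space M for M :: "'a measure" +
  fixes b :: real and \<nu> :: "real measure" and f :: "real \<Rightarrow> real" and D :: "real \<Rightarrow> 'a \<Rightarrow> real"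
  assumes bern: "bernstein_function b \<nu> f" and sub: "subordinator M f D"
begin

lemma D_rci: "\<omega> \<in> space M \<Longrightarrow> right_continuous_increasing (\<lambda>t. D t \<omega>)"
  using sub by (simp add: subordinator_def)

lemma D_measurable [measurable]: "D t \<in> borel_measurable M"
proof (cases "0 \<le> t")
  case True
  then show ?thesis using sub by (simp add: subordinator_def)
next
  case False
  have "D t \<omega> = 0" if "\<omega> \<in> space M" for \<omega> using right_continuous_increasingD(1)[OF D_rci[OF that], of t] False by simp
  then show ?thesis by (subst measurable_cong[of _ _ "\<lambda>_. 0"]) auto
qed

lemma D_nonneg: "\<omega> \<in> space M \<Longrightarrow> 0 \<le> D t \<omega>"
  using right_continuous_increasingD(4)[OF D_rci] .

lemma D_mono: "\<omega> \<in> space M \<Longrightarrow> s \<le> t \<Longrightarrow> D s \<omega> \<le> D t \<omega>"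
  using right_continuous_increasingD(2)[OF D_rci, THEN monoD] .

lemma D_joint [measurable]: "(\<lambda>p. D (fst p) (snd p)) \<in> borel_measurable (borel \<Otimes>\<^sub>M M)"
  by (rule right_continuous_joint_measurable) (auto intro: right_continuous_increasingD(3)[OF D_rci])

lemma D_comp_measurable [measurable]:
  assumes [measurable]: "r \<in> borel_measurable N" "g \<in> measurable N M"
  shows "(\<lambda>x. D (r x) (g x)) \<in> borel_measurable N"
  using measurable_compose[OF _ D_joint, of "\<lambda>x. (r x, g x)" N] by simp

lemma D_laplace: "0 < s \<Longrightarrow> 0 \<le> t \<Longrightarrow> expectation (\<lambda>\<omega>. exp (- s * D t \<omega>)) = exp (- t * f s)"
  using sub by (simp add: subordinator_def)

lemma D_laplace_nn: "0 < s \<Longrightarrow> 0 \<le> t \<Longrightarrow> (\<integral>\<^sup>+\<omega>. ennreal (exp (- s * D t \<omega>)) \<partial>M) = ennreal (exp (- t * f s))"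
  unfolding D_laplace[symmetric]
  by (intro nn_integral_eq_integral integrable_const_bound[of _ 1]) (auto simp: D_nonneg)

text \<open>Markov's inequality for exp (- s * D t).\<close>

lemma prob_D_le:
  assumes "0 < s" "0 \<le> t"
  shows "prob {\<omega> \<in> space M. D t \<omega> \<le> x} \<le> exp (s * x) * exp (- t * f s)"
proof -
  have "ennreal (prob {\<omega> \<in> space M. D t \<omega> \<le> x}) = (\<integral>\<^sup>+\<omega>. indicator {\<omega> \<in> space M. D t \<omega> \<le> x} \<omega> \<partial>M)"
    by (simp add: emeasure_eq_measure)
  also have "\<dots> \<le> (\<integral>\<^sup>+\<omega>. ennreal (exp (s * x)) * ennreal (exp (- s * D t \<omega>)) \<partial>M)"
  proof (rule nn_integral_mono)
    fix \<omega>
    have "1 \<le> exp (s * x) * exp (- s * D t \<omega>)" if "D t \<omega> \<le> x"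
      using that assms by (simp add: exp_add[symmetric])
    then show "indicator {\<omega> \<in> space M. D t \<omega> \<le> x} \<omega> \<le> ennreal (exp (s * x)) * ennreal (exp (- s * D t \<omega>))"
      by (auto simp: indicator_def ennreal_mult[symmetric] simp del: ennreal_1 simp: ennreal_1[symmetric] intro!: ennreal_leI)
  qed
  also have "\<dots> = ennreal (exp (s * x)) * (\<integral>\<^sup>+\<omega>. ennreal (exp (- s * D t \<omega>)) \<partial>M)"
    by (rule nn_integral_cmult) measurable
  also have "\<dots> = ennreal (exp (s * x)) * ennreal (exp (- t * f s))"
    by (simp only: D_laplace_nn[OF assms])
  finally show ?thesis by (simp add: ennreal_mult[symmetric])
qed

text \<open>The exponential bound at level 0 is exp (- r * f s), arbitrarily small because
  \<open>f\<close> is unbounded: with infinite Levy measure the path leaves 0 at once.\<close>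

lemma D_pos: "0 < r \<Longrightarrow> AE \<omega> in M. 0 < D r \<omega>"
proof -
  assume r: "0 < r"
  have "prob {\<omega> \<in> space M. D r \<omega> \<le> 0} = 0"
  proof (rule ccontr)
    assume "prob {\<omega> \<in> space M. D r \<omega> \<le> 0} \<noteq> 0"
    then have p: "0 < prob {\<omega> \<in> space M. D r \<omega> \<le> 0}" by (simp add: zero_less_measure_iff)
    \<comment> \<open>The threshold solves exp (- r * y) = p for y, with p the probability in
      question.\<close>
    obtain s where s: "0 < s" "- ln (prob {\<omega> \<in> space M. D r \<omega> \<le> 0}) / r < f s"
      using bernstein_unbounded[OF bern] by blast
    have "prob {\<omega> \<in> space M. D r \<omega> \<le> 0} \<le> exp (- r * f s)" using prob_D_le[OF s(1), of r 0] r by simp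
    then have "ln (prob {\<omega> \<in> space M. D r \<omega> \<le> 0}) \<le> - r * f s" using p ln_le_cancel_iff[of _ "exp (- r * f s)"] by simp
    then show False using s(2) r by (simp add: field_simps)
  qed
  then have "AE \<omega> in M. \<not> D r \<omega> \<le> 0" by (subst prob_Collect_eq_0[symmetric]) auto
  then show ?thesis by eventually_elim simp
qed

text \<open>Makes the infimum in \<open>inverse_process\<close> run over a non-empty set almost
  surely. The bound at s = 1 decays geometrically in the integer time.\<close>

lemma D_unbounded: "AE \<omega> in M. \<exists>n::nat. t < D (real n) \<omega>"
proof -
  let ?A = "{\<omega> \<in> space M. \<forall>n::nat. D (real n) \<omega> \<le> t}"
  have bd: "prob ?A \<le> exp t * exp (- f 1) ^ n" for n :: nat
  proof -
    have "prob ?A \<le> prob {\<omega> \<in> space M. D (real n) \<omega> \<le> t}" by (intro finite_measure_mono) auto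
    also have "\<dots> \<le> exp (1 * t) * exp (- real n * f 1)" by (rule prob_D_le) auto
    finally show ?thesis by (simp add: exp_of_nat_mult[symmetric])
  qed
  have lim: "(\<lambda>n. exp t * exp (- f 1) ^ n) \<longlonglongrightarrow> exp t * 0"
    using bernstein_pos[OF bern, of 1] by (intro tendsto_intros LIMSEQ_realpow_zero) auto
  have "prob ?A \<le> exp t * 0" by (rule LIMSEQ_le_const[OF lim]) (use bd in blast)
  then have "prob ?A = 0" using measure_nonneg[of M ?A] by simp
  then have "AE \<omega> in M. \<not> (\<forall>n::nat. D (real n) \<omega> \<le> t)" by (subst prob_Collect_eq_0[symmetric]) auto
  then show ?thesis by eventually_elim (auto simp: not_le)
qed

abbreviation "E \<equiv> inverse_process D"

text \<open>Only strict comparisons with \<open>E t\<close> are made: at r = E t the path may or may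
  not exceed \<open>t\<close>.\<close>

lemma inverse_process_bounds:
  assumes \<omega>: "\<omega> \<in> space M" and n: "t < D (real n) \<omega>"
  shows "0 \<le> E t \<omega>" "0 \<le> r \<Longrightarrow> r < E t \<omega> \<Longrightarrow> D r \<omega> \<le> t" "E t \<omega> < r \<Longrightarrow> t < D r \<omega>"
proof -
  let ?S = "{r. 0 \<le> r \<and> t < D r \<omega>}"
  have ne: "?S \<noteq> {}" using n by (auto intro!: exI[of _ "real n"])
  have bd: "bdd_below ?S" by (rule bdd_belowI[of _ 0]) auto
  show "0 \<le> E t \<omega>" unfolding inverse_process_def using ne by (intro cInf_greatest) auto
  show "D r \<omega> \<le> t" if "0 \<le> r" "r < E t \<omega>"
  proof (rule ccontr)
    assume "\<not> D r \<omega> \<le> t"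
    then have "r \<in> ?S" using that by auto
    then have "Inf ?S \<le> r" using bd by (rule cInf_lower)
    then show False using that by (simp add: inverse_process_def)
  qed
  show "t < D r \<omega>" if "E t \<omega> < r"
  proof -
    have "\<exists>r'\<in>?S. r' < r" using that ne unfolding inverse_process_def by (meson cInf_lessD)
    then obtain r' where "r' < r" "t < D r' \<omega>" by auto
    then show ?thesis using D_mono[OF \<omega>, of r' r] by simp
  qed
qed

lemma E_nonneg: "AE \<omega> in M. 0 \<le> E t \<omega>"
  using D_unbounded[of t] AE_space by eventually_elim (auto dest: inverse_process_bounds(1))

text \<open>The right side is the probability that an exponential time of rate \<mu> exceeds
  \<open>E t\<close>. The identity trades the infimum for \<open>D\<close>, which is jointly
  measurable and has a known law; the single time r = E t is a null set.\<close>

lemma E_exponential: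
  assumes \<omega>: "\<omega> \<in> space M" and n: "t < D (real n) \<omega>" and \<mu>: "0 < \<mu>"
  shows "(\<integral>\<^sup>+r. (if 0 < r \<and> t < D r \<omega> then ennreal (\<mu> * exp (- \<mu> * r)) else 0) \<partial>lborel) = ennreal (exp (- \<mu> * E t \<omega>))"
proof -
  have "(\<integral>\<^sup>+r. (if 0 < r \<and> t < D r \<omega> then ennreal (\<mu> * exp (- \<mu> * r)) else 0) \<partial>lborel)
      = (\<integral>\<^sup>+r. (if E t \<omega> < r then ennreal (\<mu> * exp (- \<mu> * r)) else 0) \<partial>lborel)"
  proof (rule nn_integral_cong_AE)
    show "AE r in lborel. (if 0 < r \<and> t < D r \<omega> then ennreal (\<mu> * exp (- \<mu> * r)) else 0) = (if E t \<omega> < r then ennreal (\<mu> * exp (- \<mu> * r)) else 0)"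
      using AE_lborel_singleton[of "E t \<omega>"]
    proof eventually_elim
      case (elim r)
      show ?case
      proof (cases "E t \<omega> < r")
        case True
        then show ?thesis using inverse_process_bounds(1)[OF \<omega> n] inverse_process_bounds(3)[OF \<omega> n, of r] by simp
      next
        case False
        then show ?thesis using inverse_process_bounds(2)[OF \<omega> n, of r] elim by force
      qed
    qed
  qed
  then show ?thesis by (simp add: nn_integral_exponential_tail[OF \<mu>])
qed

text \<open>\<open>E_exponential\<close> at rate 1, solved for \<open>E t\<close> by a logarithm,
  exhibits it through an integral of jointly measurable data.\<close>

lemma E_measurable [measurable]: "E t \<in> borel_measurable M"
proof -
  \<comment> \<open>Where \<open>D\<close> never exceeds \<open>t\<close>, the value of \<open>E t\<close> is the junk value \<open>Inf {}\<close>.\<close>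
  let ?g = "\<lambda>\<omega>. - ln (enn2real (\<integral>\<^sup>+r. (if 0 < r \<and> t < D r \<omega> then ennreal (1 * exp (- 1 * r)) else 0) \<partial>lborel))"
  have "E t \<omega> = (if \<exists>n::nat. t < D (real n) \<omega> then ?g \<omega> else Inf {})" if \<omega>: "\<omega> \<in> space M" for \<omega>
  proof (cases "\<exists>n::nat. t < D (real n) \<omega>")
    case True
    then obtain n where n: "t < D (real n) \<omega>" by blast
    show ?thesis using True E_exponential[OF \<omega> n, of 1] by simp
  next
    case False
    have S: "{r. 0 \<le> r \<and> t < D r \<omega>} = {}"
    proof -
      { fix r assume "0 \<le> r" "t < D r \<omega>"
        obtain n where "r \<le> real n" using real_arch_simple by blast
        then have "t < D (real n) \<omega>" using D_mono[OF \<omega>, of r "real n"] \<open>t < D r \<omega>\<close> by simp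
        then have False using False by blast }
      then show ?thesis by blast
    qed
    show ?thesis by (simp only: inverse_process_def S if_not_P[OF False])
  qed
  moreover have "(\<lambda>\<omega>. if \<exists>n::nat. t < D (real n) \<omega> then ?g \<omega> else Inf {}) \<in> borel_measurable M"
    by measurable
  ultimately show ?thesis by (subst measurable_cong) auto
qed

lemma nn_E_exponential:
  assumes \<mu>: "0 < \<mu>"
  shows "(\<integral>\<^sup>+\<omega>. ennreal (exp (- \<mu> * E t \<omega>)) \<partial>M)
    = (\<integral>\<^sup>+r. (if 0 < r then ennreal (\<mu> * exp (- \<mu> * r)) * emeasure M {\<omega> \<in> space M. t < D r \<omega>} else 0) \<partial>lborel)"
proof -
  interpret P: pair_sigma_finite lborel M by unfold_locales
  have "(\<integral>\<^sup>+\<omega>. ennreal (exp (- \<mu> * E t \<omega>)) \<partial>M) = (\<integral>\<^sup>+\<omega>. \<integral>\<^sup>+r. (if 0 < r \<and> t < D r \<omega> then ennreal (\<mu> * exp (- \<mu> * r)) else 0) \<partial>lborel \<partial>M)"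
    using D_unbounded[of t] AE_space
    by (intro nn_integral_cong_AE, eventually_elim) (auto simp: E_exponential[OF _ _ \<mu>])
  also have "\<dots> = (\<integral>\<^sup>+r. \<integral>\<^sup>+\<omega>. (if 0 < r \<and> t < D r \<omega> then ennreal (\<mu> * exp (- \<mu> * r)) else 0) \<partial>M \<partial>lborel)"
    by (rule P.Fubini') measurable
  also have "\<dots> = (\<integral>\<^sup>+r. (if 0 < r then ennreal (\<mu> * exp (- \<mu> * r)) * emeasure M {\<omega> \<in> space M. t < D r \<omega>} else 0) \<partial>lborel)"
  proof (rule nn_integral_cong)
    fix r :: real
    have "(\<integral>\<^sup>+\<omega>. (if 0 < r \<and> t < D r \<omega> then ennreal (\<mu> * exp (- \<mu> * r)) else 0) \<partial>M)
      = (\<integral>\<^sup>+\<omega>. (if 0 < r then ennreal (\<mu> * exp (- \<mu> * r)) else 0) * indicator {\<omega> \<in> space M. t < D r \<omega>} \<omega> \<partial>M)"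
      by (intro nn_integral_cong) (auto simp: indicator_def)
    also have "\<dots> = (if 0 < r then ennreal (\<mu> * exp (- \<mu> * r)) else 0) * emeasure M {\<omega> \<in> space M. t < D r \<omega>}"
      by (rule nn_integral_cmult_indicator) measurable
    finally show "(\<integral>\<^sup>+\<omega>. (if 0 < r \<and> t < D r \<omega> then ennreal (\<mu> * exp (- \<mu> * r)) else 0) \<partial>M)
      = (if 0 < r then ennreal (\<mu> * exp (- \<mu> * r)) * emeasure M {\<omega> \<in> space M. t < D r \<omega>} else 0)" by simp
  qed
  finally show ?thesis .
qed

text \<open>At each positive time \<open>D\<close> is positive almost surely, so the exponential
  time of \<open>E_exponential\<close> is never cut off. This is the source of strictly positive
  jumps and of the initial condition.\<close>

lemma expectation_exp_E_0:
  assumes \<mu>: "0 < \<mu>"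
  shows "expectation (\<lambda>\<omega>. exp (- \<mu> * E 0 \<omega>)) = 1"
proof -
  have e1: "emeasure M {\<omega> \<in> space M. 0 < D r \<omega>} = 1" if "0 < r" for r
    using D_pos[OF that] by (intro emeasure_eq_1_AE) auto
  have "(\<integral>\<^sup>+\<omega>. ennreal (exp (- \<mu> * E 0 \<omega>)) \<partial>M) = (\<integral>\<^sup>+r. (if 0 < r then ennreal (\<mu> * exp (- \<mu> * r)) else 0) \<partial>lborel)"
    unfolding nn_E_exponential[OF \<mu>] by (intro nn_integral_cong) (auto simp: e1)
  also have "\<dots> = 1" by (simp add: nn_integral_exponential_tail[OF \<mu>])
  finally show ?thesis by (subst integral_eq_nn_integral) auto
qed

end

text \<open>Integrating exp (- s t) up to \<open>V\<close> gives (1 - exp (- s V)) / s. Used for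
  \<open>D r\<close> to reach the law of \<open>E\<close>, and for a jump to turn its tail into a
  transform.\<close>

lemma (in prob_space) laplace_tail_probability:
  assumes [measurable]: "V \<in> borel_measurable M" and nn: "AE \<omega> in M. 0 \<le> V \<omega>" and s: "0 < s"
  shows "laplace (\<lambda>t. emeasure M {\<omega> \<in> space M. t < V \<omega>}) s = ennreal ((1 - expectation (\<lambda>\<omega>. exp (- s * V \<omega>))) / s)"
proof -
  interpret P: pair_sigma_finite lborel M by unfold_locales
  have "laplace (\<lambda>t. emeasure M {\<omega> \<in> space M. t < V \<omega>}) s = (\<integral>\<^sup>+t. \<integral>\<^sup>+\<omega>. (if 0 < t \<and> t < V \<omega> then ennreal (exp (- s * t)) else 0) \<partial>M \<partial>lborel)"
    unfolding laplace_def
  proof (rule nn_integral_cong)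
    fix t :: real
    have "(\<integral>\<^sup>+\<omega>. (if 0 < t \<and> t < V \<omega> then ennreal (exp (- s * t)) else 0) \<partial>M)
      = (\<integral>\<^sup>+\<omega>. (if 0 < t then ennreal (exp (- s * t)) else 0) * indicator {\<omega> \<in> space M. t < V \<omega>} \<omega> \<partial>M)"
      by (intro nn_integral_cong) (auto simp: indicator_def)
    also have "\<dots> = (if 0 < t then ennreal (exp (- s * t)) else 0) * emeasure M {\<omega> \<in> space M. t < V \<omega>}"
      by (rule nn_integral_cmult_indicator) measurable
    finally show "(if 0 < t then ennreal (exp (- s * t)) * emeasure M {\<omega> \<in> space M. t < V \<omega>} else 0)
      = (\<integral>\<^sup>+\<omega>. (if 0 < t \<and> t < V \<omega> then ennreal (exp (- s * t)) else 0) \<partial>M)" by simp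
  qed
  also have "\<dots> = (\<integral>\<^sup>+\<omega>. \<integral>\<^sup>+t. (if 0 < t \<and> t < V \<omega> then ennreal (exp (- s * t)) else 0) \<partial>lborel \<partial>M)"
    by (rule P.Fubini'[symmetric]) measurable
  also have "\<dots> = (\<integral>\<^sup>+\<omega>. ennreal ((1 - exp (- s * V \<omega>)) / s) \<partial>M)"
    using nn by (intro nn_integral_cong_AE) (auto simp: nn_integral_exp_interval[OF s] elim!: eventually_mono)
  also have "\<dots> = ennreal (expectation (\<lambda>\<omega>. (1 - exp (- s * V \<omega>)) / s))"
  proof (rule nn_integral_eq_integral)
    show "integrable M (\<lambda>\<omega>. (1 - exp (- s * V \<omega>)) / s)"
      using nn s by (intro integrable_const_bound[of _ "1/s"]) (auto simp: field_simps elim!: eventually_mono)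
    show "AE \<omega> in M. 0 \<le> (1 - exp (- s * V \<omega>)) / s" using nn s by (auto elim!: eventually_mono)
  qed
  also have "expectation (\<lambda>\<omega>. (1 - exp (- s * V \<omega>)) / s) = (1 - expectation (\<lambda>\<omega>. exp (- s * V \<omega>))) / s"
  proof -
    have "integrable M (\<lambda>\<omega>. exp (- s * V \<omega>))"
      using nn s by (intro integrable_const_bound[of _ 1]) (auto elim!: eventually_mono)
    then show ?thesis by (simp add: prob_space)
  qed
  finally show ?thesis .
qed

context levy_subordinator
begin

lemma E_exp_integrable: "0 < \<mu> \<Longrightarrow> integrable M (\<lambda>\<omega>. exp (- \<mu> * E t \<omega>))"
  using E_nonneg[of t] by (intro integrable_const_bound[of _ 1]) (auto elim!: eventually_mono)

lemma D_tail_measurable: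
  fixes t r :: "'c \<Rightarrow> real"
  assumes "t \<in> borel_measurable N" "r \<in> borel_measurable N"
  shows "(\<lambda>x. emeasure M {\<omega> \<in> space M. t x < D (r x) \<omega>}) \<in> borel_measurable N"
proof -
  have pm: "(\<lambda>(t, r). emeasure M {\<omega> \<in> space M. t < D r \<omega>}) \<in> borel_measurable (borel \<Otimes>\<^sub>M borel)"
  proof -
    have "(\<lambda>(t, r). \<integral>\<^sup>+\<omega>. (if t < D r \<omega> then 1 else 0) \<partial>M) \<in> borel_measurable (borel \<Otimes>\<^sub>M borel)" by measurable
    also have "(\<lambda>(t, r). \<integral>\<^sup>+\<omega>. (if t < D r \<omega> then 1 else 0) \<partial>M) = (\<lambda>(t, r). emeasure M {\<omega> \<in> space M. t < D r \<omega>})"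
    proof (intro ext, clarify)
      fix t r
      have "(\<integral>\<^sup>+\<omega>. (if t < D r \<omega> then 1 else 0) \<partial>M) = (\<integral>\<^sup>+\<omega>. indicator {\<omega> \<in> space M. t < D r \<omega>} \<omega> \<partial>M)"
        by (intro nn_integral_cong) (auto simp: indicator_def)
      then show "(\<integral>\<^sup>+\<omega>. (if t < D r \<omega> then 1 else 0) \<partial>M) = emeasure M {\<omega> \<in> space M. t < D r \<omega>}" by simp
    qed
    finally show ?thesis .
  qed
  then have pm': "(\<lambda>p. emeasure M {\<omega> \<in> space M. fst p < D (snd p) \<omega>}) \<in> borel_measurable (borel \<Otimes>\<^sub>M borel)"
    by (simp add: case_prod_beta)
  then show ?thesis
    using measurable_compose[OF _ pm', of "\<lambda>x. (t x, r x)" N] assms by simp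
qed

lemma expectation_exp_E_nn: "0 < \<mu> \<Longrightarrow> ennreal (expectation (\<lambda>\<omega>. exp (- \<mu> * E t \<omega>))) = (\<integral>\<^sup>+r. (if 0 < r then ennreal (\<mu> * exp (- \<mu> * r)) * emeasure M {\<omega> \<in> space M. t < D r \<omega>} else 0) \<partial>lborel)"
  unfolding nn_E_exponential[symmetric]
  by (intro nn_integral_eq_integral[symmetric] E_exp_integrable) auto

lemma expectation_exp_E_measurable:
  assumes \<mu>: "0 < \<mu>"
  shows "(\<lambda>t. expectation (\<lambda>\<omega>. exp (- \<mu> * E t \<omega>))) \<in> borel_measurable borel"
proof -
  note D_tail_measurable [measurable]
  have "(\<lambda>t. enn2real (ennreal (expectation (\<lambda>\<omega>. exp (- \<mu> * E t \<omega>))))) \<in> borel_measurable borel"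
    unfolding expectation_exp_E_nn[OF \<mu>] by measurable
  moreover have "enn2real (ennreal (expectation (\<lambda>\<omega>. exp (- \<mu> * E t \<omega>)))) = expectation (\<lambda>\<omega>. exp (- \<mu> * E t \<omega>))" for t
    by (intro enn2real_ennreal integral_nonneg_AE) auto
  ultimately show ?thesis by simp
qed

lemma laplace_E:
  assumes \<mu>: "0 < \<mu>" and s: "0 < s"
  shows "laplace (\<lambda>t. ennreal (expectation (\<lambda>\<omega>. exp (- \<mu> * E t \<omega>)))) s = ennreal (f s / s / (\<mu> + f s))"
proof -
  interpret P: pair_sigma_finite lborel M by unfold_locales
  note fp = bernstein_pos[OF bern s]
  note nn = expectation_exp_E_nn[OF \<mu>]
  note D_tail_measurable [measurable]
  have "laplace (\<lambda>t. ennreal (expectation (\<lambda>\<omega>. exp (- \<mu> * E t \<omega>)))) s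
     = (\<integral>\<^sup>+t. \<integral>\<^sup>+r. (if 0 < t \<and> 0 < r then ennreal (exp (- s * t)) * (ennreal (\<mu> * exp (- \<mu> * r)) * emeasure M {\<omega> \<in> space M. t < D r \<omega>}) else 0) \<partial>lborel \<partial>lborel)"
    unfolding laplace_def nn
    by (intro nn_integral_cong) (auto simp: nn_integral_cmult[symmetric] intro!: nn_integral_cong)
  also have "\<dots> = (\<integral>\<^sup>+r. \<integral>\<^sup>+t. (if 0 < t \<and> 0 < r then ennreal (exp (- s * t)) * (ennreal (\<mu> * exp (- \<mu> * r)) * emeasure M {\<omega> \<in> space M. t < D r \<omega>}) else 0) \<partial>lborel \<partial>lborel)"
    by (rule lborel_pair.Fubini') measurable
  also have "\<dots> = (\<integral>\<^sup>+r. (if 0 < r then ennreal (\<mu> * exp (- \<mu> * r)) * laplace (\<lambda>t. emeasure M {\<omega> \<in> space M. t < D r \<omega>}) s else 0) \<partial>lborel)"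
    unfolding laplace_def
    by (intro nn_integral_cong) (auto simp: nn_integral_cmult[symmetric] mult_ac intro!: nn_integral_cong)
  also have "\<dots> = (\<integral>\<^sup>+r. (if 0 < r then ennreal (\<mu> * exp (- \<mu> * r) * ((1 - exp (- r * f s)) / s)) else 0) \<partial>lborel)"
  proof (rule nn_integral_cong)
    fix r :: real
    have "laplace (\<lambda>t. emeasure M {\<omega> \<in> space M. t < D r \<omega>}) s = ennreal ((1 - exp (- r * f s)) / s)" if "0 < r"
      using laplace_tail_probability[of "D r" s] D_laplace[of s r] that s by (simp add: D_nonneg)
    then show "(if 0 < r then ennreal (\<mu> * exp (- \<mu> * r)) * laplace (\<lambda>t. emeasure M {\<omega> \<in> space M. t < D r \<omega>}) s else 0)
      = (if 0 < r then ennreal (\<mu> * exp (- \<mu> * r) * ((1 - exp (- r * f s)) / s)) else 0)"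
      using ennreal_mult'[of "\<mu> * exp (- \<mu> * r)" "(1 - exp (- r * f s)) / s"] \<mu>
      by (cases "0 < r") (simp_all only: if_True if_False, simp)
  qed
  also have "\<dots> = ennreal (f s / s / (\<mu> + f s))"
  proof -
    let ?I = "\<integral>\<^sup>+r. (if 0 < r then ennreal (\<mu> * exp (- \<mu> * r) * ((1 - exp (- r * f s)) / s)) else 0) \<partial>lborel"
    \<comment> \<open>To avoid subtraction in \<open>ennreal\<close>, the integral of the subtracted
      exponential is added on both sides; the sum is the full integral 1 / s, and the finite extra
      term is cancelled at the end.\<close>
    have "?I + ennreal (\<mu> / (\<mu> + f s) / s) = ?I + (\<integral>\<^sup>+r. ennreal (\<mu> / (\<mu> + f s) / s) * (if 0 < r then ennreal ((\<mu> + f s) * exp (- (\<mu> + f s) * r)) else 0) \<partial>lborel)"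
      using \<mu> fp by (subst nn_integral_cmult) (auto simp: nn_integral_exponential_tail)
    also have "\<dots> = (\<integral>\<^sup>+r. (if 0 < r then ennreal (\<mu> * exp (- \<mu> * r) * ((1 - exp (- r * f s)) / s)) else 0)
        + ennreal (\<mu> / (\<mu> + f s) / s) * (if 0 < r then ennreal ((\<mu> + f s) * exp (- (\<mu> + f s) * r)) else 0) \<partial>lborel)"
      by (rule nn_integral_add[symmetric]) measurable
    also have "\<dots> = (\<integral>\<^sup>+r. ennreal (1 / s) * (if 0 < r then ennreal (\<mu> * exp (- \<mu> * r)) else 0) \<partial>lborel)"
    proof (rule nn_integral_cong)
      fix r :: real
      have "\<mu> * exp (- \<mu> * r) * ((1 - exp (- r * f s)) / s) + \<mu> / (\<mu> + f s) / s * ((\<mu> + f s) * exp (- (\<mu> + f s) * r)) = 1 / s * (\<mu> * exp (- \<mu> * r))"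
      proof -
        have "exp (- (\<mu> + f s) * r) = exp (- \<mu> * r) * exp (- r * f s)" by (simp add: exp_add[symmetric] algebra_simps)
        moreover have "\<mu> / (\<mu> + f s) / s * ((\<mu> + f s) * x) = \<mu> / s * x" for x using \<mu> fp by simp
        ultimately have A: "\<mu> / (\<mu> + f s) / s * ((\<mu> + f s) * exp (- (\<mu> + f s) * r)) = \<mu> / s * (exp (- \<mu> * r) * exp (- r * f s))"
          by (simp only:)
        show ?thesis unfolding A using s by (simp add: field_simps)
      qed
      moreover have "0 \<le> \<mu> * exp (- \<mu> * r) * ((1 - exp (- r * f s)) / s)" if "0 < r"
        using that \<mu> s fp by (intro mult_nonneg_nonneg divide_nonneg_nonneg) auto
      ultimately show "(if 0 < r then ennreal (\<mu> * exp (- \<mu> * r) * ((1 - exp (- r * f s)) / s)) else 0)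
        + ennreal (\<mu> / (\<mu> + f s) / s) * (if 0 < r then ennreal ((\<mu> + f s) * exp (- (\<mu> + f s) * r)) else 0)
        = ennreal (1 / s) * (if 0 < r then ennreal (\<mu> * exp (- \<mu> * r)) else 0)"
        using \<mu> fp s by (auto simp: ennreal_mult[symmetric] ennreal_plus[symmetric] simp del: ennreal_plus)
    qed
    also have "\<dots> = ennreal (1 / s)"
      by (subst nn_integral_cmult) (auto simp: nn_integral_exponential_tail[OF \<mu>])
    also have "\<dots> = ennreal (f s / s / (\<mu> + f s)) + ennreal (\<mu> / (\<mu> + f s) / s)"
    proof -
      have "1 / s = f s / s / (\<mu> + f s) + \<mu> / (\<mu> + f s) / s"
        using \<mu> fp s by (simp add: divide_simps)
      then show ?thesis using \<mu> fp s by (simp add: ennreal_plus[symmetric] del: ennreal_plus)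
    qed
    finally show ?thesis using \<mu> fp s by (simp add: ennreal_add_left_cancel add.commute)
  qed
  finally show ?thesis .
qed

end

section \<open>Independent time changes and compound sums\<close>

lemma process_events_sigma_algebra: "sigma_algebra (space M) (process_events M I Z)"
  unfolding process_events_def by (rule sigma_algebra_sigma_sets) auto

lemma process_events_subset: "process_events M I Z \<subseteq> Pow (space M)"
proof
  fix A assume "A \<in> process_events M I Z"
  then have "A \<subseteq> space M" unfolding process_events_def by (rule sigma_sets_into_sp[rotated]) blast
  then show "A \<in> Pow (space M)" by blast
qed

lemma sets_sigma_of_sigma_algebra: "sigma_algebra \<Omega> F \<Longrightarrow> sets (sigma \<Omega> F) = F"
  by (rule sigma_algebra.sets_measure_of_eq)

lemma Int_stable_sigma_algebra: "sigma_algebra \<Omega> F \<Longrightarrow> Int_stable F"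
  using sets.Int[of _ "sigma \<Omega> F"] by (auto simp: sets_sigma_of_sigma_algebra intro!: Int_stableI)

lemma process_measurable:
  assumes "i \<in> I" "process_events M I Z \<subseteq> F" "sigma_algebra (space M) F"
  shows "Z i \<in> borel_measurable (sigma (space M) F)"
proof (rule measurableI)
  fix A :: "real set" assume A: "A \<in> sets borel"
  have "Z i -` A \<inter> space M \<in> process_events M I Z"
    unfolding process_events_def using assms(1) A by (intro sigma_sets.Basic) auto
  then show "Z i -` A \<inter> space (sigma (space M) F) \<in> sets (sigma (space M) F)"
    using assms(2) by (auto simp: sets_sigma_of_sigma_algebra[OF assms(3)] space_measure_of_conv)
qed simp

context prob_space
begin

lemma indep_set_mono:
  "indep_set A B \<Longrightarrow> A' \<subseteq> A \<Longrightarrow> B' \<subseteq> B \<Longrightarrow> indep_set A' B'"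
  unfolding indep_sets2_eq by blast

lemma indep_var_of_indep_set:
  assumes ind: "indep_set F G" and F: "sigma_algebra (space M) F" and G: "sigma_algebra (space M) G"
    and U: "U \<in> borel_measurable (sigma (space M) F)" and V: "V \<in> borel_measurable (sigma (space M) G)"
  shows "indep_var borel (U :: 'a \<Rightarrow> real) borel (V :: 'a \<Rightarrow> real)"
proof -
  have sub: "sigma_sets (space M) {W -` A \<inter> space M |A. A \<in> sets borel} \<subseteq> H \<and> random_variable borel W"
    if H: "sigma_algebra (space M) H" "H \<subseteq> events" and W: "W \<in> borel_measurable (sigma (space M) H)" for H and W :: "'a \<Rightarrow> real"
  proof -
    have 1: "W -` A \<inter> space M \<in> H" if "A \<in> sets borel" for A
      using measurable_sets[OF W that] by (simp add: sets_sigma_of_sigma_algebra[OF H(1)] space_measure_of_conv)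
    then have "sigma_sets (space M) {W -` A \<inter> space M |A. A \<in> sets borel} \<subseteq> H"
      by (intro sigma_algebra.sigma_sets_subset[OF H(1)]) auto
    moreover have "random_variable borel W"
      using 1 H(2) by (intro measurableI) auto
    ultimately show ?thesis by blast
  qed
  have ev: "F \<subseteq> events" "G \<subseteq> events" using ind by (auto simp: indep_sets2_eq)
  show ?thesis unfolding indep_var_eq
    using sub[OF F ev(1) U] sub[OF G ev(2) V] indep_set_mono[OF ind] by blast
qed

text \<open>Conditioning on \<open>T\<close> in elementary form. For the dyadic approximation of
  \<open>T\<close> from above, independence is used on each of countably many events;
  right-continuity and bounded convergence then remove the approximation.\<close>

lemma expectation_at_random_time:
  fixes Z :: "real \<Rightarrow> 'a \<Rightarrow> real" and h \<psi> :: "real \<Rightarrow> real"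
  assumes Z [measurable]: "\<And>r. Z r \<in> borel_measurable M"
    and rc: "\<And>\<omega> r. \<omega> \<in> space M \<Longrightarrow> continuous (at_right r) (\<lambda>t. Z t \<omega>)"
    and T [measurable]: "T \<in> borel_measurable M" and Tn: "AE \<omega> in M. 0 \<le> T \<omega>"
    and ind: "\<And>r. 0 \<le> r \<Longrightarrow> indep_var borel (Z r) borel T"
    and h: "continuous_on UNIV h" "\<And>\<omega> r. \<omega> \<in> space M \<Longrightarrow> 0 \<le> h (Z r \<omega>)" "\<And>\<omega> r. \<omega> \<in> space M \<Longrightarrow> h (Z r \<omega>) \<le> 1"
    and \<psi>: "continuous_on UNIV \<psi>" "\<And>r. 0 \<le> r \<Longrightarrow> expectation (\<lambda>\<omega>. h (Z r \<omega>)) = \<psi> r"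
  shows "expectation (\<lambda>\<omega>. h (Z (T \<omega>) \<omega>)) = expectation (\<lambda>\<omega>. \<psi> (T \<omega>))"
proof -
  have hm [measurable]: "h \<in> borel_measurable borel" using h(1) by (rule borel_measurable_continuous_onI)
  have \<psi>m [measurable]: "\<psi> \<in> borel_measurable borel" using \<psi>(1) by (rule borel_measurable_continuous_onI)
  have Zm [measurable]: "(\<lambda>p. Z (fst p) (snd p)) \<in> borel_measurable (borel \<Otimes>\<^sub>M M)"
    by (rule right_continuous_joint_measurable[OF Z rc])
  have ZT: "(\<lambda>\<omega>. Z (r \<omega>) \<omega>) \<in> borel_measurable M" if "r \<in> borel_measurable M" for r
    using measurable_compose[OF _ Zm, of "\<lambda>\<omega>. (r \<omega>, \<omega>)" M] that by simp
  have dym: "dyadic_above m \<in> borel_measurable borel" for m unfolding dyadic_above_def by measurable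
  note ZT[measurable] dym[measurable]
  have hint: "integrable M (\<lambda>\<omega>. h (Z r \<omega>))" for r
    by (rule integrable_const_bound[of _ 1]) (auto simp: h)
  have \<psi>b: "0 \<le> \<psi> r \<and> \<psi> r \<le> 1" if "0 \<le> r" for r
  proof -
    have "expectation (\<lambda>\<omega>. h (Z r \<omega>)) \<le> expectation (\<lambda>\<omega>. 1)" by (intro integral_mono_AE hint) (auto simp: h)
    moreover have "0 \<le> expectation (\<lambda>\<omega>. h (Z r \<omega>))" by (intro integral_nonneg_AE) (auto simp: h)
    ultimately show ?thesis using \<psi>(2)[OF that] by (simp add: prob_space)
  qed
  \<comment> \<open>\<open>q m k\<close> is the value of \<open>dyadic_above m (T \<omega>)\<close>
    on the event \<open>B m k\<close>; natural \<open>k\<close> cover almost every outcome because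
    \<open>T\<close> is non-negative.\<close>
  define q where "q m k = (real_of_int (int k) + 1) / 2 ^ m" for m k :: nat
  have q0: "0 \<le> q m k" for m k by (simp add: q_def)
  define B where "B m k = {\<omega> \<in> space M. \<lfloor>2 ^ m * T \<omega>\<rfloor> = int k}" for m k :: nat
  have Bm [measurable]: "B m k \<in> events" for m k unfolding B_def by measurable
  have single: "(\<Sum>k. ennreal (u k) * indicator (B m k) \<omega>) = ennreal (u k0)"
    if "\<omega> \<in> space M" "\<lfloor>2 ^ m * T \<omega>\<rfloor> = int k0" for u :: "nat \<Rightarrow> real" and m k0 \<omega>
  proof -
    have "(\<Sum>k. ennreal (u k) * indicator (B m k) \<omega>) = (\<Sum>k\<in>{k0}. ennreal (u k) * indicator (B m k) \<omega>)"
      using that by (intro suminf_finite) (auto simp: B_def indicator_def)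
    then show ?thesis using that by (simp add: B_def)
  qed
  have k0: "\<exists>k. \<lfloor>2 ^ m * T \<omega>\<rfloor> = int k \<and> dyadic_above m (T \<omega>) = q m k" if "0 \<le> T \<omega>" for m \<omega>
    using that by (intro exI[of _ "nat \<lfloor>2 ^ m * T \<omega>\<rfloor>"]) (auto simp: dyadic_above_def q_def)
  have prod: "(\<integral>\<^sup>+\<omega>. ennreal (h (Z r \<omega>)) * indicator (B m k) \<omega> \<partial>M) = ennreal (\<psi> r) * emeasure M (B m k)"
    if r: "0 \<le> r" for r m k
  proof -
    define I where "I x = (if \<lfloor>2 ^ m * x\<rfloor> = int k then 1 else 0 :: real)" for x :: real
    have Im: "I \<in> borel_measurable borel" unfolding I_def by measurable
    have "indep_var borel (h \<circ> Z r) borel (I \<circ> T)"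
      by (rule indep_var_compose[OF ind[OF r] hm Im])
    then have iv: "indep_var borel (\<lambda>\<omega>. h (Z r \<omega>)) borel (\<lambda>\<omega>. I (T \<omega>))" by (simp add: comp_def)
    have Iint: "integrable M (\<lambda>\<omega>. I (T \<omega>))"
      using Im by (intro integrable_const_bound[of _ 1]) (auto simp: I_def)
    have IB: "I (T \<omega>) = indicator (B m k) \<omega>" if "\<omega> \<in> space M" for \<omega> using that by (simp add: I_def B_def indicator_def)
    have "(\<integral>\<^sup>+\<omega>. ennreal (h (Z r \<omega>)) * indicator (B m k) \<omega> \<partial>M) = (\<integral>\<^sup>+\<omega>. ennreal (h (Z r \<omega>) * I (T \<omega>)) \<partial>M)"
      by (intro nn_integral_cong) (auto simp: IB indicator_def)
    also have "\<dots> = ennreal (expectation (\<lambda>\<omega>. h (Z r \<omega>) * I (T \<omega>)))"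
      by (intro nn_integral_eq_integral indep_var_integrable[OF iv hint Iint]) (auto simp: I_def h)
    also have "expectation (\<lambda>\<omega>. h (Z r \<omega>) * I (T \<omega>)) = \<psi> r * prob (B m k)"
    proof -
      have "expectation (\<lambda>\<omega>. I (T \<omega>)) = expectation (indicator (B m k))"
        by (intro Bochner_Integration.integral_cong) (auto simp: IB)
      then show ?thesis unfolding indep_var_lebesgue_integral[OF iv hint Iint] by (simp add: \<psi>(2)[OF r])
    qed
    finally show ?thesis using \<psi>b[OF r] by (simp add: ennreal_mult emeasure_eq_measure)
  qed
  have step: "expectation (\<lambda>\<omega>. h (Z (dyadic_above m (T \<omega>)) \<omega>)) = expectation (\<lambda>\<omega>. \<psi> (dyadic_above m (T \<omega>)))" for m
  proof -
    have "(\<integral>\<^sup>+\<omega>. ennreal (h (Z (dyadic_above m (T \<omega>)) \<omega>)) \<partial>M)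
      = (\<integral>\<^sup>+\<omega>. (\<Sum>k. ennreal (h (Z (q m k) \<omega>)) * indicator (B m k) \<omega>) \<partial>M)"
    proof (rule nn_integral_cong_AE)
      show "AE \<omega> in M. ennreal (h (Z (dyadic_above m (T \<omega>)) \<omega>)) = (\<Sum>k. ennreal (h (Z (q m k) \<omega>)) * indicator (B m k) \<omega>)"
        using Tn AE_space
      proof eventually_elim
        case (elim \<omega>)
        then obtain k where "\<lfloor>2 ^ m * T \<omega>\<rfloor> = int k" "dyadic_above m (T \<omega>) = q m k" using k0 by blast
        then show ?case using single[of \<omega> m k "\<lambda>k. h (Z (q m k) \<omega>)"] elim by simp
      qed
    qed
    also have "\<dots> = (\<Sum>k. ennreal (\<psi> (q m k)) * emeasure M (B m k))"
      by (subst nn_integral_suminf) (auto simp: prod q0)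
    also have "\<dots> = (\<integral>\<^sup>+\<omega>. (\<Sum>k. ennreal (\<psi> (q m k)) * indicator (B m k) \<omega>) \<partial>M)"
      by (subst nn_integral_suminf) (auto simp: nn_integral_cmult_indicator)
    also have "\<dots> = (\<integral>\<^sup>+\<omega>. ennreal (\<psi> (dyadic_above m (T \<omega>))) \<partial>M)"
    proof (rule nn_integral_cong_AE)
      show "AE \<omega> in M. (\<Sum>k. ennreal (\<psi> (q m k)) * indicator (B m k) \<omega>) = ennreal (\<psi> (dyadic_above m (T \<omega>)))"
        using Tn AE_space
      proof eventually_elim
        case (elim \<omega>)
        then obtain k where "\<lfloor>2 ^ m * T \<omega>\<rfloor> = int k" "dyadic_above m (T \<omega>) = q m k" using k0 by blast
        then show ?case using single[of \<omega> m k "\<lambda>k. \<psi> (q m k)"] elim by simp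
      qed
    qed
    finally have "(\<integral>\<^sup>+\<omega>. ennreal (h (Z (dyadic_above m (T \<omega>)) \<omega>)) \<partial>M) = (\<integral>\<^sup>+\<omega>. ennreal (\<psi> (dyadic_above m (T \<omega>))) \<partial>M)" .
    moreover have "expectation (\<lambda>\<omega>. h (Z (dyadic_above m (T \<omega>)) \<omega>)) = enn2real (\<integral>\<^sup>+\<omega>. ennreal (h (Z (dyadic_above m (T \<omega>)) \<omega>)) \<partial>M)"
      by (rule integral_eq_nn_integral) (auto simp: h)
    moreover have "expectation (\<lambda>\<omega>. \<psi> (dyadic_above m (T \<omega>))) = enn2real (\<integral>\<^sup>+\<omega>. ennreal (\<psi> (dyadic_above m (T \<omega>))) \<partial>M)"
    proof (rule integral_eq_nn_integral)
      show "AE \<omega> in M. 0 \<le> \<psi> (dyadic_above m (T \<omega>))"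
        using Tn by eventually_elim (use dyadic_above_bounds(1) \<psi>b in \<open>meson less_imp_le order_trans\<close>)
    qed measurable
    ultimately show ?thesis by simp
  qed
  have "(\<lambda>m. expectation (\<lambda>\<omega>. h (Z (dyadic_above m (T \<omega>)) \<omega>))) \<longlonglongrightarrow> expectation (\<lambda>\<omega>. h (Z (T \<omega>) \<omega>))"
  proof (rule integral_dominated_convergence[where w="\<lambda>_. 1"])
    show "AE \<omega> in M. (\<lambda>m. h (Z (dyadic_above m (T \<omega>)) \<omega>)) \<longlonglongrightarrow> h (Z (T \<omega>) \<omega>)"
      using AE_space
    proof eventually_elim
      case (elim \<omega>)
      have "(\<lambda>m. Z (dyadic_above m (T \<omega>)) \<omega>) \<longlonglongrightarrow> Z (T \<omega>) \<omega>"
        using rc[OF elim, of "T \<omega>"] unfolding continuous_within by (rule filterlim_compose[OF _ dyadic_above_tendsto])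
      moreover have "isCont h (Z (T \<omega>) \<omega>)" using h(1) by (simp add: continuous_on_eq_continuous_at)
      ultimately show ?case by (rule isCont_tendsto_compose[rotated])
    qed
  qed (auto simp: h)
  moreover have "(\<lambda>m. expectation (\<lambda>\<omega>. \<psi> (dyadic_above m (T \<omega>)))) \<longlonglongrightarrow> expectation (\<lambda>\<omega>. \<psi> (T \<omega>))"
  proof (rule integral_dominated_convergence[where w="\<lambda>_. 1"])
    show "AE \<omega> in M. (\<lambda>m. \<psi> (dyadic_above m (T \<omega>))) \<longlonglongrightarrow> \<psi> (T \<omega>)"
    proof (rule AE_I2)
      fix \<omega>
      have "isCont \<psi> (T \<omega>)" using \<psi>(1) by (simp add: continuous_on_eq_continuous_at)
      moreover have "(\<lambda>m. dyadic_above m (T \<omega>)) \<longlonglongrightarrow> T \<omega>"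
        using dyadic_above_tendsto[of "T \<omega>"] by (simp add: filterlim_at)
      ultimately show "(\<lambda>m. \<psi> (dyadic_above m (T \<omega>))) \<longlonglongrightarrow> \<psi> (T \<omega>)" by (rule isCont_tendsto_compose)
    qed
    show "AE \<omega> in M. norm (\<psi> (dyadic_above m (T \<omega>))) \<le> 1" for m
      using Tn
    proof eventually_elim
      case (elim \<omega>)
      then show ?case using \<psi>b[of "dyadic_above m (T \<omega>)"] dyadic_above_bounds(1)[of "T \<omega>" m] by simp
    qed
  qed auto
  ultimately show ?thesis unfolding step by (rule LIMSEQ_unique)
qed

text \<open>The sum is split along the events K = n, which lie in \<open>F\<close> and so are
  independent of the jumps. \<open>F\<close> is left abstract: for the time-changed count it is
  generated by two processes together.\<close>

lemma compound_sum_laplace: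
  assumes iid: "iid_jumps M X" and ind: "indep_set F (process_events M {1..} X)"
    and F: "sigma_algebra (space M) F" and K: "\<And>n. {\<omega> \<in> space M. K \<omega> = n} \<in> F"
    and Xn: "\<And>i. 1 \<le> i \<Longrightarrow> AE \<omega> in M. 0 \<le> X i \<omega>" and \<gamma>: "0 < \<gamma>"
    and \<phi>: "expectation (\<lambda>\<omega>. exp (- \<gamma> * X 1 \<omega>)) = \<phi>"
  shows "K \<in> measurable M (count_space UNIV)" "(\<lambda>\<omega>. \<Sum>i = 1..K \<omega>. X i \<omega>) \<in> borel_measurable M"
    "expectation (\<lambda>\<omega>. exp (- \<gamma> * (\<Sum>i = 1..K \<omega>. X i \<omega>))) = expectation (\<lambda>\<omega>. \<phi> ^ K \<omega>)"
proof -
  let ?G = "process_events M {1..} X"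
  have iv: "indep_vars (\<lambda>_. borel) X {1..}" and eqd: "\<And>i. 1 \<le> i \<Longrightarrow> distr M borel (X i) = distr M borel (X 1)"
    using iid unfolding iid_jumps_def by blast+
  have Xm: "X i \<in> borel_measurable M" if "1 \<le> i" for i using iv that by (auto simp: indep_vars_def)
  have evF: "F \<subseteq> events" using ind by (auto simp: indep_sets2_eq)
  show Km [measurable]: "K \<in> measurable M (count_space UNIV)"
    using K evF by (subst measurable_count_space_eq2_countable) (auto simp: vimage_def Int_def conj_commute)
  show Sm [measurable]: "(\<lambda>\<omega>. \<Sum>i = 1..K \<omega>. X i \<omega>) \<in> borel_measurable M"
    by (rule measurable_compose_countable[OF _ Km]) (auto intro!: borel_measurable_sum Xm)
  have ex: "expectation (\<lambda>\<omega>. exp (- \<gamma> * X i \<omega>)) = \<phi>" if i: "1 \<le> i" for i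
  proof -
    have "expectation (\<lambda>\<omega>. exp (- \<gamma> * X i \<omega>)) = (LINT x|distr M borel (X i). exp (- \<gamma> * x))"
      by (subst integral_distr) (auto intro: Xm i)
    also have "\<dots> = (LINT x|distr M borel (X 1). exp (- \<gamma> * x))" by (simp only: eqd[OF i])
    also have "\<dots> = \<phi>" unfolding \<phi>[symmetric] by (subst integral_distr) (auto intro: Xm)
    finally show ?thesis .
  qed
  have xi: "integrable M (\<lambda>\<omega>. exp (- \<gamma> * X i \<omega>))" if i: "1 \<le> i" for i
    using Xn[OF i] \<gamma> Xm[OF i] by (intro integrable_const_bound[of _ 1]) (auto elim!: eventually_mono)
  have \<phi>0: "0 \<le> \<phi>" unfolding \<phi>[symmetric] by (rule integral_nonneg_AE) auto
  define V where "V n \<omega> = (\<Prod>i\<in>{1..n}. exp (- \<gamma> * X i \<omega>))" for n \<omega>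
  have V: "expectation (V n) = \<phi> ^ n \<and> integrable M (V n)" for n
  proof -
    have "indep_vars (\<lambda>_. borel) (\<lambda>i \<omega>. exp (- \<gamma> * X i \<omega>)) {1..n}"
      by (rule indep_vars_compose2[OF indep_vars_subset[OF iv]]) auto
    from indep_vars_lebesgue_integral[OF _ this] indep_vars_integrable[OF _ this]
    have "expectation (V n) = (\<Prod>i\<in>{1..n}. expectation (\<lambda>\<omega>. exp (- \<gamma> * X i \<omega>)))" "integrable M (V n)"
      using xi unfolding V_def[abs_def] by auto
    moreover have "(\<Prod>i\<in>{1..n}. expectation (\<lambda>\<omega>. exp (- \<gamma> * X i \<omega>))) = (\<Prod>i\<in>{1..n}. \<phi>)"
      by (intro prod.cong refl ex) simp
    ultimately show ?thesis by simp
  qed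
  have VS: "exp (- \<gamma> * (\<Sum>i = 1..n. X i \<omega>)) = V n \<omega>" for n \<omega>
    by (simp add: V_def exp_sum[symmetric] sum_distrib_left)
  have Vm: "V n \<in> borel_measurable M" for n using V by auto
  define I where "I n = (indicator {\<omega> \<in> space M. K \<omega> = n} :: 'a \<Rightarrow> real)" for n
  have single: "(\<Sum>n. ennreal (u n) * ennreal (I n \<omega>)) = ennreal (u (K \<omega>))" if "\<omega> \<in> space M" for u :: "nat \<Rightarrow> real" and \<omega>
  proof -
    have "(\<Sum>n. ennreal (u n) * ennreal (I n \<omega>)) = (\<Sum>n\<in>{K \<omega>}. ennreal (u n) * ennreal (I n \<omega>))"
      by (intro suminf_finite) (auto simp: I_def indicator_def)
    then show ?thesis using that by (simp add: I_def)
  qed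
  have Ii: "integrable M (I n)" for n unfolding I_def by (intro integrable_real_indicator) (use K evF in \<open>auto simp: emeasure_eq_measure\<close>)
  have prod: "(\<integral>\<^sup>+\<omega>. ennreal (V n \<omega>) * ennreal (I n \<omega>) \<partial>M) = (\<integral>\<^sup>+\<omega>. ennreal (\<phi> ^ n) * ennreal (I n \<omega>) \<partial>M)" for n
  proof -
    have "I n \<in> borel_measurable (sigma (space M) F)"
      unfolding I_def by (intro borel_measurable_indicator) (simp add: sets_sigma_of_sigma_algebra[OF F] K)
    moreover have "V n \<in> borel_measurable (sigma (space M) ?G)"
      unfolding V_def[abs_def]
    proof (rule borel_measurable_prod)
      fix i assume i: "i \<in> {1..n}"
      have "X i \<in> borel_measurable (sigma (space M) ?G)"
        by (rule process_measurable[OF _ subset_refl process_events_sigma_algebra]) (use i in simp)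
      then show "(\<lambda>\<omega>. exp (- \<gamma> * X i \<omega>)) \<in> borel_measurable (sigma (space M) ?G)" by measurable
    qed
    ultimately have iv: "indep_var borel (I n) borel (V n)"
      by (intro indep_var_of_indep_set[OF ind F process_events_sigma_algebra])
    have "(\<integral>\<^sup>+\<omega>. ennreal (V n \<omega>) * ennreal (I n \<omega>) \<partial>M) = (\<integral>\<^sup>+\<omega>. ennreal (I n \<omega> * V n \<omega>) \<partial>M)"
      by (intro nn_integral_cong) (simp add: ennreal_mult'' I_def mult.commute)
    also have "\<dots> = ennreal (expectation (\<lambda>\<omega>. I n \<omega> * V n \<omega>))"
      using V by (intro nn_integral_eq_integral indep_var_integrable[OF iv Ii]) (auto simp: I_def V_def prod_nonneg)
    also have "\<dots> = ennreal (\<phi> ^ n) * ennreal (expectation (I n))"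
      using V \<phi>0 by (subst indep_var_lebesgue_integral[OF iv Ii]) (auto simp: ennreal_mult' mult.commute)
    also have "\<dots> = ennreal (\<phi> ^ n) * (\<integral>\<^sup>+\<omega>. ennreal (I n \<omega>) \<partial>M)"
      by (subst nn_integral_eq_integral[OF Ii]) (auto simp: I_def)
    also have "\<dots> = (\<integral>\<^sup>+\<omega>. ennreal (\<phi> ^ n) * ennreal (I n \<omega>) \<partial>M)"
      using Ii by (intro nn_integral_cmult[symmetric]) auto
    finally show ?thesis .
  qed
  have Im: "I n \<in> borel_measurable M" for n using Ii by auto
  have "(\<integral>\<^sup>+\<omega>. ennreal (exp (- \<gamma> * (\<Sum>i = 1..K \<omega>. X i \<omega>))) \<partial>M) = (\<integral>\<^sup>+\<omega>. (\<Sum>n. ennreal (V n \<omega>) * ennreal (I n \<omega>)) \<partial>M)"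
    by (intro nn_integral_cong) (simp only: VS single)
  also have "\<dots> = (\<Sum>n. \<integral>\<^sup>+\<omega>. ennreal (\<phi> ^ n) * ennreal (I n \<omega>) \<partial>M)"
    using Vm Im by (subst nn_integral_suminf) (auto simp: prod)
  also have "\<dots> = (\<integral>\<^sup>+\<omega>. (\<Sum>n. ennreal (\<phi> ^ n) * ennreal (I n \<omega>)) \<partial>M)"
    using Im by (intro nn_integral_suminf[symmetric]) auto
  also have "\<dots> = (\<integral>\<^sup>+\<omega>. ennreal (\<phi> ^ K \<omega>) \<partial>M)"
    by (intro nn_integral_cong) (simp only: single)
  finally have eq: "(\<integral>\<^sup>+\<omega>. ennreal (exp (- \<gamma> * (\<Sum>i = 1..K \<omega>. X i \<omega>))) \<partial>M) = (\<integral>\<^sup>+\<omega>. ennreal (\<phi> ^ K \<omega>) \<partial>M)" .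
  have "expectation (\<lambda>\<omega>. exp (- \<gamma> * (\<Sum>i = 1..K \<omega>. X i \<omega>))) = enn2real (\<integral>\<^sup>+\<omega>. ennreal (exp (- \<gamma> * (\<Sum>i = 1..K \<omega>. X i \<omega>))) \<partial>M)"
  proof (rule integral_eq_nn_integral)
    show "(\<lambda>\<omega>. exp (- \<gamma> * (\<Sum>i = 1..K \<omega>. X i \<omega>))) \<in> borel_measurable M" using Sm by measurable
  qed auto
  also have "\<dots> = expectation (\<lambda>\<omega>. \<phi> ^ K \<omega>)"
    unfolding eq using \<phi>0 by (intro integral_eq_nn_integral[symmetric]) auto
  finally show "expectation (\<lambda>\<omega>. exp (- \<gamma> * (\<Sum>i = 1..K \<omega>. X i \<omega>))) = expectation (\<lambda>\<omega>. \<phi> ^ K \<omega>)" .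
qed

lemma poisson_process_measurable:
  assumes "poisson_process M lam N"
  shows "N t \<in> measurable M (count_space UNIV)"
proof (cases "0 \<le> t")
  case False
  have "N t \<omega> = 0" if "\<omega> \<in> space M" for \<omega>
    using assms that False right_continuous_increasingD(1)[of "\<lambda>t. real (N t \<omega>)" t] by (auto simp: poisson_process_def)
  then show ?thesis by (subst measurable_cong[of _ _ "\<lambda>_. 0"]) auto
qed (use assms in \<open>auto simp: poisson_process_def\<close>)

text \<open>\<open>poisson_process\<close> prescribes laws over positive durations only, hence the
  separate case t = 0, where the count is 0. With z = 0 and 0 ^ 0 = 1 the formula is the probability
  of no event.\<close>

lemma poisson_process_pgf:
  assumes N: "poisson_process M lam N" and lam: "0 < lam" and t: "0 \<le> t" and z: "0 \<le> z" "z \<le> 1"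
  shows "expectation (\<lambda>\<omega>. z ^ N t \<omega>) = exp (- (lam * (1 - z)) * t)"
proof -
  have N0: "N 0 \<omega> = 0" if "\<omega> \<in> space M" for \<omega>
    using N that right_continuous_increasingD(1)[of "\<lambda>t. real (N t \<omega>)" 0] by (auto simp: poisson_process_def)
  show ?thesis
  proof (cases "t = 0")
    case True
    have "expectation (\<lambda>\<omega>. z ^ N t \<omega>) = expectation (\<lambda>\<omega>. 1)"
      using True N0 by (intro Bochner_Integration.integral_cong) auto
    then show ?thesis using True by (simp add: prob_space)
  next
    case False
    then have t: "0 < t" using t by simp
    define a where "a = lam * t"
    have a: "0 < a" using lam t by (simp add: a_def)
    note Nm = poisson_process_measurable[OF N]
    have "distr M (count_space UNIV) (\<lambda>\<omega>. N (0 + t) \<omega> - N 0 \<omega>) = measure_pmf (poisson_pmf a)"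
      using N t unfolding poisson_process_def a_def by blast
    moreover have "distr M (count_space UNIV) (\<lambda>\<omega>. N (0 + t) \<omega> - N 0 \<omega>) = distr M (count_space UNIV) (N t)"
      by (intro distr_cong) (auto simp: N0)
    ultimately have d: "distr M (count_space UNIV) (N t) = measure_pmf (poisson_pmf a)" by simp
    have "(\<integral>\<^sup>+\<omega>. ennreal (z ^ N t \<omega>) \<partial>M) = (\<integral>\<^sup>+n. ennreal (z ^ n) \<partial>distr M (count_space UNIV) (N t))"
      using Nm by (subst nn_integral_distr) auto
    also have "\<dots> = (\<Sum>n. ennreal (pmf (poisson_pmf a) n) * ennreal (z ^ n))"
      unfolding d nn_integral_measure_pmf nn_integral_count_space_nat by simp
    also have "\<dots> = (\<Sum>n. ennreal (exp (- a) * ((a * z) ^ n /\<^sub>R fact n)))"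
      using a z by (intro suminf_cong) (simp add: pmf_poisson ennreal_mult[symmetric] power_mult_distrib field_simps)
    also have "\<dots> = ennreal (exp (- a) * exp (a * z))"
      using a z by (intro suminf_ennreal_eq sums_mult exp_converges) (auto intro!: mult_nonneg_nonneg zero_le_power)
    also have "exp (- a) * exp (a * z) = exp (- (lam * (1 - z)) * t)"
      by (simp add: exp_add[symmetric] a_def algebra_simps)
    finally have "(\<integral>\<^sup>+\<omega>. ennreal (z ^ N t \<omega>) \<partial>M) = ennreal (exp (- (lam * (1 - z)) * t))" .
    then show ?thesis using Nm z by (subst integral_eq_nn_integral) auto
  qed
qed

end

context levy_subordinator
begin

text \<open>Joint independence of the three families is regrouped as \<open>N\<close> and
  \<open>E\<close> against \<open>X\<close>, so that the count N (E t) is decided by events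
  independent of the jumps. The generating function comes from conditioning the process
  \<open>N\<close> on the time \<open>E t\<close>.\<close>

lemma time_changed_poisson:
  assumes N: "poisson_process M lam N" and lam: "0 < lam" and ind: "jumps_independent M N E X" and t: "0 \<le> t"
  shows "\<exists>F. sigma_algebra (space M) F \<and> indep_set F (process_events M {1..} X) \<and> (\<forall>n. {\<omega> \<in> space M. N (E t \<omega>) \<omega> = n} \<in> F)"
    and "0 \<le> z \<Longrightarrow> z \<le> 1 \<Longrightarrow> expectation (\<lambda>\<omega>. z ^ N (E t \<omega>) \<omega>) = expectation (\<lambda>\<omega>. exp (- (lam * (1 - z)) * E t \<omega>))"
proof -
  let ?Z = "\<lambda>t \<omega>. real (N t \<omega>)"
  let ?PN = "process_events M {0..} ?Z" and ?PE = "process_events M {0..} E" and ?PX = "process_events M {1..} X"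
  let ?L = "\<lambda>k. [?PN, ?PE, ?PX] ! k"
  have rci: "\<And>\<omega>. \<omega> \<in> space M \<Longrightarrow> right_continuous_increasing (\<lambda>t. ?Z t \<omega>)" using N by (simp add: poisson_process_def)
  have L: "indep_sets ?L {0, 1, 2}" using ind unfolding jumps_independent_def .
  have PNE: "indep_set ?PN ?PE"
    unfolding indep_sets2_eq
  proof (intro conjI ballI)
    have "\<forall>i\<in>{0,1,2}. ?L i \<subseteq> events" using L unfolding indep_sets_def by (rule conjunct1)
    then show "?PN \<subseteq> events" "?PE \<subseteq> events" by auto
    fix a b assume "a \<in> ?PN" "b \<in> ?PE"
    then show "prob (a \<inter> b) = prob a * prob b"
      using indep_setsD[OF L, of "{0, 1}" "\<lambda>k. [a, b] ! k"] by auto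
  qed
  define F where "F = sigma_sets (space M) (?PN \<union> ?PE)"
  have F: "sigma_algebra (space M) F" unfolding F_def
    by (rule sigma_algebra_sigma_sets) (use process_events_subset in blast)
  have "indep_sets (\<lambda>j. sigma_sets (space M) (\<Union>i\<in>(case_bool {0, 1} {2} j). ?L i)) (UNIV :: bool set)"
  proof (rule indep_sets_collect_sigma)
    have "(\<Union>j. case_bool {0, 1} {2 :: nat} j) = {0, 1, 2}" by (auto simp: UNIV_bool)
    then show "indep_sets ?L (\<Union>j. case_bool {0, 1} {2} j)" using L by (simp only:)
    show "disjoint_family (case_bool {0, 1} {2 :: nat})"
      by (auto simp: disjoint_family_on_def split: bool.splits)
    fix i :: nat and j assume "i \<in> case_bool {0, 1} {2} j"
    then have "i = 0 \<or> i = 1 \<or> i = 2" by (auto split: bool.splits)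
    then show "Int_stable (?L i)"
      by (auto intro: Int_stable_sigma_algebra[OF process_events_sigma_algebra])
  qed
  then have indF: "indep_set F ?PX"
    unfolding indep_set_def
    by (rule indep_sets_mono_sets) (auto simp: F_def split: bool.splits intro: sigma_sets.Basic)
  let ?S = "sigma (space M) F"
  have sS: "space ?S = space M" by (simp add: space_measure_of_conv)
  have sub: "?PN \<subseteq> F" "?PE \<subseteq> F" by (auto simp: F_def)
  have ZS: "?Z r \<in> borel_measurable ?S" for r
  proof (cases "0 \<le> r")
    case True
    then show ?thesis by (intro process_measurable[OF _ sub(1) F]) auto
  next
    case False
    then show ?thesis using right_continuous_increasingD(1)[OF rci, of _ r] by (subst measurable_cong[of _ _ "\<lambda>_. 0"]) (auto simp: sS)
  qed
  have ES: "E t \<in> borel_measurable ?S" using t by (intro process_measurable[OF _ sub(2) F]) auto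
  \<comment> \<open>Measurability with respect to the generated algebra \<open>F\<close>, rather
    than all events, is what places the events N (E t) = n in \<open>F\<close>.\<close>
  have "(\<lambda>p. ?Z (fst p) (snd p)) \<in> borel_measurable (borel \<Otimes>\<^sub>M ?S)"
    by (rule right_continuous_joint_measurable[OF ZS]) (auto simp: sS intro: right_continuous_increasingD(3)[OF rci])
  from measurable_compose[OF _ this, of "\<lambda>\<omega>. (E t \<omega>, \<omega>)" ?S] ES
  have KS: "(\<lambda>\<omega>. ?Z (E t \<omega>) \<omega>) \<in> borel_measurable ?S" by simp
  have "{\<omega> \<in> space M. N (E t \<omega>) \<omega> = n} \<in> F" for n
  proof -
    have "(\<lambda>\<omega>. ?Z (E t \<omega>) \<omega>) -` {real n} \<inter> space ?S \<in> sets ?S" by (rule measurable_sets[OF KS]) simp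
    moreover have "(\<lambda>\<omega>. ?Z (E t \<omega>) \<omega>) -` {real n} \<inter> space ?S = {\<omega> \<in> space M. N (E t \<omega>) \<omega> = n}" by (auto simp: sS)
    ultimately show ?thesis by (simp add: sets_sigma_of_sigma_algebra[OF F])
  qed
  then show "\<exists>F. sigma_algebra (space M) F \<and> indep_set F (process_events M {1..} X) \<and> (\<forall>n. {\<omega> \<in> space M. N (E t \<omega>) \<omega> = n} \<in> F)"
    using F indF by blast
  assume z: "0 \<le> z" "z \<le> 1"
  \<comment> \<open>A continuous function that agrees with \<open>\<lambda>n. z ^ n\<close> on the naturals; the case \<open>z = 0\<close>, where \<open>0 ^ 0 = 1\<close>, gives the probability of no jump.\<close>
  define h where "h x = (if z = 0 then max 0 (1 - x) else exp (ln z * x))" for x :: real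
  have hz: "h (real n) = z ^ n" for n
  proof (cases "z = 0")
    case True
    then show ?thesis by (cases n) (auto simp: h_def)
  next
    case False
    then have "0 < z" using z by simp
    then show ?thesis by (simp add: h_def mult.commute exp_of_nat_mult)
  qed
  have "expectation (\<lambda>\<omega>. h (?Z (E t \<omega>) \<omega>)) = expectation (\<lambda>\<omega>. exp (- (lam * (1 - z)) * E t \<omega>))"
  proof (rule expectation_at_random_time[where Z = ?Z and T = "E t" and h = h and \<psi> = "\<lambda>x. exp (- (lam * (1 - z)) * x)"])
    show "?Z r \<in> borel_measurable M" for r
      using poisson_process_measurable[OF N, of r] by measurable
    show "continuous (at_right r) (\<lambda>t. ?Z t \<omega>)" if "\<omega> \<in> space M" for \<omega> r
      by (rule right_continuous_increasingD(3)[OF rci[OF that]])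
    show "indep_var borel (?Z r) borel (E t)" if "0 \<le> r" for r
      using that t
      by (intro indep_var_of_indep_set[OF PNE process_events_sigma_algebra process_events_sigma_algebra]
          process_measurable[OF _ subset_refl process_events_sigma_algebra]) auto
    show "continuous_on UNIV h" unfolding h_def by (cases "z = 0") (auto intro!: continuous_intros)
    show "0 \<le> h (?Z r \<omega>)" "h (?Z r \<omega>) \<le> 1" for r \<omega> using z by (auto simp: hz power_le_one)
    show "continuous_on UNIV (\<lambda>x. exp (- (lam * (1 - z)) * x))" by (intro continuous_intros)
    show "expectation (\<lambda>\<omega>. h (?Z r \<omega>)) = exp (- (lam * (1 - z)) * r)" if "0 \<le> r" for r
      unfolding hz by (rule poisson_process_pgf[OF N lam that z])
  qed (auto intro: E_nonneg)
  then show "expectation (\<lambda>\<omega>. z ^ N (E t \<omega>) \<omega>) = expectation (\<lambda>\<omega>. exp (- (lam * (1 - z)) * E t \<omega>))"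
    unfolding hz .
qed

text \<open>The generating function of the count is used twice: at z = \<phi> for the transform of
  the sum, and at z = 0 for the probability of no jumps.\<close>

lemma compound_process_law:
  assumes N: "poisson_process M lam N" and lam: "0 < lam" and ind: "jumps_independent M N E X" and iid: "iid_jumps M X"
    and Xn: "\<And>i. 1 \<le> i \<Longrightarrow> AE \<omega> in M. 0 \<le> X i \<omega>" and \<gamma>: "0 < \<gamma>" and t: "0 \<le> t"
    and \<phi>: "expectation (\<lambda>\<omega>. exp (- \<gamma> * X 1 \<omega>)) = \<phi>"
  shows "compound_process N E X t \<in> borel_measurable M"
    and "AE \<omega> in M. 0 \<le> compound_process N E X t \<omega>"
    and "expectation (\<lambda>\<omega>. exp (- \<gamma> * compound_process N E X t \<omega>)) = expectation (\<lambda>\<omega>. exp (- (lam * (1 - \<phi>)) * E t \<omega>))"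
    and "(\<lambda>\<omega>. N (E t \<omega>) \<omega>) \<in> measurable M (count_space UNIV)"
    and "prob {\<omega> \<in> space M. N (E t \<omega>) \<omega> = 0} = expectation (\<lambda>\<omega>. exp (- lam * E t \<omega>))"
proof -
  obtain F where F: "sigma_algebra (space M) F" "indep_set F (process_events M {1..} X)" "\<And>n. {\<omega> \<in> space M. N (E t \<omega>) \<omega> = n} \<in> F"
    using time_changed_poisson(1)[OF N lam ind t] by blast
  note C = compound_sum_laplace[OF iid F(2,1,3) Xn \<gamma> \<phi>]
  show "compound_process N E X t \<in> borel_measurable M" using C(2) by (simp add: compound_process_def[abs_def])
  show Km [measurable]: "(\<lambda>\<omega>. N (E t \<omega>) \<omega>) \<in> measurable M (count_space UNIV)" by (rule C(1))
  have "\<And>i. AE \<omega> in M. 1 \<le> i \<longrightarrow> 0 \<le> X i \<omega>" using Xn by auto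
  then have "AE \<omega> in M. \<forall>i. 1 \<le> i \<longrightarrow> 0 \<le> X i \<omega>" unfolding AE_all_countable by blast
  then show "AE \<omega> in M. 0 \<le> compound_process N E X t \<omega>"
    by eventually_elim (auto simp: compound_process_def intro!: sum_nonneg)
  have "indep_vars (\<lambda>_. borel) X {1..}" using iid unfolding iid_jumps_def by blast
  then have Xm: "X 1 \<in> borel_measurable M" by (auto simp: indep_vars_def)
  have "expectation (\<lambda>\<omega>. exp (- \<gamma> * X 1 \<omega>)) \<le> expectation (\<lambda>\<omega>. 1)"
    using Xn[of 1] \<gamma> Xm by (intro integral_mono_AE integrable_const_bound[of _ 1]) (auto elim!: eventually_mono)
  then have p1: "\<phi> \<le> 1" using \<phi> by (simp add: prob_space)
  have p0: "0 \<le> \<phi>" unfolding \<phi>[symmetric] by (rule integral_nonneg_AE) auto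
  show "expectation (\<lambda>\<omega>. exp (- \<gamma> * compound_process N E X t \<omega>)) = expectation (\<lambda>\<omega>. exp (- (lam * (1 - \<phi>)) * E t \<omega>))"
    using C(3) time_changed_poisson(2)[OF N lam ind t p0 p1] unfolding compound_process_def by simp
  have "prob {\<omega> \<in> space M. N (E t \<omega>) \<omega> = 0} = expectation (indicator {\<omega> \<in> space M. N (E t \<omega>) \<omega> = 0})" by simp
  also have "\<dots> = expectation (\<lambda>\<omega>. 0 ^ N (E t \<omega>) \<omega>)"
    by (intro Bochner_Integration.integral_cong) (auto simp: indicator_def)
  also have "\<dots> = expectation (\<lambda>\<omega>. exp (- lam * E t \<omega>))"
    using time_changed_poisson(2)[OF N lam ind t, of 0] by simp
  finally show "prob {\<omega> \<in> space M. N (E t \<omega>) \<omega> = 0} = expectation (\<lambda>\<omega>. exp (- lam * E t \<omega>))" .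
qed

end

section \<open>The equation for the density\<close>

text \<open>The signed counterpart of \<open>nconv\<close>; the space derivative of \<open>P\<close>
  may change sign.\<close>

definition rconv :: "real \<Rightarrow> (real \<Rightarrow> real) \<Rightarrow> (real \<Rightarrow> real) \<Rightarrow> real \<Rightarrow> real" where
  "rconv b k u t = b * u t + (LINT s|lborel. (if 0 < s \<and> s < t then u (t - s) * k s else 0))"

lemma measurable_rconv [measurable]:
  assumes [measurable]: "k \<in> borel_measurable borel" "(\<lambda>(x, r). U x r) \<in> borel_measurable (M \<Otimes>\<^sub>M borel)"
    "t \<in> borel_measurable M"
  shows "(\<lambda>x. rconv b k (U x) (t x)) \<in> borel_measurable M"
  unfolding rconv_def by measurable

text \<open>Agreement is asked on (0, t] only, so that \<open>v\<close> may be a Caputo derivative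
  of unknown measurability elsewhere and \<open>u\<close> a Borel cut-off of it.\<close>

lemma caputo_conv_eq_rconv:
  assumes [measurable]: "u \<in> borel_measurable borel" "levy_tail \<nu> \<in> borel_measurable borel"
    and eq: "\<And>r. 0 < r \<Longrightarrow> r \<le> t \<Longrightarrow> v r = u r" and t: "0 < t"
  shows "caputo_conv b \<nu> v t = rconv b (levy_tail \<nu>) u t"
proof -
  have "(\<integral>s. indicator {0<..<t} s *\<^sub>R (v (t - s) * levy_tail \<nu> s) \<partial>lebesgue) = (\<integral>s. (if 0 < s \<and> s < t then u (t - s) * levy_tail \<nu> s else 0) \<partial>lebesgue)"
    using eq by (intro Bochner_Integration.integral_cong) (auto simp: indicator_def)
  also have "\<dots> = (\<integral>s. (if 0 < s \<and> s < t then u (t - s) * levy_tail \<nu> s else 0) \<partial>lborel)"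
    by (rule integral_completion) measurable
  finally show ?thesis
    using eq[of t] t by (simp add: caputo_conv_def rconv_def set_lebesgue_integral_def)
qed

lemma nconv_ennreal:
  fixes u k :: "real \<Rightarrow> real"
  assumes "u \<in> borel_measurable borel" "k \<in> borel_measurable borel"
    and u: "\<And>r. 0 < r \<Longrightarrow> r \<le> t \<Longrightarrow> 0 \<le> u r" and k: "\<And>r. 0 \<le> k r" and b: "0 \<le> b" and t: "0 < t"
    and int: "integrable lborel (\<lambda>s. if 0 < s \<and> s < t then u (t - s) * k s else 0)"
  shows "nconv b (\<lambda>s. ennreal (k s)) (\<lambda>r. ennreal (u r)) t = ennreal (rconv b k u t)" and "0 \<le> rconv b k u t"
proof -
  have nn: "0 \<le> (if 0 < s \<and> s < t then u (t - s) * k s else 0)" for s using u k by simp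
  have "(\<integral>\<^sup>+s. (if 0 < s \<and> s < t then ennreal (u (t - s)) * ennreal (k s) else 0) \<partial>lborel)
    = (\<integral>\<^sup>+s. ennreal (if 0 < s \<and> s < t then u (t - s) * k s else 0) \<partial>lborel)"
    using u k by (intro nn_integral_cong) (auto simp: ennreal_mult)
  also have "\<dots> = ennreal (LINT s|lborel. (if 0 < s \<and> s < t then u (t - s) * k s else 0))"
    by (rule nn_integral_eq_integral[OF int]) (use nn in auto)
  finally have 1: "(\<integral>\<^sup>+s. (if 0 < s \<and> s < t then ennreal (u (t - s)) * ennreal (k s) else 0) \<partial>lborel)
    = ennreal (LINT s|lborel. (if 0 < s \<and> s < t then u (t - s) * k s else 0))" .
  have 2: "0 \<le> (LINT s|lborel. (if 0 < s \<and> s < t then u (t - s) * k s else 0))"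
    by (rule integral_nonneg_AE) (use nn in auto)
  have 3: "0 \<le> u t" using u[of t] t by simp
  show "0 \<le> rconv b k u t" unfolding rconv_def using 2 3 b by simp
  show "nconv b (\<lambda>s. ennreal (k s)) (\<lambda>r. ennreal (u r)) t = ennreal (rconv b k u t)"
    unfolding nconv_def rconv_def 1 using 2 3 b by (simp add: ennreal_mult)
qed

lemma nconv_finite_integrable:
  fixes u k :: "real \<Rightarrow> real"
  assumes [measurable]: "u \<in> borel_measurable borel" "k \<in> borel_measurable borel"
    and u: "\<And>r. 0 < r \<Longrightarrow> r \<le> t \<Longrightarrow> 0 \<le> u r" and k: "\<And>r. 0 \<le> k r"
    and fin: "nconv b (\<lambda>s. ennreal (k s)) (\<lambda>r. ennreal (u r)) t < \<infinity>"
  shows "integrable lborel (\<lambda>s. if 0 < s \<and> s < t then u (t - s) * k s else 0)"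
proof (rule integrableI_bounded)
  have "(\<integral>\<^sup>+s. ennreal (norm (if 0 < s \<and> s < t then u (t - s) * k s else 0)) \<partial>lborel)
    = (\<integral>\<^sup>+s. (if 0 < s \<and> s < t then ennreal (u (t - s)) * ennreal (k s) else 0) \<partial>lborel)"
    using u k by (intro nn_integral_cong) (auto simp: ennreal_mult)
  also have "\<dots> \<le> nconv b (\<lambda>s. ennreal (k s)) (\<lambda>r. ennreal (u r)) t" unfolding nconv_def by simp
  finally show "(\<integral>\<^sup>+s. ennreal (norm (if 0 < s \<and> s < t then u (t - s) * k s else 0)) \<partial>lborel) < \<infinity>"
    using fin by (rule le_less_trans)
qed measurable

text \<open>Undoes one space integration: \<open>Q\<close> is the space density of a primitive with
  values \<open>Ua\<close> and \<open>Uc\<close> at the endpoints, and Fubini moves the integral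
  over [a, c] inside the convolution in time. The primitive is non-negative, so finite convolutions
  control it; \<open>Q\<close> has no sign and is controlled by the absolute bound
  \<open>I\<close>.\<close>

lemma rconv_difference:
  fixes Q :: "real \<Rightarrow> real \<Rightarrow> real" and Ua Uc k :: "real \<Rightarrow> real"
  assumes Qm [measurable]: "(\<lambda>(y, r). Q y r) \<in> borel_measurable (borel \<Otimes>\<^sub>M borel)"
    and [measurable]: "k \<in> borel_measurable borel" "Ua \<in> borel_measurable borel" "Uc \<in> borel_measurable borel"
    and k: "\<And>s. 0 \<le> k s" and b: "0 \<le> b" and t: "0 < t"
    and U: "\<And>r. 0 < r \<Longrightarrow> r \<le> t \<Longrightarrow> 0 \<le> Ua r" "\<And>r. 0 < r \<Longrightarrow> r \<le> t \<Longrightarrow> 0 \<le> Uc r"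
    and fa: "nconv b (\<lambda>s. ennreal (k s)) (\<lambda>r. ennreal (Ua r)) t < \<infinity>"
    and fc: "nconv b (\<lambda>s. ennreal (k s)) (\<lambda>r. ennreal (Uc r)) t < \<infinity>"
    and diff: "\<And>r. 0 < r \<Longrightarrow> r \<le> t \<Longrightarrow> set_integrable lborel {a..c} (\<lambda>y. Q y r)"
      "\<And>r. 0 < r \<Longrightarrow> r \<le> t \<Longrightarrow> (LINT y:{a..c}|lborel. Q y r) = Uc r - Ua r"
    and I: "(\<integral>\<^sup>+s. (if 0 < s \<and> s < t then (\<integral>\<^sup>+y. (if a \<le> y \<and> y \<le> c then ennreal \<bar>Q y (t - s)\<bar> else 0) \<partial>lborel) * ennreal (k s) else 0) \<partial>lborel) < \<infinity>"
  shows "set_integrable lborel {a..c} (\<lambda>y. rconv b k (Q y) t)"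
    and "(LINT y:{a..c}|lborel. rconv b k (Q y) t) =
      enn2real (nconv b (\<lambda>s. ennreal (k s)) (\<lambda>r. ennreal (Uc r)) t) - enn2real (nconv b (\<lambda>s. ennreal (k s)) (\<lambda>r. ennreal (Ua r)) t)"
proof -
  define \<Phi> where "\<Phi> y s = (if a \<le> y \<and> y \<le> c \<and> 0 < s \<and> s < t then Q y (t - s) * k s else 0)" for y s
  have \<Phi>m [measurable]: "(\<lambda>p. \<Phi> (fst p) (snd p)) \<in> borel_measurable (borel \<Otimes>\<^sub>M borel)"
    unfolding \<Phi>_def by measurable
  have \<Phi>i: "integrable (lborel \<Otimes>\<^sub>M lborel) (\<lambda>p. \<Phi> (fst p) (snd p))"
  proof (rule integrableI_bounded)
    have "(\<integral>\<^sup>+p. ennreal (norm (\<Phi> (fst p) (snd p))) \<partial>(lborel \<Otimes>\<^sub>M lborel)) = (\<integral>\<^sup>+s. \<integral>\<^sup>+y. ennreal (norm (\<Phi> y s)) \<partial>lborel \<partial>lborel)"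
      by (subst lborel_pair.nn_integral_snd[symmetric]) auto
    also have "\<dots> = (\<integral>\<^sup>+s. (if 0 < s \<and> s < t then (\<integral>\<^sup>+y. (if a \<le> y \<and> y \<le> c then ennreal \<bar>Q y (t - s)\<bar> else 0) \<partial>lborel) * ennreal (k s) else 0) \<partial>lborel)"
    proof (rule nn_integral_cong)
      fix s
      have "(\<integral>\<^sup>+y. ennreal (norm (\<Phi> y s)) \<partial>lborel)
        = (\<integral>\<^sup>+y. (if a \<le> y \<and> y \<le> c then ennreal \<bar>Q y (t - s)\<bar> else 0) * (if 0 < s \<and> s < t then ennreal (k s) else 0) \<partial>lborel)"
        using k by (intro nn_integral_cong) (auto simp: \<Phi>_def abs_mult ennreal_mult)
      also have "\<dots> = (\<integral>\<^sup>+y. (if a \<le> y \<and> y \<le> c then ennreal \<bar>Q y (t - s)\<bar> else 0) \<partial>lborel) * (if 0 < s \<and> s < t then ennreal (k s) else 0)"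
        by (rule nn_integral_multc) measurable
      finally show "(\<integral>\<^sup>+y. ennreal (norm (\<Phi> y s)) \<partial>lborel) =
        (if 0 < s \<and> s < t then (\<integral>\<^sup>+y. (if a \<le> y \<and> y \<le> c then ennreal \<bar>Q y (t - s)\<bar> else 0) \<partial>lborel) * ennreal (k s) else 0)" by simp
    qed
    finally show "(\<integral>\<^sup>+p. ennreal (norm (\<Phi> (fst p) (snd p))) \<partial>(lborel \<Otimes>\<^sub>M lborel)) < \<infinity>" using I by simp
  qed measurable
  have \<Phi>i': "integrable (lborel \<Otimes>\<^sub>M lborel) (\<lambda>(y, s). \<Phi> y s)" using \<Phi>i by (simp add: case_prod_unfold)
  have in1: "(\<integral>s. \<Phi> y s \<partial>lborel) = indicator {a..c} y *\<^sub>R (LINT s|lborel. (if 0 < s \<and> s < t then Q y (t - s) * k s else 0))" for y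
    by (cases "y \<in> {a..c}") (auto simp: \<Phi>_def)
  have in2: "(\<integral>y. \<Phi> y s \<partial>lborel) = (if 0 < s \<and> s < t then Uc (t - s) * k s else 0) - (if 0 < s \<and> s < t then Ua (t - s) * k s else 0)" for s
  proof (cases "0 < s \<and> s < t")
    case True
    have "(\<integral>y. \<Phi> y s \<partial>lborel) = (\<integral>y. (indicator {a..c} y *\<^sub>R Q y (t - s)) * k s \<partial>lborel)"
      using True by (intro Bochner_Integration.integral_cong) (auto simp: \<Phi>_def indicator_def)
    also have "\<dots> = (LINT y:{a..c}|lborel. Q y (t - s)) * k s" by (simp add: set_lebesgue_integral_def)
    finally show ?thesis using True diff(2)[of "t - s"] by (simp add: algebra_simps)
  next
    case False
    then have "\<Phi> y s = 0" for y by (auto simp: \<Phi>_def)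
    then show ?thesis using False by auto
  qed
  have ia: "integrable lborel (\<lambda>s. if 0 < s \<and> s < t then Ua (t - s) * k s else 0)" by (rule nconv_finite_integrable[OF _ _ U(1) k fa]) auto
  have ic: "integrable lborel (\<lambda>s. if 0 < s \<and> s < t then Uc (t - s) * k s else 0)" by (rule nconv_finite_integrable[OF _ _ U(2) k fc]) auto
  have i2: "set_integrable lborel {a..c} (\<lambda>y. LINT s|lborel. (if 0 < s \<and> s < t then Q y (t - s) * k s else 0))"
    using lborel_pair.integrable_fst[OF \<Phi>i'] by (simp add: in1 set_integrable_def)
  have i1: "set_integrable lborel {a..c} (\<lambda>y. b * Q y t)" using diff(1)[of t] t by simp
  show "set_integrable lborel {a..c} (\<lambda>y. rconv b k (Q y) t)"
    unfolding rconv_def by (rule set_integral_add(1)[OF i1 i2])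
  have "(LINT y:{a..c}|lborel. rconv b k (Q y) t) = b * (Uc t - Ua t) + (LINT y:{a..c}|lborel. LINT s|lborel. (if 0 < s \<and> s < t then Q y (t - s) * k s else 0))"
    unfolding rconv_def set_integral_add(2)[OF i1 i2] using diff(2)[of t] t by simp
  also have "(LINT y:{a..c}|lborel. LINT s|lborel. (if 0 < s \<and> s < t then Q y (t - s) * k s else 0)) = (\<integral>y. \<integral>s. \<Phi> y s \<partial>lborel \<partial>lborel)"
    by (simp add: in1 set_lebesgue_integral_def)
  also have "\<dots> = (\<integral>s. \<integral>y. \<Phi> y s \<partial>lborel \<partial>lborel)"
    by (rule lborel_pair.Fubini_integral[OF \<Phi>i', symmetric])
  also have "\<dots> = (LINT s|lborel. (if 0 < s \<and> s < t then Uc (t - s) * k s else 0)) - (LINT s|lborel. (if 0 < s \<and> s < t then Ua (t - s) * k s else 0))"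
    unfolding in2 by (rule Bochner_Integration.integral_diff[OF ic ia])
  finally have *: "(LINT y:{a..c}|lborel. rconv b k (Q y) t) = rconv b k Uc t - rconv b k Ua t"
    by (simp add: rconv_def algebra_simps)
  have "enn2real (nconv b (\<lambda>s. ennreal (k s)) (\<lambda>r. ennreal (Uc r)) t) = rconv b k Uc t"
    using nconv_ennreal[of Uc k t b] U(2) k b t ic by simp
  moreover have "enn2real (nconv b (\<lambda>s. ennreal (k s)) (\<lambda>r. ennreal (Ua r)) t) = rconv b k Ua t"
    using nconv_ennreal[of Ua k t b] U(1) k b t ia by simp
  ultimately show "(LINT y:{a..c}|lborel. rconv b k (Q y) t) =
      enn2real (nconv b (\<lambda>s. ennreal (k s)) (\<lambda>r. ennreal (Uc r)) t) - enn2real (nconv b (\<lambda>s. ennreal (k s)) (\<lambda>r. ennreal (Ua r)) t)"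
    using * by simp
qed

lemma nconv_one:
  assumes [measurable]: "u \<in> borel_measurable borel"
  shows "nconv 0 (\<lambda>_. 1) u x = (\<integral>\<^sup>+y. (if 0 < y \<and> y < x then u y else 0) \<partial>lborel)"
proof -
  have "(\<integral>\<^sup>+y. (if 0 < y \<and> y < x then u y else 0) \<partial>lborel) = (\<integral>\<^sup>+s. (if 0 < x - s \<and> x - s < x then u (x - s) else 0) \<partial>lborel)"
    by (subst nn_integral_real_affine[of _ "-1" x]) (auto intro!: nn_integral_cong)
  also have "\<dots> = (\<integral>\<^sup>+s. (if 0 < s \<and> s < x then u (x - s) * 1 else 0) \<partial>lborel)"
    by (intro nn_integral_cong) auto
  finally show ?thesis by (simp add: nconv_def)
qed

lemma set_integral_lebesgue_eq_lborel:
  fixes h :: "real \<Rightarrow> real"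
  assumes "h \<in> borel_measurable borel" "A \<in> sets borel"
  shows "set_integrable lebesgue A h \<longleftrightarrow> set_integrable lborel A h"
    and "(LINT s:A|lebesgue. h s) = (LINT s:A|lborel. h s)"
proof -
  have "(\<lambda>x. indicator A x *\<^sub>R h x) \<in> borel_measurable lborel" using assms by measurable
  then show "set_integrable lebesgue A h \<longleftrightarrow> set_integrable lborel A h"
    "(LINT s:A|lebesgue. h s) = (LINT s:A|lborel. h s)"
    unfolding set_integrable_def set_lebesgue_integral_def by (simp_all add: integrable_completion integral_completion)
qed

lemma set_integral_cong_on:
  fixes h :: "'b \<Rightarrow> real"
  assumes "\<And>x. x \<in> A \<Longrightarrow> h x = h' x"
  shows "set_integrable M A h \<longleftrightarrow> set_integrable M A h'" "(LINT s:A|M. h s) = (LINT s:A|M. h' s)"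
  unfolding set_integrable_def set_lebesgue_integral_def using assms
  by (auto intro!: Bochner_Integration.integrable_cong Bochner_Integration.integral_cong simp: indicator_def)

text \<open>\<open>p\<close> is the double transform of \<open>P\<close>. With D = l G + (e + G) F
  one has l G / (e + G) + F = D / (e + G) and (e + G)(l + F) - D = e l. Hence p D = F / s * e l / (l
  + F), while the left side is p D / (s \<theta>).\<close>

lemma resolvent_identity:
  fixes e l s \<theta> F G :: real
  assumes pos: "0 < e" "0 < l" "0 < s" "0 < \<theta>" "0 < F" "0 < G"
    and p: "p = F / s * (1 / (l * G / (e + G) + F) - 1 / (l + F))"
  shows "e * (F / s * (1 / \<theta> * p)) + F / s * (G / \<theta> * p) + l * (1 / s * (G / \<theta> * p))
    = l * e * (1 / s * (F / s / (l + F))) * (1 / \<theta>)"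
proof -
  define D where "D = l * G + (e + G) * F"
  have D: "0 < D" using pos by (simp add: D_def add_pos_pos)
  have "l * G / (e + G) + F = D / (e + G)" using pos by (simp add: D_def field_simps)
  then have "1 / (l * G / (e + G) + F) - 1 / (l + F) = ((e + G) * (l + F) - D) / (D * (l + F))"
    using pos D by (simp add: divide_simps)
  also have "(e + G) * (l + F) - D = e * l" by (simp add: D_def algebra_simps)
  finally have p': "p * D = F / s * (e * l / (l + F))" unfolding p using D by simp
  have "e * (F / s * (1 / \<theta> * p)) + F / s * (G / \<theta> * p) + l * (1 / s * (G / \<theta> * p)) = p * D / (s * \<theta>)"
    using pos by (simp add: D_def field_simps)
  also have "\<dots> = l * e * (1 / s * (F / s / (l + F))) * (1 / \<theta>)"
    unfolding p' by (simp add: divide_inverse mult_ac)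
  finally show ?thesis .
qed

text \<open>What the equation takes from probability: \<open>w\<close> stands for the probability of
  the atom at 0, and the transforms of \<open>w\<close> and of \<open>P\<close> are explicit. The
  rest is analysis of two functions.\<close>

locale subordinated_density =
  fixes bf bg :: real and \<nu>f \<nu>g :: "real measure" and f g :: "real \<Rightarrow> real" and lam eta :: real
    and P :: "real \<Rightarrow> real \<Rightarrow> real" and w :: "real \<Rightarrow> real"
  assumes bernf: "bernstein_function bf \<nu>f f" and berng: "bernstein_function bg \<nu>g g"
    and lam: "0 < lam" and eta: "0 < eta"
    and Pm0: "(\<lambda>(x, t). P x t) \<in> borel_measurable borel" and Pnn: "\<And>x t. 0 \<le> P x t"
    and Px0: "\<And>x t. x \<le> 0 \<Longrightarrow> P x t = 0"
    and wm [measurable]: "w \<in> borel_measurable borel" and w01: "\<And>t. 0 \<le> w t" "\<And>t. 0 \<le> t \<Longrightarrow> w t \<le> 1"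
    and wl: "\<And>s. 0 < s \<Longrightarrow> laplace (\<lambda>t. ennreal (w t)) s = ennreal (f s / s / (lam + f s))"
    and Pl: "\<And>\<theta> s. 0 < \<theta> \<Longrightarrow> 0 < s \<Longrightarrow> laplace (\<lambda>t. laplace (\<lambda>x. ennreal (P x t)) \<theta>) s
        = ennreal (f s / s * (1 / (lam * g \<theta> / (eta + g \<theta>) + f s) - 1 / (lam + f s)))"
    and Pfin: "\<And>t. 0 \<le> t \<Longrightarrow> laplace (\<lambda>x. ennreal (P x t)) 1 < \<infinity>"
    and P0: "AE x in lborel. 0 < x \<longrightarrow> P x 0 = 0"
    and reg: "equation_regular bf \<nu>f bg \<nu>g P"
begin

lemma Pm [measurable]: "(\<lambda>(x, t). P x t) \<in> borel_measurable (borel \<Otimes>\<^sub>M borel)"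
  using Pm0 by (simp add: borel_prod)

abbreviation "kf \<equiv> \<lambda>s. ennreal (levy_tail \<nu>f s)"
abbreviation "kg \<equiv> \<lambda>s. ennreal (levy_tail \<nu>g s)"

lemma tail_measurable [measurable]: "levy_tail \<nu>f \<in> borel_measurable borel" "levy_tail \<nu>g \<in> borel_measurable borel"
  using levy_tail_measurable bernf berng by auto

text \<open>In the overview's notation \<open>F\<close> is 1 *_x P, \<open>G\<close> is k_g *_x P,
  and \<open>L\<close> and \<open>R\<close> are the two sides of the integrated equation.\<close>

definition F :: "real \<Rightarrow> real \<Rightarrow> ennreal" where "F x r = nconv 0 (\<lambda>_. 1) (\<lambda>y. ennreal (P y r)) x"
definition G :: "real \<Rightarrow> real \<Rightarrow> ennreal" where "G x r = nconv bg kg (\<lambda>y. ennreal (P y r)) x"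
definition L :: "real \<Rightarrow> real \<Rightarrow> ennreal" where
  "L x t = ennreal eta * nconv bf kf (F x) t + nconv bf kf (G x) t + ennreal lam * nconv 0 (\<lambda>_. 1) (G x) t"
definition R :: "real \<Rightarrow> ennreal" where
  "R t = ennreal (lam * eta) * nconv 0 (\<lambda>_. 1) (\<lambda>r. ennreal (w r)) t"

lemma F_measurable [measurable]: "(\<lambda>(x, r). F x r) \<in> borel_measurable (borel \<Otimes>\<^sub>M borel)"
  unfolding F_def case_prod_beta by measurable

lemma G_measurable [measurable]: "(\<lambda>(x, r). G x r) \<in> borel_measurable (borel \<Otimes>\<^sub>M borel)"
  unfolding G_def case_prod_beta by measurable

lemma L_measurable [measurable]: "(\<lambda>(x, r). L x r) \<in> borel_measurable (borel \<Otimes>\<^sub>M borel)"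
  unfolding L_def case_prod_beta by measurable

lemma R_measurable [measurable]: "R \<in> borel_measurable borel"
  unfolding R_def by measurable

text \<open>The value is at most lam * eta * max 0 t. Through the integrated equation this
  finiteness passes to every term of \<open>L\<close>.\<close>

lemma R_finite: "R t < \<infinity>"
proof -
  have "nconv 0 (\<lambda>_. 1) (\<lambda>r. ennreal (w r)) t \<le> (\<integral>\<^sup>+s. indicator {0..max 0 t} s \<partial>lborel)"
    unfolding nconv_one[OF measurable_compose[OF wm measurable_ennreal]]
    using w01 by (intro nn_integral_mono) (auto simp: indicator_def)
  also have "\<dots> = ennreal (max 0 t)" by (simp add: nn_integral_indicator)
  finally have "nconv 0 (\<lambda>_. 1) (\<lambda>r. ennreal (w r)) t < \<infinity>" by (auto intro: le_less_trans)
  then show ?thesis by (simp add: R_def ennreal_mult_less_top)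
qed

lemma laplace_F: "0 < \<theta> \<Longrightarrow> laplace (\<lambda>x. F x r) \<theta> = ennreal (1 / \<theta>) * laplace (\<lambda>x. ennreal (P x r)) \<theta>"
  unfolding F_def by (subst laplace_nconv) (auto simp: laplace_one)

lemma laplace_G: "0 < \<theta> \<Longrightarrow> laplace (\<lambda>x. G x r) \<theta> = ennreal (g \<theta> / \<theta>) * laplace (\<lambda>x. ennreal (P x r)) \<theta>"
  unfolding G_def by (subst laplace_nconv) (auto simp: laplace_levy_tail[OF berng])

lemma laplace_L:
  assumes \<theta>: "0 < \<theta>"
  shows "laplace (\<lambda>x. L x t) \<theta> = ennreal eta * nconv bf kf (\<lambda>r. ennreal (1 / \<theta>) * laplace (\<lambda>x. ennreal (P x r)) \<theta>) t
    + nconv bf kf (\<lambda>r. ennreal (g \<theta> / \<theta>) * laplace (\<lambda>x. ennreal (P x r)) \<theta>) t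
    + ennreal lam * nconv 0 (\<lambda>_. 1) (\<lambda>r. ennreal (g \<theta> / \<theta>) * laplace (\<lambda>x. ennreal (P x r)) \<theta>) t"
  unfolding L_def
  by (simp add: laplace_add laplace_cmult laplace_nconv_swap laplace_F laplace_G \<theta>)

lemma laplace_laplace_L:
  assumes \<theta>: "0 < \<theta>" and s: "0 < s"
  shows "laplace (\<lambda>t. laplace (\<lambda>x. L x t) \<theta>) s = laplace (\<lambda>t. laplace (\<lambda>x. R t) \<theta>) s" (is "?l = ?r")
    and "laplace (\<lambda>t. laplace (\<lambda>x. L x t) \<theta>) s < \<infinity>"
proof -
  note fp = bernstein_pos[OF bernf s] and gp = bernstein_pos[OF berng \<theta>]
  define \<mu> where "\<mu> = lam * g \<theta> / (eta + g \<theta>)"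
  have \<mu>: "0 < \<mu>" "\<mu> < lam" using lam eta gp by (auto simp: \<mu>_def divide_simps)
  define p where "p = f s / s * (1 / (\<mu> + f s) - 1 / (lam + f s))"
  have p0: "0 \<le> p" unfolding p_def using fp s \<mu> by (intro mult_nonneg_nonneg) (auto simp: divide_simps)
  have [measurable]: "(\<lambda>r. laplace (\<lambda>x. ennreal (P x r)) \<theta>) \<in> borel_measurable borel" by measurable
  have LL: "laplace (\<lambda>t. laplace (\<lambda>x. L x t) \<theta>) s
    = ennreal eta * (ennreal (f s / s) * (ennreal (1 / \<theta>) * ennreal p))
      + ennreal (f s / s) * (ennreal (g \<theta> / \<theta>) * ennreal p)
      + ennreal lam * (ennreal (1 / s) * (ennreal (g \<theta> / \<theta>) * ennreal p))"
    unfolding laplace_L[OF \<theta>] p_def \<mu>_def Pl[OF \<theta> s, symmetric]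
    by (simp add: laplace_add laplace_cmult laplace_nconv laplace_levy_tail[OF bernf s] laplace_one[OF s])
  also have "\<dots> = ennreal (eta * (f s / s * (1 / \<theta> * p)) + f s / s * (g \<theta> / \<theta> * p) + lam * (1 / s * (g \<theta> / \<theta> * p)))"
    using eta fp s \<theta> gp lam p0 by (simp add: ennreal_mult[symmetric] ennreal_plus[symmetric] del: ennreal_plus)
  also have "eta * (f s / s * (1 / \<theta> * p)) + f s / s * (g \<theta> / \<theta> * p) + lam * (1 / s * (g \<theta> / \<theta> * p))
    = lam * eta * (1 / s * (f s / s / (lam + f s))) * (1 / \<theta>)"
    by (rule resolvent_identity) (use eta lam gp fp s \<theta> in \<open>simp_all add: p_def \<mu>_def\<close>)
  also have "ennreal \<dots> = laplace (\<lambda>t. laplace (\<lambda>x. R t) \<theta>) s"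
  proof -
    have "laplace (\<lambda>x. R t) \<theta> = R t * ennreal (1 / \<theta>)" for t
      using laplace_cmult[of "\<lambda>_. 1" "R t" \<theta>] by (simp add: laplace_one[OF \<theta>])
    then have "laplace (\<lambda>t. laplace (\<lambda>x. R t) \<theta>) s = laplace (\<lambda>t. ennreal (1 / \<theta>) * R t) s" by (simp add: mult.commute)
    also have "\<dots> = ennreal (1 / \<theta>) * (ennreal (lam * eta) * (ennreal (1 / s) * ennreal (f s / s / (lam + f s))))"
      unfolding R_def by (subst laplace_cmult, measurable, subst laplace_cmult, measurable, subst laplace_nconv, measurable) (simp add: laplace_one[OF s] wl[OF s])
    also have "\<dots> = ennreal (lam * eta * (1 / s * (f s / s / (lam + f s))) * (1 / \<theta>))"
      using \<theta> s lam eta fp by (simp add: ennreal_mult[symmetric] mult.commute)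
    finally show ?thesis by simp
  qed
  finally show "?l = ?r" .
  show "?l < \<infinity>" unfolding LL by (simp add: ennreal_mult_less_top)
qed

text \<open>The right-hand side is constant in the space variable: it stems from the atom at 0, which
  \<open>P\<close> leaves out.\<close>

lemma integrated_equation: "AE t in lborel. 0 < t \<longrightarrow> (AE x in lborel. 0 < x \<longrightarrow> L x t = R t)"
proof -
  \<comment> \<open>Uniqueness in time for each positive integer \<theta>. Countably many \<theta>
    leave one null set of times, outside which uniqueness in space applies.\<close>
  have "AE t in lborel. 0 < t \<longrightarrow> laplace (\<lambda>x. L x t) (real (Suc n)) = laplace (\<lambda>x. R t) (real (Suc n))" for n
  proof (rule AE_eq_of_laplace)
    show "laplace (\<lambda>t. laplace (\<lambda>x. L x t) (real (Suc n))) 1 < \<infinity>" by (rule laplace_laplace_L(2)) auto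
    show "laplace (\<lambda>t. laplace (\<lambda>x. L x t) (real (Suc n))) (real m) = laplace (\<lambda>t. laplace (\<lambda>x. R t) (real (Suc n))) (real m)"
      if "1 \<le> m" for m using that by (intro laplace_laplace_L(1)) auto
  qed measurable
  then have "AE t in lborel. \<forall>n. 0 < t \<longrightarrow> laplace (\<lambda>x. L x t) (real (Suc n)) = laplace (\<lambda>x. R t) (real (Suc n))"
    unfolding AE_all_countable by blast
  then show ?thesis
  proof eventually_elim
    case (elim t)
    show ?case
    proof
      assume t: "0 < t"
      have e: "laplace (\<lambda>x. L x t) (real n) = laplace (\<lambda>x. R t) (real n)" if "1 \<le> n" for n
        using elim[rule_format, of "n - 1"] t that by simp
      show "AE x in lborel. 0 < x \<longrightarrow> L x t = R t"
      proof (rule AE_eq_of_laplace[OF _ _ e])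
        have "laplace (\<lambda>x. R t) 1 = R t * 1"
          using laplace_cmult[of "\<lambda>_. 1" "R t" 1] laplace_one[of 1] by simp
        then show "laplace (\<lambda>x. L x t) 1 < \<infinity>" using e[of 1] R_finite[of t] by simp
      qed measurable
    qed
  qed
qed

end

context subordinated_density
begin

text \<open>The cut-off keeps to the quadrant x > 0, t \<ge> 0, on whose compact boxes the
  regularity assumptions give integrability; this makes a Borel function of both variables.\<close>

definition q :: "real \<Rightarrow> real \<Rightarrow> real" where
  "q x t = (if 0 < x \<and> 0 \<le> t then caputo bg \<nu>g (\<lambda>y. P y t) x else 0)"

definition Gr :: "real \<Rightarrow> real \<Rightarrow> real" where "Gr x r = rconv bg (levy_tail \<nu>g) (\<lambda>y. P y r) x"

lemma Gr_measurable [measurable]: "(\<lambda>(x, r). Gr x r) \<in> borel_measurable (borel \<Otimes>\<^sub>M borel)"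
  unfolding Gr_def case_prod_beta by measurable

lemma bf_nonneg: "0 \<le> bf" and bg_nonneg: "0 \<le> bg"
  using bernstein_functionD(1)[OF bernf] bernstein_functionD(1)[OF berng] .

lemma P_section [measurable]: "(\<lambda>y. P y r) \<in> borel_measurable borel" by measurable

lemma P_domain: "0 \<le> t \<Longrightarrow> caputo_domain bg \<nu>g (\<lambda>y. P y t)"
  using reg by (simp add: equation_regular_def)

lemma Gr_caputo_conv: "0 < x \<Longrightarrow> caputo_conv bg \<nu>g (\<lambda>y. P y r) x = Gr x r"
  unfolding Gr_def by (rule caputo_conv_eq_rconv) auto

text \<open>Integrability from \<open>caputo_domain\<close> makes \<open>G\<close> finite at every
  such point, with no exceptional set.\<close>

lemma G_eq_Gr:
  assumes x: "0 < x" and r: "0 \<le> r"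
  shows "G x r = ennreal (Gr x r)" "0 \<le> Gr x r"
proof -
  have "set_integrable lebesgue {0<..<x} (\<lambda>s. P (x - s) r * levy_tail \<nu>g s)"
    by (rule caputo_integral(1)[OF berng P_domain[OF r] _ x]) (simp add: Px0)
  then have "set_integrable lborel {0<..<x} (\<lambda>s. P (x - s) r * levy_tail \<nu>g s)"
    by (subst (asm) set_integral_lebesgue_eq_lborel) auto
  moreover have "indicator {0<..<x} s *\<^sub>R (P (x - s) r * levy_tail \<nu>g s) = (if 0 < s \<and> s < x then P (x - s) r * levy_tail \<nu>g s else 0)" for s
    by (auto simp: indicator_def)
  ultimately have i: "integrable lborel (\<lambda>s. if 0 < s \<and> s < x then P (x - s) r * levy_tail \<nu>g s else 0)"
    by (simp add: set_integrable_def)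
  show "G x r = ennreal (Gr x r)" "0 \<le> Gr x r"
    unfolding G_def Gr_def using nconv_ennreal[OF _ _ _ _ bg_nonneg x i] Pnn levy_tail_nonneg by auto
qed

text \<open>Endpoints of the intervals [1 / m, m] that exhaust x > 0. The shift by 2 keeps 1 / m < m
  strict already for the first one.\<close>

lemma reciprocal_bounds: "0 < 1 / real (Suc (Suc n))" "1 / real (Suc (Suc n)) < real (Suc (Suc n))"
proof -
  have "1 < real (Suc (Suc n)) * real (Suc (Suc n))" by (intro less_1_mult) auto
  then show "0 < 1 / real (Suc (Suc n))" "1 / real (Suc (Suc n)) < real (Suc (Suc n))" by (auto simp: divide_less_eq)
qed

text \<open>Measurability is only implicit in integrability over boxes, so \<open>q\<close> is
  obtained as the pointwise limit of its restrictions to an exhausting sequence of them.\<close>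

lemma q_measurable [measurable]: "(\<lambda>(x, t). q x t) \<in> borel_measurable (borel \<Otimes>\<^sub>M borel)"
proof -
  let ?A = "\<lambda>n. {1 / real (Suc (Suc n))..real (Suc (Suc n))} \<times> {0..real (Suc (Suc n))}"
  let ?c = "\<lambda>p. case p of (x, t) \<Rightarrow> caputo bg \<nu>g (\<lambda>y. P y t) x"
  have m: "(\<lambda>p. indicator (?A n) p *\<^sub>R ?c p) \<in> borel_measurable (borel \<Otimes>\<^sub>M borel)" for n
  proof -
    have "set_integrable lborel (?A n) ?c"
      using reg reciprocal_bounds[of n] unfolding equation_regular_def by simp
    then have "(\<lambda>p. indicator (?A n) p *\<^sub>R ?c p) \<in> borel_measurable borel"
      unfolding set_integrable_def by (auto dest: borel_measurable_integrable)
    then show ?thesis by (simp add: borel_prod)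
  qed
  show ?thesis
  proof (rule borel_measurable_LIMSEQ_real[OF _ m])
    fix p :: "real \<times> real"
    obtain x t where p: "p = (x, t)" by (cases p)
    have "\<forall>\<^sub>F n in sequentially. indicator (?A n) p *\<^sub>R ?c p = (case p of (x, t) \<Rightarrow> q x t)"
    proof (cases "0 < x \<and> 0 \<le> t")
      case True
      obtain N where N: "max (1 / x) (max x t) < real N" using reals_Archimedean2 by blast
      have "indicator (?A n) p *\<^sub>R ?c p = (case p of (x, t) \<Rightarrow> q x t)" if "N \<le> n" for n
      proof -
        define m where "m = real (Suc (Suc n))"
        have "real N \<le> m" using that by (simp add: m_def)
        then have m: "1 / x < m" "x < m" "t < m" using N by linarith+
        then have "1 / m \<le> x" using True by (simp add: field_simps)
        then show ?thesis using True m unfolding m_def[symmetric] by (simp add: p q_def)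
      qed
      then show ?thesis unfolding eventually_sequentially by blast
    next
      case False
      have "p \<notin> ?A n" for n
      proof
        assume "p \<in> ?A n"
        then have "1 / real (Suc (Suc n)) \<le> x" "0 \<le> t" by (auto simp: p)
        then show False using False reciprocal_bounds(1)[of n] by linarith
      qed
      then show ?thesis using False by (auto simp: p q_def)
    qed
    then show "(\<lambda>n. indicator (?A n) p *\<^sub>R ?c p) \<longlonglongrightarrow> (case p of (x, t) \<Rightarrow> q x t)"
      by (rule tendsto_eventually)
  qed
qed

lemma q_locally_integrable:
  assumes "0 < a" "a < c" "0 < T"
  shows "(\<integral>\<^sup>+r. (if 0 \<le> r \<and> r \<le> T then (\<integral>\<^sup>+y. (if a \<le> y \<and> y \<le> c then ennreal \<bar>q y r\<bar> else 0) \<partial>lborel) else 0) \<partial>lborel) < \<infinity>"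
    and "AE y in lborel. a \<le> y \<and> y \<le> c \<longrightarrow> set_integrable lborel {0..T} (q y)"
proof -
  have "set_integrable lborel ({a..c} \<times> {0..T}) (\<lambda>(x, t). caputo bg \<nu>g (\<lambda>y. P y t) x)"
    using reg assms by (simp add: equation_regular_def)
  then have "set_integrable lborel ({a..c} \<times> {0..T}) (\<lambda>(x, t). q x t)"
    by (rule set_integral_cong_on(1)[THEN iffD1, rotated]) (use assms in \<open>auto simp: q_def\<close>)
  then have i: "integrable (lborel \<Otimes>\<^sub>M lborel) (\<lambda>(y, r). indicator ({a..c} \<times> {0..T}) (y, r) *\<^sub>R q y r)"
    by (simp add: set_integrable_def lborel_prod case_prod_unfold)
  then have "(\<integral>\<^sup>+p. ennreal (norm ((\<lambda>(y, r). indicator ({a..c} \<times> {0..T}) (y, r) *\<^sub>R q y r) p)) \<partial>(lborel \<Otimes>\<^sub>M lborel)) < \<infinity>"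
    unfolding integrable_iff_bounded by blast
  also have "(\<integral>\<^sup>+p. ennreal (norm ((\<lambda>(y, r). indicator ({a..c} \<times> {0..T}) (y, r) *\<^sub>R q y r) p)) \<partial>(lborel \<Otimes>\<^sub>M lborel))
    = (\<integral>\<^sup>+r. \<integral>\<^sup>+y. ennreal (norm (indicator ({a..c} \<times> {0..T}) (y, r) *\<^sub>R q y r)) \<partial>lborel \<partial>lborel)"
    using i by (subst lborel_pair.nn_integral_snd[symmetric]) auto
  also have "\<dots> = (\<integral>\<^sup>+r. (if 0 \<le> r \<and> r \<le> T then (\<integral>\<^sup>+y. (if a \<le> y \<and> y \<le> c then ennreal \<bar>q y r\<bar> else 0) \<partial>lborel) else 0) \<partial>lborel)"
  proof (rule nn_integral_cong)
    fix r
    show "(\<integral>\<^sup>+y. ennreal (norm (indicator ({a..c} \<times> {0..T}) (y, r) *\<^sub>R q y r)) \<partial>lborel)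
      = (if 0 \<le> r \<and> r \<le> T then (\<integral>\<^sup>+y. (if a \<le> y \<and> y \<le> c then ennreal \<bar>q y r\<bar> else 0) \<partial>lborel) else 0)"
      by (cases "0 \<le> r \<and> r \<le> T") (auto intro!: nn_integral_cong simp: indicator_def)
  qed
  finally show "(\<integral>\<^sup>+r. (if 0 \<le> r \<and> r \<le> T then (\<integral>\<^sup>+y. (if a \<le> y \<and> y \<le> c then ennreal \<bar>q y r\<bar> else 0) \<partial>lborel) else 0) \<partial>lborel) < \<infinity>" .
  from lborel_pair.AE_integrable_fst[OF i]
  show "AE y in lborel. a \<le> y \<and> y \<le> c \<longrightarrow> set_integrable lborel {0..T} (q y)"
    by eventually_elim (auto simp: set_integrable_def indicator_times)
qed

text \<open>A convolution of locally integrable functions need be finite only almost everywhere. Cut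
  off at time \<open>T\<close> both factors have finite integrals, and so has their convolution, by
  the product formula for transforms at 0. The null set of times may depend on \<open>a\<close> and
  \<open>c\<close>.\<close>

lemma q_convolution_finite:
  fixes k :: "real \<Rightarrow> real"
  assumes [measurable]: "k \<in> borel_measurable borel" and k: "\<And>s. 0 \<le> k s" "\<And>T. set_integrable lborel {0<..<T} k"
    and ac: "0 < a" "a < c"
  shows "AE t in lborel. 0 < t \<longrightarrow>
    (\<integral>\<^sup>+s. (if 0 < s \<and> s < t then (\<integral>\<^sup>+y. (if a \<le> y \<and> y \<le> c then ennreal \<bar>q y (t - s)\<bar> else 0) \<partial>lborel) * ennreal (k s) else 0) \<partial>lborel) < \<infinity>"
proof -
  define v where "v r = (\<integral>\<^sup>+y. (if a \<le> y \<and> y \<le> c then ennreal \<bar>q y r\<bar> else 0) \<partial>lborel)" for r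
  have [measurable]: "v \<in> borel_measurable borel" unfolding v_def by measurable
  have "AE t in lborel. 0 < t \<and> t < T \<longrightarrow> nconv 0 (\<lambda>s. ennreal (k s)) v t < \<infinity>" if T: "0 < T" for T
  proof -
    define v1 where "v1 r = (if 0 \<le> r \<and> r \<le> T then v r else 0)" for r
    define k1 where "k1 s = ennreal (norm (indicator {0<..<T} s *\<^sub>R k s))" for s
    have [measurable]: "v1 \<in> borel_measurable borel" "k1 \<in> borel_measurable borel" unfolding v1_def k1_def by measurable
    have "laplace (nconv 0 k1 v1) 0 = laplace k1 0 * laplace v1 0" by (subst laplace_nconv) auto
    also have "\<dots> < \<infinity>"
    proof -
      have "laplace k1 0 \<le> (\<integral>\<^sup>+s. k1 s \<partial>lborel)" "laplace v1 0 \<le> (\<integral>\<^sup>+r. v1 r \<partial>lborel)"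
        unfolding laplace_def by (auto intro!: nn_integral_mono)
      moreover have "(\<integral>\<^sup>+s. k1 s \<partial>lborel) < \<infinity>"
        using k(2)[of T] unfolding k1_def set_integrable_def integrable_iff_bounded by simp
      moreover have "(\<integral>\<^sup>+r. v1 r \<partial>lborel) < \<infinity>"
        using q_locally_integrable(1)[OF ac T] unfolding v1_def v_def .
      ultimately show ?thesis by (auto simp: ennreal_mult_less_top intro: le_less_trans)
    qed
    finally have "(\<integral>\<^sup>+t. (if 0 < t then ennreal (exp (- 0 * t)) * nconv 0 k1 v1 t else 0) \<partial>lborel) \<noteq> \<infinity>"
      unfolding laplace_def by simp
    then have "AE t in lborel. (if 0 < t then ennreal (exp (- 0 * t)) * nconv 0 k1 v1 t else 0) \<noteq> \<infinity>"
      by (intro nn_integral_PInf_AE) auto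
    then show ?thesis
    proof eventually_elim
      case (elim t)
      show ?case
      proof
        assume t: "0 < t \<and> t < T"
        have "nconv 0 (\<lambda>s. ennreal (k s)) v t = nconv 0 k1 v1 t"
          unfolding nconv_def using t k(1) by (auto simp: v1_def k1_def intro!: nn_integral_cong)
        then show "nconv 0 (\<lambda>s. ennreal (k s)) v t < \<infinity>" using elim t by (simp add: less_top)
      qed
    qed
  qed
  then have "AE t in lborel. 0 < t \<and> t < real (Suc n) \<longrightarrow> nconv 0 (\<lambda>s. ennreal (k s)) v t < \<infinity>" for n by simp
  then have "AE t in lborel. \<forall>n. 0 < t \<and> t < real (Suc n) \<longrightarrow> nconv 0 (\<lambda>s. ennreal (k s)) v t < \<infinity>"
    unfolding AE_all_countable by blast
  then show ?thesis
  proof eventually_elim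
    case (elim t)
    obtain n where "t < real n" using reals_Archimedean2 by blast
    then have "t < real (Suc n)" by simp
    then show ?case using elim[rule_format, of n] unfolding v_def[symmetric] by (simp add: nconv_def)
  qed
qed

text \<open>\<open>P\<close> vanishes at x = 0, so no boundary term arises and the space convolution
  is a primitive of the space derivative.\<close>

lemma q_integral:
  assumes r: "0 \<le> r" and ac: "0 < a" "a < c"
  shows "set_integrable lborel {a..c} (\<lambda>y. q y r)" "(LINT y:{a..c}|lborel. q y r) = Gr c r - Gr a r"
proof -
  note C = caputo_integral(2,3)[OF berng P_domain[OF r] _ ac]
  have P00: "P 0 r = 0" by (simp add: Px0)
  have cong: "set_integrable lebesgue {a..c} (\<lambda>y. q y r) = set_integrable lebesgue {a..c} (caputo bg \<nu>g (\<lambda>y. P y r))"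
    "(LINT y:{a..c}|lebesgue. q y r) = (LINT y:{a..c}|lebesgue. caputo bg \<nu>g (\<lambda>y. P y r) y)"
    using r ac by (intro set_integral_cong_on; simp add: q_def)+
  have qm: "(\<lambda>y. q y r) \<in> borel_measurable borel" by measurable
  note L = set_integral_lebesgue_eq_lborel[OF qm, of "{a..c}"]
  show "set_integrable lborel {a..c} (\<lambda>y. q y r)" using C(1)[OF P00] L(1) cong(1) by simp
  have "caputo_conv bg \<nu>g (\<lambda>y. P y r) c = Gr c r" "caputo_conv bg \<nu>g (\<lambda>y. P y r) a = Gr a r"
    using ac by (simp_all add: Gr_caputo_conv)
  then show "(LINT y:{a..c}|lborel. q y r) = Gr c r - Gr a r"
    using C(2)[OF P00] L(2) cong(2) by simp
qed

definition Fr :: "real \<Rightarrow> real \<Rightarrow> real" where "Fr x r = enn2real (F x r)"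

lemma Fr_measurable [measurable]: "(\<lambda>(x, r). Fr x r) \<in> borel_measurable (borel \<Otimes>\<^sub>M borel)"
  unfolding Fr_def case_prod_beta by measurable

lemma F_finite:
  assumes r: "0 \<le> r"
  shows "F x r < \<infinity>"
proof -
  have "F x r \<le> (\<integral>\<^sup>+y. ennreal (exp x) * (if 0 < y then ennreal (exp (- 1 * y)) * ennreal (P y r) else 0) \<partial>lborel)"
    unfolding F_def nconv_one[OF measurable_compose[OF P_section measurable_ennreal]]
  proof (rule nn_integral_mono)
    fix y
    have "P y r \<le> exp x * (exp (- y) * P y r)" if "y < x"
      using that Pnn[of y r] by (simp add: mult.assoc[symmetric] exp_add[symmetric] mult_le_cancel_right1)
    then show "(if 0 < y \<and> y < x then ennreal (P y r) else 0) \<le> ennreal (exp x) * (if 0 < y then ennreal (exp (- 1 * y)) * ennreal (P y r) else 0)"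
      using Pnn[of y r] by (auto simp: ennreal_mult[symmetric] intro!: ennreal_leI)
  qed
  also have "\<dots> = ennreal (exp x) * laplace (\<lambda>x. ennreal (P x r)) 1"
    unfolding laplace_def by (rule nn_integral_cmult) measurable
  also have "\<dots> < \<infinity>" using Pfin[OF r] by (simp add: ennreal_mult_less_top)
  finally show ?thesis .
qed

lemma F_integral:
  assumes r: "0 \<le> r" and ac: "0 < a" "a < c"
  shows "set_integrable lborel {a..c} (\<lambda>y. P y r)" "(LINT y:{a..c}|lborel. P y r) = Fr c r - Fr a r"
    "(\<integral>\<^sup>+y. (if a \<le> y \<and> y \<le> c then ennreal \<bar>P y r\<bar> else 0) \<partial>lborel) \<le> F c r"
proof -
  let ?I = "\<integral>\<^sup>+y. (if a \<le> y \<and> y \<le> c then ennreal \<bar>P y r\<bar> else 0) \<partial>lborel"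
  have F1: "F x r = (\<integral>\<^sup>+y. (if 0 < y \<and> y < x then ennreal (P y r) else 0) \<partial>lborel)" for x
    unfolding F_def by (rule nconv_one) measurable
  have "F c r = (\<integral>\<^sup>+y. (if 0 < y \<and> y < a then ennreal (P y r) else 0) + (if a \<le> y \<and> y \<le> c then ennreal \<bar>P y r\<bar> else 0) \<partial>lborel)"
    unfolding F1 using AE_lborel_singleton[of c] ac Pnn
    by (intro nn_integral_cong_AE) (auto elim!: eventually_mono)
  also have "\<dots> = F a r + ?I" unfolding F1 by (rule nn_integral_add) measurable
  finally have FF: "F c r = F a r + ?I" .
  then show le: "?I \<le> F c r" by simp
  have I: "?I = (\<integral>\<^sup>+y. ennreal (indicator {a..c} y *\<^sub>R P y r) \<partial>lborel)"
    using Pnn by (intro nn_integral_cong) (auto simp: indicator_def)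
  have fin: "?I < \<infinity>" using le F_finite[OF r, of c] by (rule le_less_trans)
  show i: "set_integrable lborel {a..c} (\<lambda>y. P y r)"
    unfolding set_integrable_def
  proof (rule integrableI_nonneg)
    show "(\<integral>\<^sup>+y. ennreal (indicator {a..c} y *\<^sub>R P y r) \<partial>lborel) < \<infinity>" using fin unfolding I .
    show "AE y in lborel. 0 \<le> indicator {a..c} y *\<^sub>R P y r" using Pnn by auto
  qed measurable
  have "?I = ennreal (LINT y:{a..c}|lborel. P y r)"
    unfolding I set_lebesgue_integral_def using i Pnn by (intro nn_integral_eq_integral) (auto simp: set_integrable_def)
  moreover have "0 \<le> (LINT y:{a..c}|lborel. P y r)"
    unfolding set_lebesgue_integral_def using Pnn by (intro integral_nonneg_AE) auto
  ultimately have "Fr c r = Fr a r + (LINT y:{a..c}|lborel. P y r)"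
    unfolding Fr_def FF using F_finite[OF r, of a] by (subst enn2real_plus) auto
  then show "(LINT y:{a..c}|lborel. P y r) = Fr c r - Fr a r" by simp
qed

text \<open>Formally the space derivative of \<open>L\<close>, and at the same time a primitive in
  time of the sum of the three terms of the equation.\<close>

definition \<Phi> :: "real \<Rightarrow> real \<Rightarrow> real" where
  "\<Phi> y t = eta * rconv bf (levy_tail \<nu>f) (P y) t + rconv bf (levy_tail \<nu>f) (q y) t + lam * rconv 0 (\<lambda>_. 1) (q y) t"

lemma \<Phi>_measurable [measurable]: "(\<lambda>(y, t). \<Phi> y t) \<in> borel_measurable (borel \<Otimes>\<^sub>M borel)"
  unfolding \<Phi>_def case_prod_beta by measurable

lemma one_integrable: "set_integrable lborel {0<..<T :: real} (\<lambda>_. 1 :: real)"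
proof -
  have "emeasure lborel {0<..<T} < \<infinity>" by (cases "0 \<le> T") auto
  then show ?thesis unfolding set_integrable_def by (auto intro!: integrable_mult_indicator)
qed

lemma nconv_cong: "0 < t \<Longrightarrow> (\<And>r. 0 < r \<Longrightarrow> r \<le> t \<Longrightarrow> u r = v r) \<Longrightarrow> nconv b k u t = nconv b k v t"
  unfolding nconv_def by (auto intro!: arg_cong2[where f="(+)"] nn_integral_cong)

text \<open>Countably many boxes are fixed before the endpoints, so one null set of times serves all
  a < c. For the other \<open>t\<close>, increments of \<open>L\<close> in space are integrals of
  \<Phi>, and the constant \<open>R t\<close> has increment 0.\<close>

lemma \<Phi>_zero: "AE t in lborel. 0 < t \<longrightarrow> (AE y in lborel. 0 < y \<longrightarrow> \<Phi> y t = 0)"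
proof -
  let ?B = "\<lambda>k n t. 0 < t \<longrightarrow> (\<integral>\<^sup>+s. (if 0 < s \<and> s < t then (\<integral>\<^sup>+y. (if 1 / real (Suc (Suc n)) \<le> y \<and> y \<le> real (Suc (Suc n)) then ennreal \<bar>q y (t - s)\<bar> else 0) \<partial>lborel) * ennreal (k s) else 0) \<partial>lborel) < \<infinity>"
  note n = reciprocal_bounds
  have "AE t in lborel. ?B (levy_tail \<nu>f) n t" for n
    by (intro q_convolution_finite n levy_tail_nonneg levy_tail_integrable[OF bernf]) measurable
  then have B1: "AE t in lborel. \<forall>n. ?B (levy_tail \<nu>f) n t" unfolding AE_all_countable by blast
  have "AE t in lborel. ?B (\<lambda>_. 1) n t" for n
    by (intro q_convolution_finite n one_integrable) auto
  then have B2: "AE t in lborel. \<forall>n. ?B (\<lambda>_. 1) n t" unfolding AE_all_countable by blast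
  show ?thesis using B1 B2 integrated_equation
  proof eventually_elim
    case (elim t)
    show ?case
    proof
      assume t: "0 < t"
      let ?S = "{x. 0 < x \<and> L x t = R t}"
      have S: "AE x in lborel. 0 < x \<longrightarrow> x \<in> ?S" using elim(3) t by (auto elim!: eventually_mono)
      define \<alpha> where "\<alpha> x = nconv bf kf (\<lambda>r. ennreal (Fr x r)) t" for x
      define \<beta> where "\<beta> x = nconv bf kf (\<lambda>r. ennreal (Gr x r)) t" for x
      define \<gamma> where "\<gamma> x = nconv 0 (\<lambda>_. ennreal 1) (\<lambda>r. ennreal (Gr x r)) t" for x
      have Leq: "L x t = ennreal eta * \<alpha> x + \<beta> x + ennreal lam * \<gamma> x" if x: "0 < x" for x
      proof -
        have "nconv bf kf (F x) t = \<alpha> x" unfolding \<alpha>_def Fr_def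
          using F_finite by (intro nconv_cong t) (simp add: less_top)
        moreover have "nconv bf kf (G x) t = \<beta> x" "nconv 0 (\<lambda>_. 1) (G x) t = \<gamma> x" unfolding \<beta>_def \<gamma>_def ennreal_1
          using G_eq_Gr(1)[OF x] by (intro nconv_cong t; simp)+
        ultimately show ?thesis by (simp add: L_def)
      qed
      \<comment> \<open>Finiteness of \<open>R t\<close> bounds each non-negative summand, so the
        identity can be moved to the reals and subtracted at two points.\<close>
      have fin: "\<alpha> x < \<infinity>" "\<beta> x < \<infinity>" "\<gamma> x < \<infinity>"
        "eta * enn2real (\<alpha> x) + enn2real (\<beta> x) + lam * enn2real (\<gamma> x) = enn2real (R t)" if x: "x \<in> ?S" for x
      proof -
        have R: "ennreal eta * \<alpha> x + \<beta> x + ennreal lam * \<gamma> x = R t" using Leq x by auto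
        then have "ennreal eta * \<alpha> x + \<beta> x + ennreal lam * \<gamma> x < \<infinity>" using R_finite by simp
        then show f: "\<alpha> x < \<infinity>" "\<beta> x < \<infinity>" "\<gamma> x < \<infinity>"
          using eta lam by (auto simp: ennreal_mult_less_top less_top ennreal_mult_eq_top_iff)
        then show "eta * enn2real (\<alpha> x) + enn2real (\<beta> x) + lam * enn2real (\<gamma> x) = enn2real (R t)"
          unfolding R[symmetric] using eta lam
          by (simp add: enn2real_plus enn2real_mult ennreal_mult_less_top)
      qed
      show "AE y in lborel. 0 < y \<longrightarrow> \<Phi> y t = 0"
      proof (rule AE_zero_of_interval_integrals[OF S])
        fix a c assume a: "a \<in> ?S" and c: "c \<in> ?S" and ac: "0 < a" "a < c"
        have c0: "0 < c" using ac by simp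
        obtain n where nn: "max (1 / a) c < real n" using reals_Archimedean2 by blast
        have nac: "1 / real (Suc (Suc n)) \<le> a" "c \<le> real (Suc (Suc n))"
        proof -
          have "1 / a < real (Suc (Suc n))" using nn by simp
          then show "1 / real (Suc (Suc n)) \<le> a" using ac by (simp add: field_simps)
          show "c \<le> real (Suc (Suc n))" using nn by simp
        qed
        have Iq: "(\<integral>\<^sup>+s. (if 0 < s \<and> s < t then (\<integral>\<^sup>+y. (if a \<le> y \<and> y \<le> c then ennreal \<bar>q y (t - s)\<bar> else 0) \<partial>lborel) * ennreal (k s) else 0) \<partial>lborel) < \<infinity>"
          if "?B k n t" for k
        proof -
          have le: "(\<integral>\<^sup>+y. (if a \<le> y \<and> y \<le> c then ennreal \<bar>q y (t - s)\<bar> else 0) \<partial>lborel)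
            \<le> (\<integral>\<^sup>+y. (if 1 / real (Suc (Suc n)) \<le> y \<and> y \<le> real (Suc (Suc n)) then ennreal \<bar>q y (t - s)\<bar> else 0) \<partial>lborel)"
            (is "?l s \<le> ?r s") for s
            using nac by (intro nn_integral_mono) (simp del: of_nat_Suc)
          have "(\<integral>\<^sup>+s. (if 0 < s \<and> s < t then ?l s * ennreal (k s) else 0) \<partial>lborel) \<le> (\<integral>\<^sup>+s. (if 0 < s \<and> s < t then ?r s * ennreal (k s) else 0) \<partial>lborel)"
          proof (rule nn_integral_mono)
            fix s
            show "(if 0 < s \<and> s < t then ?l s * ennreal (k s) else 0) \<le> (if 0 < s \<and> s < t then ?r s * ennreal (k s) else 0)"
              using mult_right_mono[OF le[of s] zero_le] by (cases "0 < s \<and> s < t") (simp_all only: if_True if_False simp_thms order_refl)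
          qed
          also have "\<dots> < \<infinity>" using that t by blast
          finally show ?thesis .
        qed
        \<comment> \<open>As \<open>P\<close> is non-negative, its integral over [a, c] is at most
          the value of \<open>F\<close> at c, and finiteness of \<alpha> c gives the bound without
          further exceptional times.\<close>
        have IP: "(\<integral>\<^sup>+s. (if 0 < s \<and> s < t then (\<integral>\<^sup>+y. (if a \<le> y \<and> y \<le> c then ennreal \<bar>P y (t - s)\<bar> else 0) \<partial>lborel) * ennreal (levy_tail \<nu>f s) else 0) \<partial>lborel) < \<infinity>"
        proof (rule le_less_trans[OF _ fin(1)[OF c]])
          show "(\<integral>\<^sup>+s. (if 0 < s \<and> s < t then (\<integral>\<^sup>+y. (if a \<le> y \<and> y \<le> c then ennreal \<bar>P y (t - s)\<bar> else 0) \<partial>lborel) * ennreal (levy_tail \<nu>f s) else 0) \<partial>lborel) \<le> \<alpha> c"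
            unfolding \<alpha>_def nconv_def
          proof (rule add_increasing[OF zero_le], rule nn_integral_mono)
            fix s
            show "(if 0 < s \<and> s < t then (\<integral>\<^sup>+y. (if a \<le> y \<and> y \<le> c then ennreal \<bar>P y (t - s)\<bar> else 0) \<partial>lborel) * ennreal (levy_tail \<nu>f s) else 0)
              \<le> (if 0 < s \<and> s < t then ennreal (Fr c (t - s)) * kf s else 0)"
              using F_integral(3)[of "t - s" a c] F_finite[of "t - s" c] ac
              by (auto simp: Fr_def less_top intro!: mult_right_mono)
          qed
        qed
        note DF = rconv_difference[OF Pm _ _ _ levy_tail_nonneg bf_nonneg t _ _ fin(1)[OF a, unfolded \<alpha>_def] fin(1)[OF c, unfolded \<alpha>_def] _ _ IP]
        note DG = rconv_difference[OF q_measurable _ _ _ levy_tail_nonneg bf_nonneg t _ _ fin(2)[OF a, unfolded \<beta>_def] fin(2)[OF c, unfolded \<beta>_def] _ _ Iq[of "levy_tail \<nu>f"]]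
        note D1 = rconv_difference[OF q_measurable _ _ _ _ order_refl t _ _ fin(3)[OF a, unfolded \<gamma>_def] fin(3)[OF c, unfolded \<gamma>_def] _ _ Iq[of "\<lambda>_. 1"]]
        have dF: "set_integrable lborel {a..c} (\<lambda>y. rconv bf (levy_tail \<nu>f) (P y) t)"
          "(LINT y:{a..c}|lborel. rconv bf (levy_tail \<nu>f) (P y) t) = enn2real (\<alpha> c) - enn2real (\<alpha> a)"
          using DF F_integral(1,2)[OF _ ac] unfolding \<alpha>_def by (auto simp: Fr_def)
        have dG: "set_integrable lborel {a..c} (\<lambda>y. rconv bf (levy_tail \<nu>f) (q y) t)"
          "(LINT y:{a..c}|lborel. rconv bf (levy_tail \<nu>f) (q y) t) = enn2real (\<beta> c) - enn2real (\<beta> a)"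
          using DG q_integral[OF _ ac] elim(1) G_eq_Gr(2)[OF ac(1)] G_eq_Gr(2)[OF c0] unfolding \<beta>_def by auto
        have d1: "set_integrable lborel {a..c} (\<lambda>y. rconv 0 (\<lambda>_. 1) (q y) t)"
          "(LINT y:{a..c}|lborel. rconv 0 (\<lambda>_. 1) (q y) t) = enn2real (\<gamma> c) - enn2real (\<gamma> a)"
          using D1 q_integral[OF _ ac] elim(2) G_eq_Gr(2)[OF ac(1)] G_eq_Gr(2)[OF c0] unfolding \<gamma>_def by auto
        have i12: "set_integrable lborel {a..c} (\<lambda>y. eta * rconv bf (levy_tail \<nu>f) (P y) t + rconv bf (levy_tail \<nu>f) (q y) t)"
          using dF(1) dG(1) by (intro set_integral_add(1)) auto
        have i3: "set_integrable lborel {a..c} (\<lambda>y. lam * rconv 0 (\<lambda>_. 1) (q y) t)" using d1(1) by simp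
        have "set_integrable lborel {a..c} (\<lambda>y. \<Phi> y t)" unfolding \<Phi>_def by (rule set_integral_add(1)[OF i12 i3])
        moreover have "(LINT y:{a..c}|lborel. \<Phi> y t) = 0"
        proof -
          have "(LINT y:{a..c}|lborel. \<Phi> y t) = eta * (enn2real (\<alpha> c) - enn2real (\<alpha> a)) + (enn2real (\<beta> c) - enn2real (\<beta> a)) + lam * (enn2real (\<gamma> c) - enn2real (\<gamma> a))"
            unfolding \<Phi>_def set_integral_add(2)[OF i12 i3] using dF dG d1
            by (subst set_integral_add(2)) auto
          also have "\<dots> = 0" using fin(4)[OF a] fin(4)[OF c] by (simp add: algebra_simps)
          finally show ?thesis .
        qed
        moreover have "(\<lambda>y. \<Phi> y t) \<in> borel_measurable borel" by measurable
        ultimately show "set_integrable lebesgue {a..c} (\<lambda>y. \<Phi> y t) \<and> (LINT y:{a..c}|lebesgue. \<Phi> y t) = 0"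
          by (simp add: set_integral_lebesgue_eq_lborel)
      qed
    qed
  qed
qed

text \<open>\<open>P\<close> vanishes almost everywhere at time 0, hence so does \<open>Gr\<close>,
  and then \<open>q\<close>, of which \<open>Gr\<close> is a primitive. The outer time derivative in
  the equation is integrated with this zero initial value.\<close>

lemma q_0: "AE y in lborel. 0 < y \<longrightarrow> q y 0 = 0"
proof -
  have "laplace (\<lambda>x. ennreal (P x 0)) \<theta> = 0" for \<theta>
  proof -
    have "laplace (\<lambda>x. ennreal (P x 0)) \<theta> = (\<integral>\<^sup>+(x::real). 0 \<partial>lborel)"
      unfolding laplace_def using P0 by (intro nn_integral_cong_AE) (auto elim!: eventually_mono)
    then show ?thesis by simp
  qed
  then have "laplace (\<lambda>x. G x 0) (real n) = laplace (\<lambda>_. 0) (real n)" if "1 \<le> n" for n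
    using that by (simp add: laplace_G) (simp add: laplace_def cong: if_cong)
  then have "AE x in lborel. 0 < x \<longrightarrow> G x 0 = 0"
    using laplace_G[of 1 0] by (intro AE_eq_of_laplace) (auto simp: \<open>\<And>\<theta>. laplace (\<lambda>x. ennreal (P x 0)) \<theta> = 0\<close>)
  then have "AE x in lborel. 0 < x \<longrightarrow> x \<in> {x. 0 < x \<and> Gr x 0 = 0}"
    by eventually_elim (use G_eq_Gr[of _ 0] in auto)
  then show ?thesis
  proof (rule AE_zero_of_interval_integrals)
    fix a c assume "a \<in> {x. 0 < x \<and> Gr x 0 = 0}" "c \<in> {x. 0 < x \<and> Gr x 0 = 0}" "0 < a" "a < c"
    moreover have "(\<lambda>y. q y 0) \<in> borel_measurable borel" by measurable
    ultimately show "set_integrable lebesgue {a..c} (\<lambda>y. q y 0) \<and> (LINT y:{a..c}|lebesgue. q y 0) = 0"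
      using q_integral[of 0 a c] by (simp add: set_integral_lebesgue_eq_lborel)
  qed
qed

lemma q_time_integrable: "AE y in lborel. 0 < y \<longrightarrow> (\<forall>T>0. set_integrable lborel {0..T} (q y))"
proof -
  have "AE y in lborel. 1 / real (Suc (Suc n)) \<le> y \<and> y \<le> real (Suc (Suc n)) \<longrightarrow> set_integrable lborel {0..real (Suc (Suc n))} (q y)" for n
    by (rule q_locally_integrable(2)[OF reciprocal_bounds]) simp
  then have "AE y in lborel. \<forall>n. 1 / real (Suc (Suc n)) \<le> y \<and> y \<le> real (Suc (Suc n)) \<longrightarrow> set_integrable lborel {0..real (Suc (Suc n))} (q y)"
    unfolding AE_all_countable by blast
  then show ?thesis
  proof eventually_elim
    case (elim y)
    show ?case
    proof (intro impI allI)
      fix T :: real assume y: "0 < y" and T: "0 < T"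
      obtain n where nn: "max (1 / y) (max y T) < real n" using reals_Archimedean2 by blast
      then have b: "1 / y < real (Suc (Suc n))" "y \<le> real (Suc (Suc n))" "T \<le> real (Suc (Suc n))" by simp_all
      then have "1 / real (Suc (Suc n)) \<le> y" using y by (simp add: field_simps)
      then have "set_integrable lborel {0..real (Suc (Suc n))} (q y)" using elim b by blast
      then show "set_integrable lborel {0..T} (q y)" by (rule set_integrable_subset) (use b in auto)
    qed
  qed
qed

lemma density_equation:
  "AE x in lborel. 0 < x \<longrightarrow> (AE t in lborel. 0 < t \<longrightarrow>
     eta * caputo bf \<nu>f (\<lambda>r. P x r) t =
       - (lam * caputo bg \<nu>g (\<lambda>y. P y t) x + caputo bf \<nu>f (\<lambda>r. caputo bg \<nu>g (\<lambda>y. P y r) x) t))"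
proof -
  have "AE t in lborel. AE y in lborel. 0 < t \<and> 0 < y \<longrightarrow> \<Phi> y t = 0"
    using \<Phi>_zero by eventually_elim (auto elim!: eventually_mono)
  \<comment> \<open>The two null-set quantifiers change places, which uses that \<Phi> is Borel in
    both variables: from here on \<open>y\<close> is fixed and \<open>t\<close> varies.\<close>
  then have "AE y in lborel. AE t in lborel. 0 < t \<and> 0 < y \<longrightarrow> \<Phi> y t = 0"
    by (subst (asm) lborel_pair.AE_commute) measurable
  moreover have "AE x in lborel. 0 < x \<longrightarrow> caputo_domain bf \<nu>f (\<lambda>t. P x t) \<and> caputo_domain bf \<nu>f (\<lambda>t. caputo bg \<nu>g (\<lambda>y. P y t) x)"
    using reg by (simp add: equation_regular_def)
  ultimately show ?thesis using P0 q_0 q_time_integrable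
  proof eventually_elim
    case (elim y)
    show ?case
    proof
      assume y: "0 < y"
      let ?C = "\<lambda>t. caputo bg \<nu>g (\<lambda>y. P y t) y"
      have domP: "caputo_domain bf \<nu>f (P y)" and domq: "caputo_domain bf \<nu>f ?C" and y0: "P y 0 = 0" "?C 0 = 0"
        and qi: "\<And>T. 0 < T \<Longrightarrow> set_integrable lborel {0..T} (q y)"
        using elim y by (auto simp: q_def)
      have qC: "q y t = ?C t" if "0 \<le> t" for t using that y by (simp add: q_def)
      have ym [measurable]: "P y \<in> borel_measurable borel" "q y \<in> borel_measurable borel" by measurable
      define H where "H t = (LINT r:{0..t}|lborel. q y r)" for t
      have H: "rconv 0 (\<lambda>_. 1) (q y) t = H t" if t: "0 < t" for t
      proof -
        have "(LINT s|lborel. (if 0 < s \<and> s < t then q y (t - s) * 1 else 0)) = (LINT r|lborel. (if 0 < t - r \<and> t - r < t then q y (t - (t - r)) * 1 else 0))"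
          by (subst lborel_integral_real_affine[of "-1" _ t]) (auto intro!: Bochner_Integration.integral_cong)
        also have "\<dots> = (LINT r|lborel. indicator {0..t} r *\<^sub>R q y r)"
          using AE_lborel_singleton[of "0::real"] AE_lborel_singleton[of t]
          by (intro integral_cong_AE) (auto simp: indicator_def elim!: eventually_elim2)
        finally show ?thesis by (simp add: rconv_def H_def set_lebesgue_integral_def)
      qed
      have CP: "caputo_conv bf \<nu>f (P y) t = rconv bf (levy_tail \<nu>f) (P y) t" if "0 < t" for t
        by (rule caputo_conv_eq_rconv) (use that in auto)
      have Cq: "caputo_conv bf \<nu>f ?C t = rconv bf (levy_tail \<nu>f) (q y) t" if "0 < t" for t
        by (rule caputo_conv_eq_rconv) (use that qC in auto)
      let ?S = "{t. 0 < t \<and> \<Phi> y t = 0}"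
      have S: "AE t in lborel. 0 < t \<longrightarrow> t \<in> ?S" using elim(1) y by (auto elim!: eventually_mono)
      \<comment> \<open>Between times where \<Phi> vanishes the integral of this sum is an increment
        of \<Phi>: \<open>caputo_integral\<close> accounts for the first two terms and
        \<open>H\<close> for the third.\<close>
      have "AE t in lborel. 0 < t \<longrightarrow> eta * caputo bf \<nu>f (P y) t + caputo bf \<nu>f ?C t + lam * q y t = 0"
      proof (rule AE_zero_of_interval_integrals[OF S])
        fix a c assume a: "a \<in> ?S" and c: "c \<in> ?S" and ac: "0 < a" "a < c"
        have c0: "0 < c" using ac by simp
        note iP = caputo_integral(2,3)[OF bernf domP y0(1) ac] and iq = caputo_integral(2,3)[OF bernf domq y0(2) ac]
        have q1: "set_integrable lborel {a..c} (q y)" using qi[OF c0] by (rule set_integrable_subset) (use ac in auto)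
        have q2: "set_integrable lborel {0..a} (q y)" using qi[OF c0] by (rule set_integrable_subset) (use ac in auto)
        have Hd: "(LINT r:{a..c}|lborel. q y r) = H c - H a"
        proof -
          have "{0..c} = {0..a} \<union> {a..c}" using ac by auto
          then have "H c = (LINT r:{0..a} \<union> {a..c}|lborel. q y r)" by (simp add: H_def)
          also have "\<dots> = H a + (LINT r:{a..c}|lborel. q y r)" unfolding H_def
          proof (rule set_integral_Un_AE[OF _ _ _ q2 q1])
            show "AE x in lborel. \<not> (x \<in> {0..a} \<and> x \<in> {a..c})"
              using AE_lborel_singleton[of a] by eventually_elim auto
          qed auto
          finally show ?thesis by simp
        qed
        have l1: "set_integrable lebesgue {a..c} (\<lambda>t. eta * caputo bf \<nu>f (P y) t)"
          and l3: "set_integrable lebesgue {a..c} (\<lambda>t. lam * q y t)"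
          using iP(1) q1 set_integral_lebesgue_eq_lborel(1)[OF ym(2), of "{a..c}"] by auto
        note l12 = set_integral_add[OF l1 iq(1)]
        note l123 = set_integral_add[OF l12(1) l3]
        have "(LINT t:{a..c}|lebesgue. lam * q y t) = lam * (H c - H a)"
          using Hd set_integral_lebesgue_eq_lborel(2)[OF ym(2), of "{a..c}"] by simp
        then have "(LINT t:{a..c}|lebesgue. eta * caputo bf \<nu>f (P y) t + caputo bf \<nu>f ?C t + lam * q y t)
          = eta * (rconv bf (levy_tail \<nu>f) (P y) c - rconv bf (levy_tail \<nu>f) (P y) a) + (rconv bf (levy_tail \<nu>f) (q y) c - rconv bf (levy_tail \<nu>f) (q y) a) + lam * (H c - H a)"
          unfolding l123(2) l12(2) using iP(2) iq(2) by (simp add: CP Cq ac(1) c0)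
        also have "\<dots> = \<Phi> y c - \<Phi> y a" by (simp add: \<Phi>_def H ac(1) c0 algebra_simps)
        also have "\<dots> = 0" using a c by simp
        finally show "set_integrable lebesgue {a..c} (\<lambda>t. eta * caputo bf \<nu>f (P y) t + caputo bf \<nu>f ?C t + lam * q y t) \<and>
          (LINT t:{a..c}|lebesgue. eta * caputo bf \<nu>f (P y) t + caputo bf \<nu>f ?C t + lam * q y t) = 0"
          using l123(1) by blast
      qed
      then show "AE t in lborel. 0 < t \<longrightarrow> eta * caputo bf \<nu>f (\<lambda>r. P y r) t = - (lam * ?C t + caputo bf \<nu>f ?C t)"
        by eventually_elim (auto simp: qC)
    qed
  qed
qed

end

section \<open>Subordination of the compound process\<close>

context levy_subordinator
begin

text \<open>The tail at t = 0 equals 1, so the jump is strictly positive; this later identifies the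
  event of no jumps with the atom. The transform follows by transforming both sides of the tail
  formula in \<open>t\<close>.\<close>

lemma jump_law:
  assumes \<eta>: "0 < \<eta>" and Xm: "V \<in> borel_measurable M"
    and tail: "\<And>t. 0 \<le> t \<Longrightarrow> prob {\<omega> \<in> space M. t < V \<omega>} = expectation (\<lambda>\<omega>. exp (- \<eta> * E t \<omega>))"
  shows "AE \<omega> in M. 0 < V \<omega>" and "0 < s \<Longrightarrow> expectation (\<lambda>\<omega>. exp (- s * V \<omega>)) = \<eta> / (\<eta> + f s)"
proof -
  note [measurable] = Xm
  have "prob {\<omega> \<in> space M. 0 < V \<omega>} = 1" using tail[of 0] expectation_exp_E_0[OF \<eta>] by simp
  then show pos: "AE \<omega> in M. 0 < V \<omega>" by (subst (asm) prob_Collect_eq_1) auto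
  assume s: "0 < s"
  have nn: "AE \<omega> in M. 0 \<le> V \<omega>" using pos by eventually_elim simp
  note fp = bernstein_pos[OF bern s]
  have "laplace (\<lambda>t. emeasure M {\<omega> \<in> space M. t < V \<omega>}) s = laplace (\<lambda>t. ennreal (expectation (\<lambda>\<omega>. exp (- \<eta> * E t \<omega>)))) s"
    by (intro laplace_cong) (simp add: emeasure_eq_measure tail)
  also have "\<dots> = ennreal (f s / s / (\<eta> + f s))" by (rule laplace_E[OF \<eta> s])
  finally have "ennreal ((1 - expectation (\<lambda>\<omega>. exp (- s * V \<omega>))) / s) = ennreal (f s / s / (\<eta> + f s))"
    unfolding laplace_tail_probability[OF Xm nn s] .
  moreover have "expectation (\<lambda>\<omega>. exp (- s * V \<omega>)) \<le> 1"
  proof -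
    have "expectation (\<lambda>\<omega>. exp (- s * V \<omega>)) \<le> expectation (\<lambda>\<omega>. 1)"
      using nn s by (intro integral_mono_AE integrable_const_bound[of _ 1]) (auto elim!: eventually_mono)
    then show ?thesis by (simp add: prob_space)
  qed
  ultimately have "(1 - expectation (\<lambda>\<omega>. exp (- s * V \<omega>))) / s = f s / s / (\<eta> + f s)"
    using s \<eta> fp by (subst (asm) ennreal_inj) auto
  then have "s * ((1 - expectation (\<lambda>\<omega>. exp (- s * V \<omega>))) / s) = s * (f s / s / (\<eta> + f s))" by (rule arg_cong)
  then have "1 - expectation (\<lambda>\<omega>. exp (- s * V \<omega>)) = f s / (\<eta> + f s)" using s by simp
  then show "expectation (\<lambda>\<omega>. exp (- s * V \<omega>)) = \<eta> / (\<eta> + f s)"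
    using \<eta> fp by (simp add: field_simps)
qed

lemma subordination_laplace:
  assumes ind: "indep_set (process_events M {0..} D) (process_events M {0..} T)" and r: "0 \<le> r"
    and Tm: "T r \<in> borel_measurable M" and Tn: "AE \<omega> in M. 0 \<le> T r \<omega>" and s: "0 < s"
  shows "expectation (\<lambda>\<omega>. exp (- s * D (T r \<omega>) \<omega>)) = expectation (\<lambda>\<omega>. exp (- f s * T r \<omega>))"
proof (rule expectation_at_random_time[where Z = D and T = "T r" and h = "\<lambda>x. exp (- s * x)" and \<psi> = "\<lambda>x. exp (- f s * x)"])
  show "continuous (at_right t) (\<lambda>t. D t \<omega>)" if "\<omega> \<in> space M" for \<omega> t
    by (rule right_continuous_increasingD(3)[OF D_rci[OF that]])
  show "indep_var borel (D t) borel (T r)" if "0 \<le> t" for t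
    using that r
    by (intro indep_var_of_indep_set[OF ind process_events_sigma_algebra process_events_sigma_algebra]
        process_measurable[OF _ subset_refl process_events_sigma_algebra]) auto
  show "expectation (\<lambda>\<omega>. exp (- s * D t \<omega>)) = exp (- f s * t)" if "0 \<le> t" for t
    using D_laplace[OF s that] by (simp add: mult.commute)
  show "exp (- s * D t \<omega>) \<le> 1" if "\<omega> \<in> space M" for \<omega> t
    using D_nonneg[OF that, of t] s by simp
qed (use Tm Tn in \<open>auto intro!: continuous_intros\<close>)

end

lemma (in prob_space) exponential_laplace:
  assumes d: "distributed M lborel V (exponential_density \<eta>)" and \<eta>: "0 < \<eta>"
  shows "AE \<omega> in M. 0 \<le> V \<omega>" and "0 < s \<Longrightarrow> expectation (\<lambda>\<omega>. exp (- s * V \<omega>)) = \<eta> / (\<eta> + s)"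
proof -
  have Vm [measurable]: "V \<in> borel_measurable M" using distributed_measurable[OF d] by simp
  have "(\<integral>\<^sup>+\<omega>. indicator {..<0} (V \<omega>) \<partial>M) = (\<integral>\<^sup>+x. ennreal (exponential_density \<eta> x) * indicator {..<0} x \<partial>lborel)"
    by (rule distributed_nn_integral[OF d, symmetric]) auto
  also have "\<dots> = (\<integral>\<^sup>+(x::real). 0 \<partial>lborel)"
    by (intro nn_integral_cong) (auto simp: exponential_density_def indicator_def)
  also have "\<dots> = 0" by simp
  finally have "AE \<omega> in M. indicator {..<0} (V \<omega>) = (0::ennreal)"
    by (subst (asm) nn_integral_0_iff_AE) auto
  then show nn: "AE \<omega> in M. 0 \<le> V \<omega>" by eventually_elim (auto simp: indicator_def split: if_splits)
  assume s: "0 < s"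
  have "(\<integral>\<^sup>+\<omega>. ennreal (exp (- s * V \<omega>)) \<partial>M) = (\<integral>\<^sup>+x. ennreal (exponential_density \<eta> x) * ennreal (exp (- s * x)) \<partial>lborel)"
    by (rule distributed_nn_integral[OF d, symmetric]) auto
  also have "\<dots> = (\<integral>\<^sup>+x. ennreal (\<eta> / (\<eta> + s)) * (if 0 < x then ennreal ((\<eta> + s) * exp (- (\<eta> + s) * x)) else 0) \<partial>lborel)"
  proof (rule nn_integral_cong_AE)
    show "AE x in lborel. ennreal (exponential_density \<eta> x) * ennreal (exp (- s * x)) = ennreal (\<eta> / (\<eta> + s)) * (if 0 < x then ennreal ((\<eta> + s) * exp (- (\<eta> + s) * x)) else 0)"
      using AE_lborel_singleton[of "0::real"]
    proof eventually_elim
      case (elim x)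
      have "\<eta> * exp (- x * \<eta>) * exp (- s * x) = \<eta> / (\<eta> + s) * ((\<eta> + s) * exp (- (\<eta> + s) * x))"
      proof -
        have "\<eta> / (\<eta> + s) * ((\<eta> + s) * z) = \<eta> * z" for z using s \<eta> by simp
        moreover have "exp (- (\<eta> + s) * x) = exp (- x * \<eta>) * exp (- s * x)" by (simp add: exp_add[symmetric] algebra_simps)
        ultimately show ?thesis by (simp only: mult.assoc)
      qed
      then show ?case using elim s \<eta> by (auto simp: exponential_density_def ennreal_mult[symmetric])
    qed
  qed
  also have "\<dots> = ennreal (\<eta> / (\<eta> + s))"
    using s \<eta> by (subst nn_integral_cmult) (auto simp: nn_integral_exponential_tail)
  finally have "(\<integral>\<^sup>+\<omega>. ennreal (exp (- s * V \<omega>)) \<partial>M) = ennreal (\<eta> / (\<eta> + s))" .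
  then show "expectation (\<lambda>\<omega>. exp (- s * V \<omega>)) = \<eta> / (\<eta> + s)"
    using s \<eta> by (subst integral_eq_nn_integral) auto
qed

text \<open>The density is given on sets; equality of measures on the open half-line extends this to
  integrals. At 0 the exponential is 1, so the atom accounts for exactly the subtracted
  probability.\<close>

lemma (in prob_space) positive_density_laplace:
  assumes P: "positive_density M Y P" and Ym: "Y t \<in> borel_measurable M" and Yn: "AE \<omega> in M. 0 \<le> Y t \<omega>"
    and t: "0 \<le> t" and \<theta>: "0 < \<theta>"
  shows "laplace (\<lambda>x. ennreal (P x t)) \<theta> = ennreal (expectation (\<lambda>\<omega>. exp (- \<theta> * Y t \<omega>)) - prob {\<omega> \<in> space M. Y t \<omega> = 0})"
proof -
  note [measurable] = Ym
  have "(\<lambda>(x, t). P x t) \<in> borel_measurable (borel \<Otimes>\<^sub>M borel)" using P by (simp add: positive_density_def borel_prod)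
  then have Pm [measurable]: "(\<lambda>x. P x t) \<in> borel_measurable borel" by measurable
  have dens: "emeasure M {\<omega> \<in> space M. Y t \<omega> \<in> A} = (\<integral>\<^sup>+x\<in>A. ennreal (P x t) \<partial>lborel)" if "A \<in> sets borel" "A \<subseteq> {0<..}" for A
    using P t that by (auto simp: positive_density_def)
  define N where "N = distr M borel (Y t)"
  have "density N (indicator {0<..}) = density lborel (\<lambda>x. ennreal (P x t) * indicator {0<..} x)"
  proof (rule measure_eqI)
    fix A assume "A \<in> sets (density N (indicator {0<..}))"
    then have A [measurable]: "A \<in> sets borel" by (simp add: N_def)
    have "emeasure (density N (indicator {0<..})) A = emeasure N (A \<inter> {0<..})"
      by (subst emeasure_density) (auto simp: N_def nn_integral_indicator[symmetric] indicator_inter_arith mult.commute simp del: nn_integral_indicator)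
    also have "\<dots> = emeasure M {\<omega> \<in> space M. Y t \<omega> \<in> A \<inter> {0<..}}"
      unfolding N_def by (subst emeasure_distr) (auto simp: vimage_def Int_def conj_commute intro!: arg_cong[where f="emeasure M"])
    also have "\<dots> = (\<integral>\<^sup>+x\<in>A \<inter> {0<..}. ennreal (P x t) \<partial>lborel)" by (rule dens) auto
    also have "\<dots> = emeasure (density lborel (\<lambda>x. ennreal (P x t) * indicator {0<..} x)) A"
      by (subst emeasure_density) (auto simp: indicator_inter_arith mult_ac intro!: nn_integral_cong)
    finally show "emeasure (density N (indicator {0<..})) A = emeasure (density lborel (\<lambda>x. ennreal (P x t) * indicator {0<..} x)) A" .
  qed (simp add: N_def)
  note eq = this
  have "laplace (\<lambda>x. ennreal (P x t)) \<theta> = (\<integral>\<^sup>+x. ennreal (exp (- \<theta> * x)) \<partial>density lborel (\<lambda>x. ennreal (P x t) * indicator {0<..} x))"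
    unfolding laplace_def by (subst nn_integral_density) (auto simp: indicator_def mult.commute intro!: nn_integral_cong)
  also have "\<dots> = (\<integral>\<^sup>+x. indicator {0<..} x * ennreal (exp (- \<theta> * x)) \<partial>N)"
    unfolding eq[symmetric] by (subst nn_integral_density) (auto simp: N_def)
  also have "\<dots> = (\<integral>\<^sup>+\<omega>. indicator {0<..} (Y t \<omega>) * ennreal (exp (- \<theta> * Y t \<omega>)) \<partial>M)"
    unfolding N_def by (subst nn_integral_distr) auto
  also have "\<dots> = (\<integral>\<^sup>+\<omega>. ennreal (exp (- \<theta> * Y t \<omega>) - indicator {\<omega> \<in> space M. Y t \<omega> = 0} \<omega>) \<partial>M)"
    using Yn AE_space by (intro nn_integral_cong_AE, eventually_elim) (auto simp: indicator_def)
  also have "\<dots> = ennreal (expectation (\<lambda>\<omega>. exp (- \<theta> * Y t \<omega>) - indicator {\<omega> \<in> space M. Y t \<omega> = 0} \<omega>))"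
  proof (rule nn_integral_eq_integral)
    show "integrable M (\<lambda>\<omega>. exp (- \<theta> * Y t \<omega>) - indicator {\<omega> \<in> space M. Y t \<omega> = 0} \<omega>)"
      using Yn \<theta> by (intro integrable_const_bound[of _ 1]) (auto simp: indicator_def elim!: eventually_mono)
    show "AE \<omega> in M. 0 \<le> exp (- \<theta> * Y t \<omega>) - indicator {\<omega> \<in> space M. Y t \<omega> = 0} \<omega>"
      by (auto simp: indicator_def)
  qed
  also have "expectation (\<lambda>\<omega>. exp (- \<theta> * Y t \<omega>) - indicator {\<omega> \<in> space M. Y t \<omega> = 0} \<omega>)
    = expectation (\<lambda>\<omega>. exp (- \<theta> * Y t \<omega>)) - prob {\<omega> \<in> space M. Y t \<omega> = 0}"
  proof -
    have "integrable M (\<lambda>\<omega>. exp (- \<theta> * Y t \<omega>))"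
      using Yn \<theta> by (intro integrable_const_bound[of _ 1]) (auto elim!: eventually_mono)
    moreover have "integrable M (indicator {\<omega> \<in> space M. Y t \<omega> = 0} :: 'a \<Rightarrow> real)"
      by (intro integrable_real_indicator) (auto simp: emeasure_eq_measure)
    ultimately show ?thesis by simp
  qed
  finally show ?thesis .
qed

lemma (in prob_space) distr_eq_of_laplace:
  fixes U V :: "'a \<Rightarrow> real"
  assumes [measurable]: "U \<in> borel_measurable M" "V \<in> borel_measurable M"
    and nn: "AE \<omega> in M. 0 \<le> U \<omega>" "AE \<omega> in M. 0 \<le> V \<omega>"
    and eq: "\<And>s. 0 < s \<Longrightarrow> expectation (\<lambda>\<omega>. exp (- s * U \<omega>)) = expectation (\<lambda>\<omega>. exp (- s * V \<omega>))"
  shows "distr M borel U = distr M borel V"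
proof (rule measure_eq_of_laplace)
  show "finite_measure (distr M borel U)" "finite_measure (distr M borel V)"
    by (intro finite_measure_distr; measurable)+
  show "AE x in distr M borel U. 0 \<le> x" "AE x in distr M borel V. 0 \<le> x"
    using nn by (subst AE_distr_iff; simp)+
  have d: "(LINT x|distr M borel W. exp (- real n * x)) = expectation (\<lambda>\<omega>. exp (- real n * W \<omega>))"
    if "W \<in> borel_measurable M" for W and n :: nat
    using that by (subst integral_distr) auto
  show "(LINT x|distr M borel U. exp (- real n * x)) = (LINT x|distr M borel V. exp (- real n * x))" for n
    unfolding d[OF assms(1)] d[OF assms(2)] using eq[of "real n"] by (cases "n = 0") auto
qed auto

theorem theorem4p4:
  fixes M :: "'a measure"
    and f g :: "real \<Rightarrow> real" and bf bg :: real and \<nu>f \<nu>g :: "real measure"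
    and lam eta :: real
    and Df Dg :: "real \<Rightarrow> 'a \<Rightarrow> real" and N :: "real \<Rightarrow> 'a \<Rightarrow> nat"
    and X X' :: "nat \<Rightarrow> 'a \<Rightarrow> real"
  defines "Ef \<equiv> inverse_process Df" and "Eg \<equiv> inverse_process Dg"
  defines "Y \<equiv> compound_process N Ef X" and "Y' \<equiv> compound_process N Ef X'"
  assumes "prob_space M"
    and "bernstein_function bf \<nu>f f" and "bernstein_function bg \<nu>g g"
    and "0 < lam" and "0 < eta"
    and "subordinator M f Df" and "subordinator M g Dg"
    and "poisson_process M lam N"
    and "iid_jumps M X" and "jumps_independent M N Ef X"
    and "\<And>i t. 1 \<le> i \<Longrightarrow> 0 \<le> t \<Longrightarrow>
           measure M {\<omega> \<in> space M. t < X i \<omega>} = (LINT \<omega>|M. exp (- eta * Eg t \<omega>))"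
    and "iid_jumps M X'" and "jumps_independent M N Ef X'"
    and "\<And>i. 1 \<le> i \<Longrightarrow> distributed M lborel (X' i) (exponential_density eta)"
    and "prob_space.indep_set M (process_events M {0..} Dg) (process_events M {0..} Y')"
  shows "(\<forall>t\<ge>0. distr M borel (Y t) = distr M borel (\<lambda>\<omega>. Dg (Y' t \<omega>) \<omega>)) \<and>
    (\<forall>P. positive_density M Y P \<longrightarrow>
       (equation_regular bf \<nu>f bg \<nu>g P \<longrightarrow>
          (AE x in lborel. 0 < x \<longrightarrow> (AE t in lborel. 0 < t \<longrightarrow>
             eta * caputo bf \<nu>f (\<lambda>r. P x r) t =
               - (lam * caputo bg \<nu>g (\<lambda>y. P y t) x
                  + caputo bf \<nu>f (\<lambda>r. caputo bg \<nu>g (\<lambda>y. P y r) x) t)))) \<and>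
       (AE x in lborel. 0 < x \<longrightarrow> P x 0 = 0)) \<and>
    (\<forall>t\<ge>0. measure M {\<omega> \<in> space M. 0 < Y t \<omega>} = 1 - (LINT \<omega>|M. exp (- lam * Ef t \<omega>)))"
proof -
  interpret prob_space M by fact
  interpret f: levy_subordinator M bf \<nu>f f Df by unfold_locales fact+
  interpret g: levy_subordinator M bg \<nu>g g Dg by unfold_locales fact+
  note lam = \<open>0 < lam\<close> and eta = \<open>0 < eta\<close>
  note N = \<open>poisson_process M lam N\<close>
  have iid: "iid_jumps M X" and ji: "jumps_independent M N f.E X"
    and iid': "iid_jumps M X'" and ji': "jumps_independent M N f.E X'"
    using \<open>iid_jumps M X\<close> \<open>jumps_independent M N Ef X\<close> \<open>iid_jumps M X'\<close> \<open>jumps_independent M N Ef X'\<close>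
    unfolding Ef_def by blast+
  have Xm: "X i \<in> borel_measurable M" if "1 \<le> i" for i
  proof -
    have "indep_vars (\<lambda>_. borel) X {1..}" using iid unfolding iid_jumps_def by blast
    then show ?thesis using that by (auto simp: indep_vars_def)
  qed
  have tail: "prob {\<omega> \<in> space M. t < X i \<omega>} = expectation (\<lambda>\<omega>. exp (- eta * g.E t \<omega>))" if "1 \<le> i" "0 \<le> t" for i t
    using assms(15)[OF that] by (simp add: Eg_def)
  note Xlaw = g.jump_law[OF eta Xm tail]
  have Xpos: "AE \<omega> in M. 0 < X i \<omega>" if "1 \<le> i" for i by (rule Xlaw(1)[OF that that])
  have Xlap: "expectation (\<lambda>\<omega>. exp (- s * X 1 \<omega>)) = eta / (eta + g s)" if "0 < s" for s
    by (rule Xlaw(2)[of 1]) (use that in auto)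
  have Xn: "AE \<omega> in M. 0 \<le> X i \<omega>" if "1 \<le> i" for i using Xpos[OF that] by eventually_elim simp
  have d': "distributed M lborel (X' i) (exponential_density eta)" if "1 \<le> i" for i using assms(18)[OF that] .
  have Xn': "AE \<omega> in M. 0 \<le> X' i \<omega>" if "1 \<le> i" for i by (rule exponential_laplace(1)[OF d'[OF that] eta])
  have Xlap': "expectation (\<lambda>\<omega>. exp (- s * X' 1 \<omega>)) = eta / (eta + s)" if "0 < s" for s
    by (rule exponential_laplace(2)[OF d' eta that]) simp
  note CX = f.compound_process_law[OF N lam ji iid Xn _ _ Xlap, folded Ef_def, folded Y_def]
  note CX' = f.compound_process_law[OF N lam ji' iid' Xn' _ _ Xlap', folded Ef_def, folded Y'_def]
  have Ym: "Y t \<in> borel_measurable M" and Yn: "AE \<omega> in M. 0 \<le> Y t \<omega>"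
    and K0: "prob {\<omega> \<in> space M. N (Ef t \<omega>) \<omega> = 0} = expectation (\<lambda>\<omega>. exp (- lam * Ef t \<omega>))"
    and Km: "(\<lambda>\<omega>. N (Ef t \<omega>) \<omega>) \<in> measurable M (count_space UNIV)" if "0 \<le> t" for t
    using CX(1,2,4,5)[of 1 t] that by auto
  have Ym': "Y' t \<in> borel_measurable M" and Yn': "AE \<omega> in M. 0 \<le> Y' t \<omega>" if "0 \<le> t" for t
    using CX'(1,2)[of 1 t] that by auto
  have YL: "expectation (\<lambda>\<omega>. exp (- s * Y t \<omega>)) = expectation (\<lambda>\<omega>. exp (- (lam * g s / (eta + g s)) * Ef t \<omega>))" if "0 < s" "0 \<le> t" for s t
  proof -
    have "lam * (1 - eta / (eta + g s)) = lam * g s / (eta + g s)"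
      using eta bernstein_pos[OF g.bern \<open>0 < s\<close>] by (simp add: field_simps)
    then show ?thesis using CX(3)[OF _ that(1) that(2) that(1)] by simp
  qed
  \<comment> \<open>Strict positivity of the jumps excludes that a non-empty sum is 0.\<close>
  have Y0: "AE \<omega> in M. Y t \<omega> = 0 \<longleftrightarrow> N (Ef t \<omega>) \<omega> = 0" if "0 \<le> t" for t
  proof -
    have "\<And>i. AE \<omega> in M. 1 \<le> i \<longrightarrow> 0 < X i \<omega>" using Xpos by auto
    then have "AE \<omega> in M. \<forall>i. 1 \<le> i \<longrightarrow> 0 < X i \<omega>" unfolding AE_all_countable by blast
    then show ?thesis
    proof eventually_elim
      case (elim \<omega>)
      have pos: "0 < (\<Sum>i = 1..n. X i \<omega>)" if "n \<noteq> 0" for n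
        using elim that by (intro sum_pos) auto
      have Yt: "Y t \<omega> = (\<Sum>i = 1..N (Ef t \<omega>) \<omega>. X i \<omega>)" unfolding Y_def compound_process_def ..
      show ?case
      proof (cases "N (Ef t \<omega>) \<omega> = 0")
        case True
        then show ?thesis unfolding Yt by simp
      next
        case False
        then show ?thesis using pos[OF False] unfolding Yt by linarith
      qed
    qed
  qed
  have PY0: "prob {\<omega> \<in> space M. Y t \<omega> = 0} = expectation (\<lambda>\<omega>. exp (- lam * Ef t \<omega>))" if t: "0 \<le> t" for t
  proof -
    note [measurable] = Ym[OF t] Km[OF t]
    have "prob {\<omega> \<in> space M. Y t \<omega> = 0} = prob {\<omega> \<in> space M. N (Ef t \<omega>) \<omega> = 0}"
      by (rule prob_eq_AE) (use Y0[OF t] in auto)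
    then show ?thesis using K0[OF t] by simp
  qed
  have law: "distr M borel (Y t) = distr M borel (\<lambda>\<omega>. Dg (Y' t \<omega>) \<omega>)" if t: "0 \<le> t" for t
  proof (rule distr_eq_of_laplace)
    note [measurable] = Ym'[OF t]
    show "(\<lambda>\<omega>. Dg (Y' t \<omega>) \<omega>) \<in> borel_measurable M" by measurable
    show "AE \<omega> in M. 0 \<le> Dg (Y' t \<omega>) \<omega>" using AE_space by eventually_elim (rule g.D_nonneg)
    fix s :: real assume s: "0 < s"
    note gp = bernstein_pos[OF g.bern s]
    \<comment> \<open>\<open>Dg\<close> turns \<open>s\<close> into \<open>g s\<close>, and an
      exponential jump has at \<open>g s\<close> the transform eta / (eta + g s), which is that of
      \<open>X\<close> at \<open>s\<close>. Both compound sums thus lead to the same rate in front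
      of \<open>Ef\<close>.\<close>
    have "expectation (\<lambda>\<omega>. exp (- s * Dg (Y' t \<omega>) \<omega>)) = expectation (\<lambda>\<omega>. exp (- g s * Y' t \<omega>))"
      by (rule g.subordination_laplace[OF assms(19) t Ym'[OF t] Yn'[OF t] s])
    also have "\<dots> = expectation (\<lambda>\<omega>. exp (- (lam * (1 - eta / (eta + g s))) * Ef t \<omega>))"
      by (rule CX'(3)[OF _ gp t gp])
    also have "\<dots> = expectation (\<lambda>\<omega>. exp (- s * Y t \<omega>))" by (rule CX(3)[OF _ s t s, symmetric])
    finally show "expectation (\<lambda>\<omega>. exp (- s * Y t \<omega>)) = expectation (\<lambda>\<omega>. exp (- s * Dg (Y' t \<omega>) \<omega>))" by simp
  qed (use Ym[OF t] Yn[OF t] in auto)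
  have pos: "prob {\<omega> \<in> space M. 0 < Y t \<omega>} = 1 - expectation (\<lambda>\<omega>. exp (- lam * Ef t \<omega>))" if t: "0 \<le> t" for t
  proof -
    note [measurable] = Ym[OF t]
    have "prob {\<omega> \<in> space M. 0 < Y t \<omega>} = prob {\<omega> \<in> space M. \<not> Y t \<omega> = 0}"
      by (rule prob_eq_AE) (use Yn[OF t] in \<open>auto elim!: eventually_mono\<close>)
    also have "\<dots> = 1 - prob {\<omega> \<in> space M. Y t \<omega> = 0}" by (rule prob_neg) measurable
    finally show ?thesis by (simp only: PY0[OF t])
  qed
  \<comment> \<open>At \<mu> = lam this is the probability of the atom at 0; at \<mu> = lam * g
    \<theta> / (eta + g \<theta>) it is the transform of \<open>Y t\<close> at \<theta>.\<close>
  define w where "w \<mu> t = expectation (\<lambda>\<omega>. exp (- \<mu> * Ef t \<omega>))" for \<mu> t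
  have wm [measurable]: "w \<mu> \<in> borel_measurable borel" if "0 < \<mu>" for \<mu>
    using f.expectation_exp_E_measurable[OF that] by (simp add: w_def[abs_def] Ef_def)
  have wl: "laplace (\<lambda>t. ennreal (w \<mu> t)) s = ennreal (f s / s / (\<mu> + f s))" if "0 < \<mu>" "0 < s" for \<mu> s
    using f.laplace_E[OF that] by (simp add: w_def Ef_def)
  have w0: "0 \<le> w \<mu> t" for \<mu> t unfolding w_def by (rule integral_nonneg_AE) auto
  have wi: "integrable M (\<lambda>\<omega>. exp (- \<mu> * Ef t \<omega>))" if "0 < \<mu>" for \<mu> t
    using f.E_exp_integrable[OF that] by (simp add: Ef_def)
  have wmono: "w \<mu>' t \<le> w \<mu> t" if "0 < \<mu>" "\<mu> \<le> \<mu>'" for \<mu> \<mu>' t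
    unfolding w_def
  proof (rule integral_mono_AE[OF wi wi])
    show "AE \<omega> in M. exp (- \<mu>' * Ef t \<omega>) \<le> exp (- \<mu> * Ef t \<omega>)"
      using f.E_nonneg[of t] by eventually_elim (use that in \<open>auto simp: Ef_def intro: mult_right_mono\<close>)
  qed (use that in auto)
  have w1: "w \<mu> t \<le> 1" if "0 < \<mu>" for \<mu> t
  proof -
    have "w \<mu> t \<le> expectation (\<lambda>\<omega>. 1)" unfolding w_def
      using f.E_nonneg[of t] that by (intro integral_mono_AE wi) (auto simp: Ef_def elim!: eventually_mono)
    then show ?thesis by (simp add: prob_space)
  qed
  \<comment> \<open>The law at time 0 has no mass on the positive half-line. A density is determined
    only up to null sets, so the conclusion is for almost every \<open>x\<close>.\<close>
  have dens: "AE x in lborel. 0 < x \<longrightarrow> P x 0 = 0" if P: "positive_density M Y P" for P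
  proof -
    have "(\<lambda>(x, t). P x t) \<in> borel_measurable (borel \<Otimes>\<^sub>M borel)" using P by (simp add: positive_density_def borel_prod)
    then have [measurable]: "(\<lambda>x. P x 0) \<in> borel_measurable borel" by measurable
    have "prob {\<omega> \<in> space M. 0 < Y 0 \<omega>} = 0"
      unfolding pos[OF order_refl] using f.expectation_exp_E_0[OF lam] by (simp add: Ef_def)
    then have "emeasure M {\<omega> \<in> space M. Y 0 \<omega> \<in> {0<..}} = 0" by (simp add: emeasure_eq_measure)
    moreover have "emeasure M {\<omega> \<in> space M. Y 0 \<omega> \<in> {0<..}} = (\<integral>\<^sup>+x\<in>{0<..}. ennreal (P x 0) \<partial>lborel)"
      using P unfolding positive_density_def by (meson order_refl borel_open open_greaterThan)
    ultimately have "(\<integral>\<^sup>+x\<in>{0<..}. ennreal (P x 0) \<partial>lborel) = 0" by simp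
    then have "AE x in lborel. ennreal (P x 0) * indicator {0<..} x = 0"
      by (subst (asm) nn_integral_0_iff_AE) auto
    then show ?thesis
    proof eventually_elim
      case (elim x)
      have "0 \<le> P x 0" using P by (simp add: positive_density_def)
      then show ?case using elim by (auto simp: ennreal_eq_0_iff)
    qed
  qed
  have eqn: "AE x in lborel. 0 < x \<longrightarrow> (AE t in lborel. 0 < t \<longrightarrow>
     eta * caputo bf \<nu>f (\<lambda>r. P x r) t =
       - (lam * caputo bg \<nu>g (\<lambda>y. P y t) x + caputo bf \<nu>f (\<lambda>r. caputo bg \<nu>g (\<lambda>y. P y r) x) t))"
    if P: "positive_density M Y P" and reg: "equation_regular bf \<nu>f bg \<nu>g P" for P
  proof -
    have PL: "laplace (\<lambda>x. ennreal (P x t)) \<theta> = ennreal (w (lam * g \<theta> / (eta + g \<theta>)) t - w lam t)" if "0 < \<theta>" "0 \<le> t" for \<theta> t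
      using positive_density_laplace[OF P Ym[OF that(2)] Yn[OF that(2)] that(2) that(1)]
      unfolding YL[OF that] PY0[OF that(2)] by (simp add: w_def)
    interpret subordinated_density bf bg \<nu>f \<nu>g f g lam eta P "w lam"
    proof
      show "laplace (\<lambda>t. laplace (\<lambda>x. ennreal (P x t)) \<theta>) s
        = ennreal (f s / s * (1 / (lam * g \<theta> / (eta + g \<theta>) + f s) - 1 / (lam + f s)))"
        if \<theta>: "0 < \<theta>" and s: "0 < s" for \<theta> s
      proof -
        note gp = bernstein_pos[OF g.bern \<theta>] and fp = bernstein_pos[OF f.bern s]
        let ?\<mu> = "lam * g \<theta> / (eta + g \<theta>)"
        have \<mu>: "0 < ?\<mu>" "?\<mu> \<le> lam" using lam eta gp by (auto simp: divide_simps)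
        have [measurable]: "w ?\<mu> \<in> borel_measurable borel" "w lam \<in> borel_measurable borel" using wm \<mu> lam by auto
        \<comment> \<open>The transform of \<open>w lam\<close> is added on both sides and cancelled
          at the end, which avoids subtraction in \<open>ennreal\<close>; \<open>wmono\<close> makes
          the difference inside non-negative.\<close>
        have "laplace (\<lambda>t. laplace (\<lambda>x. ennreal (P x t)) \<theta>) s + laplace (\<lambda>t. ennreal (w lam t)) s
          = laplace (\<lambda>t. ennreal (w ?\<mu> t - w lam t)) s + laplace (\<lambda>t. ennreal (w lam t)) s"
          using PL[OF \<theta>] by (intro arg_cong2[where f="(+)"] laplace_cong) auto
        also have "\<dots> = laplace (\<lambda>t. ennreal (w ?\<mu> t - w lam t) + ennreal (w lam t)) s"
          by (rule laplace_add[symmetric]) measurable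
        also have "\<dots> = laplace (\<lambda>t. ennreal (w ?\<mu> t)) s"
          using wmono[OF \<mu>] w0 by (intro laplace_cong) (simp add: ennreal_plus[symmetric] del: ennreal_plus)
        also have "\<dots> = ennreal (f s / s / (?\<mu> + f s))" by (rule wl[OF \<mu>(1) s])
        also have "\<dots> = ennreal (f s / s * (1 / (?\<mu> + f s) - 1 / (lam + f s))) + ennreal (f s / s / (lam + f s))"
        proof -
          have "1 / (lam + f s) \<le> 1 / (?\<mu> + f s)" using \<mu> fp by (intro divide_left_mono) auto
          then have "0 \<le> f s / s * (1 / (?\<mu> + f s) - 1 / (lam + f s))" using fp s by (intro mult_nonneg_nonneg) auto
          moreover have "0 \<le> f s / s / (lam + f s)" using fp s lam by simp
          moreover have "f s / s / (?\<mu> + f s) = f s / s * (1 / (?\<mu> + f s) - 1 / (lam + f s)) + f s / s / (lam + f s)"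
            by (simp add: right_diff_distrib)
          ultimately show ?thesis by (metis ennreal_plus)
        qed
        finally show ?thesis
          unfolding wl[OF lam s] by (simp add: add.commute[of _ "ennreal (f s / s / (lam + f s))"] ennreal_add_left_cancel)
      qed
      show "laplace (\<lambda>x. ennreal (P x t)) 1 < \<infinity>" if "0 \<le> t" for t by (simp add: PL that)
    qed (use P reg wm[OF lam] w0 w1[OF lam] wl[OF lam] lam eta f.bern g.bern dens[OF P] in \<open>simp_all add: positive_density_def\<close>)
    show ?thesis by (rule density_equation)
  qed
  show ?thesis using law pos dens eqn by blast
qed

end
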